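(* Let $0<\alpha<mn$, let $1<p_1,\dots,p_m<\infty$, $\frac1p=\frac1{p_1}+\cdots+\frac1{p_m}$, and let $p<q<\infty$ satisfy $\frac1q=\frac1p-\frac{\alpha}{n}$. Let $\vec\omega=(\omega_1,\dots,\omega_m)$ be weights on $\mathbb{R}^n$ and $\nu_{\vec\omega}=\prod_{i=1}^m\omega_i$. Then $\vec\omega\in A_{(\vec p,q),\mathcal{R}}$ if and only if either of the following two inequalities holds (that is, membership is equivalent to (1), and membership is equivalent to (2)): (1) there is a constant $C$ such that for all $\vec f=(f_1,\dots,f_m)$, $$\|\mathcal{M}_{\mathcal{R},\alpha}(\vec f)\|_{L^{q,\infty}(\nu_{\vec\omega}^q)}\le C\prod_{i=1}^m\|f_i\|_{L^{p_i}(\omega_i^{p_i})};$$ (2) there is a constant $C$ such that for all $\vec f=(f_1,\dots,f_m)$, $$\|\mathcal{M}_{\mathcal{R},\alpha}(\vec f)\|_{L^{q}(\nu_{\vec\omega}^q)}\le C\prod_{i=1}^m\|f_i\|_{L^{p_i}(\omega_i^{p_i})}.$$ The analogous equivalences hold with $\mathcal{M}_{\mathcal{R},\alpha}$ replaced by its dyadic version $\mathcal{M}^d_{\mathcal{R},\alpha}$ and $A_{(\vec p,q),\mathcal{R}}$ replaced by its dyadic version $A^d_{(\vec p,q),\mathcal{R}}$.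
   Context: $m,n\ge1$ are integers, $\vec p=(p_1,\dots,p_m)$, $p_i'=p_i/(p_i-1)$. A weight is a nonnegative measurable function on $\mathbb{R}^n$. $\mathcal{R}$ is the family of all rectangles (products of $n$ bounded nondegenerate intervals) in $\mathbb{R}^n$ with sides parallel to the coordinate axes; $\mathcal{DR}\subset\mathcal{R}$ is the family of all dyadic rectangles, i.e. products of $n$ dyadic intervals (of possibly different lengths). For $\vec f=(f_1,\dots,f_m)$ with each $f_i$ locally integrable on $\mathbb{R}^n$, the multilinear fractional strong maximal operator is $$\mathcal{M}_{\mathcal{R},\alpha}(\vec f)(x)=\sup_{R\ni x,\,R\in\mathcal{R}}\ \prod_{i=1}^m\frac1{|R|^{1-\frac{\alpha}{mn}}}\int_R|f_i(y_i)|\,dy_i,\qquad x\in\mathbb{R}^n,$$ and its dyadic version $\mathcal{M}^d_{\mathcal{R},\alpha}$ is defined in the same way with the supremum over $R\in\mathcal{DR}$, $R\ni x$. The class $A_{(\vec p,q),\mathcal{R}}$ consists of all $\vec\omega=(\omega_1,\dots,\omega_m)$ with each $\omega_i$ a nonnegative function on $\mathbb{R}^n$ such that, with $\nu_{\vec\omega}=\prod_{i=1}^m\omega_i$, $$\sup_{R\in\mathcal{R}}\left(\frac1{|R|}\int_R\nu_{\vec\omega}^q\,dx\right)^{\frac1q}\prod_{i=1}^m\left(\frac1{|R|}\int_R\omega_i^{-p_i'}\,dx\right)^{\frac1{p_i'}}<\infty .$$ $A^d_{(\vec p,q),\mathcal{R}}$ is defined in the same way with the supremum over $R\in\mathcal{DR}$.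 $\|g\|_{L^{r}(\mu)}=(\int_{\mathbb{R}^n}|g|^r\mu\,dx)^{1/r}$ and $\|g\|_{L^{q,\infty}(\mu)}=\sup_{\lambda>0}\lambda\,\mu(\{x:|g(x)|>\lambda\})^{1/q}$, where $\mu(E)=\int_E\mu\,dx$. *)

theory Defs
  imports "HOL-Analysis.Analysis"
begin

text \<open>
  Real powers on [0,\<infinity>]. For a negative exponent, 0 is sent to \<infinity> and \<infinity> to 0. Products in
  \<^typ>\<open>ennreal\<close> use the library convention 0 * \<infinity> = 0.
\<close>

definition epowr :: "ennreal \<Rightarrow> real \<Rightarrow> ennreal" where
  "epowr x r =
     (if r = 0 then 1
      else if x = 0 then (if r < 0 then \<infinity> else 0)
      else if x = \<infinity> then (if r < 0 then 0 else \<infinity>)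
      else ennreal (enn2real x powr r))"

definition rectangles :: "(real ^ 'n) set set" where
  "rectangles = {R. \<exists>I :: 'n \<Rightarrow> real set.
     (\<forall>j. is_interval (I j) \<and> bounded (I j) \<and> interior (I j) \<noteq> {}) \<and>
     R = {x. \<forall>j. x $ j \<in> I j}}"

definition dyadic_intervals :: "real set set" where
  "dyadic_intervals =
     {{real_of_int l * 2 powi k ..< (real_of_int l + 1) * 2 powi k} | k l :: int. True}"

definition dyadic_rectangles :: "(real ^ 'n) set set" where
  "dyadic_rectangles = {R. \<exists>I :: 'n \<Rightarrow> real set.
     (\<forall>j. I j \<in> dyadic_intervals) \<and> R = {x. \<forall>j. x $ j \<in> I j}}"

definition weight :: "(real ^ 'n \<Rightarrow> real) \<Rightarrow> bool" where
  "weight w \<longleftrightarrow> w \<in> borel_measurable lebesgue \<and> (\<forall>x. 0 \<le> w x)"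

definition locally_integrable :: "(real ^ 'n \<Rightarrow> real) \<Rightarrow> bool" where
  "locally_integrable f \<longleftrightarrow> (\<forall>K. compact K \<longrightarrow> f absolutely_integrable_on K)"

text \<open>
  The operator and the weight class below are parametrised by the family \<open>\<B>\<close> of admissible sets, to
  be instantiated by \<^const>\<open>rectangles\<close> or \<^const>\<open>dyadic_rectangles\<close>. The dimensions
  \<open>n\<close> and \<open>m\<close> are the cardinalities of the index types \<open>'n\<close> and \<open>'m\<close>.
\<close>

definition frac_maximal ::
  "(real ^ 'n) set set \<Rightarrow> real \<Rightarrow> ('m::finite \<Rightarrow> real ^ 'n \<Rightarrow> real) \<Rightarrow> real ^ 'n \<Rightarrow> ennreal" where
  "frac_maximal \<B> \<alpha> f x =
     (SUP R \<in> {R \<in> \<B>. x \<in> R}.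
        \<Prod>i\<in>UNIV. (\<integral>\<^sup>+y\<in>R. ennreal \<bar>f i y\<bar> \<partial>lebesgue) /
          ennreal (measure lebesgue R powr (1 - \<alpha> / (real CARD('m) * real CARD('n)))))"

definition conj_exp :: "real \<Rightarrow> real" where
  "conj_exp r = r / (r - 1)"

definition weight_prod :: "('m::finite \<Rightarrow> real ^ 'n \<Rightarrow> real) \<Rightarrow> real ^ 'n \<Rightarrow> real" where
  "weight_prod \<omega> x = (\<Prod>i\<in>UNIV. \<omega> i x)"

definition average :: "(real ^ 'n) set \<Rightarrow> (real ^ 'n \<Rightarrow> ennreal) \<Rightarrow> ennreal" where
  "average R g = (\<integral>\<^sup>+x\<in>R. g x \<partial>lebesgue) / emeasure lebesgue R"

definition A_class ::
  "(real ^ 'n) set set \<Rightarrow> ('m::finite \<Rightarrow> real) \<Rightarrow> real \<Rightarrow> ('m \<Rightarrow> real ^ 'n \<Rightarrow> real) set" where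
  "A_class \<B> p q = {\<omega>. (\<forall>i. weight (\<omega> i)) \<and>
     (SUP R \<in> \<B>.
        epowr (average R (\<lambda>x. epowr (ennreal (weight_prod \<omega> x)) q)) (1 / q) *
        (\<Prod>i\<in>UNIV. epowr (average R (\<lambda>x. epowr (ennreal (\<omega> i x)) (- conj_exp (p i))))
                         (1 / conj_exp (p i)))) < \<infinity>}"

text \<open>
  The norms of \<open>L\<^sup>r(\<mu>)\<close> and of weak \<open>L\<^sup>r(\<mu>)\<close>, as elements of [0,\<infinity>], for the measure with density
  \<open>\<mu>\<close> with respect to Lebesgue measure. The argument \<open>g\<close> is the modulus of the function, because
  maximal functions may take the value \<infinity>.
\<close>

definition Lnorm :: "real \<Rightarrow> (real ^ 'n \<Rightarrow> ennreal) \<Rightarrow> (real ^ 'n \<Rightarrow> ennreal) \<Rightarrow> ennreal" where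
  "Lnorm r \<mu> g = epowr (\<integral>\<^sup>+x. epowr (g x) r * \<mu> x \<partial>lebesgue) (1 / r)"

definition weak_Lnorm :: "real \<Rightarrow> (real ^ 'n \<Rightarrow> ennreal) \<Rightarrow> (real ^ 'n \<Rightarrow> ennreal) \<Rightarrow> ennreal" where
  "weak_Lnorm r \<mu> g =
     (SUP t \<in> {0<..}. ennreal t *
        epowr (\<integral>\<^sup>+x\<in>{x. g x > ennreal t}. \<mu> x \<partial>lebesgue) (1 / r))"

definition weak_type_bound ::
  "(real ^ 'n) set set \<Rightarrow> real \<Rightarrow> ('m::finite \<Rightarrow> real) \<Rightarrow> real \<Rightarrow> ('m \<Rightarrow> real ^ 'n \<Rightarrow> real) \<Rightarrow> bool" where
  "weak_type_bound \<B> \<alpha> p q \<omega> \<longleftrightarrow>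
     (\<exists>C::real. \<forall>f. (\<forall>i. locally_integrable (f i)) \<longrightarrow>
        weak_Lnorm q (\<lambda>x. epowr (ennreal (weight_prod \<omega> x)) q) (frac_maximal \<B> \<alpha> f)
        \<le> ennreal C * (\<Prod>i\<in>UNIV.
             Lnorm (p i) (\<lambda>x. epowr (ennreal (\<omega> i x)) (p i)) (\<lambda>x. ennreal \<bar>f i x\<bar>)))"

definition strong_type_bound ::
  "(real ^ 'n) set set \<Rightarrow> real \<Rightarrow> ('m::finite \<Rightarrow> real) \<Rightarrow> real \<Rightarrow> ('m \<Rightarrow> real ^ 'n \<Rightarrow> real) \<Rightarrow> bool" where
  "strong_type_bound \<B> \<alpha> p q \<omega> \<longleftrightarrow>
     (\<exists>C::real. \<forall>f. (\<forall>i. locally_integrable (f i)) \<longrightarrow>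
        Lnorm q (\<lambda>x. epowr (ennreal (weight_prod \<omega> x)) q) (frac_maximal \<B> \<alpha> f)
        \<le> ennreal C * (\<Prod>i\<in>UNIV.
             Lnorm (p i) (\<lambda>x. epowr (ennreal (\<omega> i x)) (p i)) (\<lambda>x. ennreal \<bar>f i x\<bar>)))"

end

theory Submission
  imports Defs
begin

text \<open>
  Write \<open>\<sigma>\<^sub>i = \<omega>\<^sub>i\<^bsup>-p\<^sub>i'\<^esup>\<close>, \<open>V = \<nu>\<^bsup>q\<^esup>\<close> and \<open>\<kappa> = m - \<alpha>/n = 1/q + \<Sum>\<^sub>i 1/p\<^sub>i'\<close>. For a single rectangle the weight
  condition says \<open>V(R)\<^bsup>1/q\<^esup> \<Prod>\<^sub>i \<sigma>\<^sub>i(R)\<^bsup>1/p\<^sub>i'\<^esup> \<le> K |R|\<^bsup>\<kappa>\<^esup>\<close> with \<open>K\<close> independent of \<open>R\<close>.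

  Necessity. Testing the weak type inequality with a truncation of \<open>\<sigma>\<^sub>i 1\<^sub>R\<close> in place of \<open>f\<^sub>i\<close> makes
  the maximal function at least \<open>|R|\<^bsup>-\<kappa>\<^esup> \<Prod>\<^sub>i \<integral>\<^sub>R f\<^sub>i\<close> on all of \<open>R\<close>, while the norm of \<open>f\<^sub>i\<close> is at
  most \<open>(\<integral>\<^sub>R f\<^sub>i)\<^bsup>1/p\<^sub>i\<^esup>\<close>; removing the truncation gives the condition. The strong type inequality
  implies the weak one by Chebyshev's inequality.

  Sufficiency. Because \<open>q > P\<close>, the supremum over dyadic rectangles may be replaced by the sum over
  all of them. With \<open>F\<^sub>i(R) = \<sigma>\<^sub>i(R)\<^bsup>-1/p\<^sub>i'\<^esup> \<integral>\<^sub>R |f\<^sub>i|\<close> the weight condition bounds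
  \<open>(|R|\<^bsup>-\<kappa>\<^esup> \<Prod>\<^sub>i \<integral>\<^sub>R |f\<^sub>i|)\<^bsup>q\<^esup> V(R)\<close> by \<open>K\<^bsup>q\<^esup> \<Prod>\<^sub>i F\<^sub>i(R)\<^bsup>q\<^esup>\<close>, and Hoelder's inequality for sums with
  exponents \<open>P/p\<^sub>i\<close> reduces the strong type inequality to the linear embedding
  \<open>\<Sum>\<^sub>R F\<^sub>i(R)\<^bsup>p\<^sub>i t\<^esup> \<le> C (\<integral> |f\<^sub>i|\<^bsup>p\<^sub>i\<^esup> \<omega>\<^sub>i\<^bsup>p\<^sub>i\<^esup>)\<^bsup>t\<^esup>\<close> with \<open>t = q/P > 1\<close>, which is \<open>dyadic_embedding\<close>.

  The embedding rests on reverse doubling: halving a rectangle on one side multiplies \<open>\<sigma>\<^sub>i\<close> by at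
  most some \<open>\<gamma> < 1\<close>. This follows from the weight condition, since Hoelder's inequality bounds
  \<open>|E|\<^bsup>\<kappa>\<^esup>\<close> by \<open>V(E)\<^bsup>1/q\<^esup> \<Prod>\<^sub>i \<sigma>\<^sub>i(E)\<^bsup>1/p\<^sub>i'\<^esup>\<close> for \<open>E \<subseteq> R\<close> if \<open>V(R) \<noteq> 0\<close>
  (\<open>measure_le_masses\<close>), so that neither half of \<open>R\<close> can carry a negligible part of \<open>\<sigma>\<^sub>i(R)\<close>.
  In one variable, \<open>F = F\<^sub>i\<close> satisfies
  \<open>F(I) \<le> \<gamma>\<^bsup>1/p'\<^esup> (F(I') + F(I''))\<close> and \<open>F(I)\<^bsup>p\<^esup> \<le> F(I')\<^bsup>p\<^esup> + F(I'')\<^bsup>p\<^esup>\<close> for the two halves of \<open>I\<close>, and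
  these two inequalities alone give the embedding for the tree of all intervals above a fixed
  level, by telescoping a Bellman function (\<open>bellman_step\<close>, \<open>dyadic_tree_summation\<close>). In several
  variables the one-variable bounds are iterated with Minkowski's inequality
  (\<open>tensorized_summation\<close>). The iteration works with the values \<open>F\<^sub>i(R)\<close> alone, and this is why it
  applies to densities \<open>\<sigma>\<^sub>i\<close> that are not products. Finally an arbitrary rectangle lies in a union
  of \<open>2\<^bsup>n\<^esup>\<close> adjacent dyadic ones of comparable size, and this transfers the argument to the full
  family of rectangles.

  Where the weights degenerate, only rectangles with \<open>V(R) \<noteq> 0\<close> contribute. On them all
  \<open>\<sigma>\<^sub>i(R)\<close> are positive and finite, and among dyadic rectangles this property passes to halves and
  to parents.
\<close>

section \<open>Powers and Hoelder's inequality on [0,\<infinity>]\<close>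

lemma epowr_zero_exp [simp]: "epowr x 0 = 1"
  by (simp add: epowr_def)

lemma epowr_ennreal: "0 \<le> x \<Longrightarrow> 0 < r \<Longrightarrow> epowr (ennreal x) r = ennreal (x powr r)"
  by (auto simp: epowr_def ennreal_eq_0_iff)

lemma epowr_ennreal_pos: "0 < x \<Longrightarrow> epowr (ennreal x) r = ennreal (x powr r)"
  by (auto simp: epowr_def ennreal_eq_0_iff)

lemma epowr_0 [simp]: "0 < r \<Longrightarrow> epowr 0 r = 0"
  by (simp add: epowr_def)

lemma epowr_top [simp]: "0 < r \<Longrightarrow> epowr top r = top"
  by (simp add: epowr_def)

lemma epowr_1 [simp]: "epowr 1 r = 1"
  using epowr_ennreal_pos[of 1 r] by simp

lemma epowr_one [simp]: "epowr x 1 = x"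
  by (cases x) (auto simp: epowr_ennreal)

lemma epowr_eq_0_iff: "0 < r \<Longrightarrow> epowr x r = 0 \<longleftrightarrow> x = 0"
  by (cases x) (auto simp: epowr_ennreal ennreal_eq_0_iff)

lemma epowr_eq_top_iff: "0 < r \<Longrightarrow> epowr x r = top \<longleftrightarrow> x = top"
  by (cases x) (auto simp: epowr_ennreal)

lemma epowr_mono: "0 \<le> r \<Longrightarrow> x \<le> y \<Longrightarrow> epowr x r \<le> epowr y r"
proof (cases "r = 0")
  case False
  assume "0 \<le> r" "x \<le> y"
  with False have "0 < r" by simp
  then show ?thesis using \<open>x \<le> y\<close>
    by (cases x; cases y) (auto simp: epowr_ennreal top_unique intro!: ennreal_leI powr_mono2)
qed simp

lemma epowr_epowr: "epowr (epowr x r) s = epowr x (r * s)"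
proof (cases "r = 0 \<or> s = 0")
  case False
  then have rs: "r \<noteq> 0" "s \<noteq> 0" by auto
  consider "x = 0" | "x = top" | a where "x = ennreal a" "0 < a"
    by (cases x) (auto simp: less_le)
  then show ?thesis
  proof cases
    case 3
    then show ?thesis by (simp add: epowr_ennreal_pos powr_powr)
  qed (use rs in \<open>auto simp: epowr_def zero_less_mult_iff mult_less_0_iff\<close>)
qed auto

lemma epowr_mult: "0 \<le> r \<Longrightarrow> epowr (x * y) r = epowr x r * epowr y r"
proof (cases "r = 0")
  case False
  assume "0 \<le> r"
  with False have "0 < r" by simp
  then show ?thesis
    by (cases x; cases y)
       (auto simp: epowr_ennreal ennreal_mult[symmetric] ennreal_top_mult ennreal_mult_top powr_mult epowr_eq_0_iff)
qed simp

lemma epowr_prod: "0 \<le> r \<Longrightarrow> epowr (\<Prod>i\<in>I. f i) r = (\<Prod>i\<in>I. epowr (f i) r)"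
  by (induction I rule: infinite_finite_induct) (auto simp: epowr_mult)

lemma epowr_add: "0 < r \<Longrightarrow> 0 < s \<Longrightarrow> epowr x (r + s) = epowr x r * epowr x s"
  by (cases x) (auto simp: epowr_ennreal ennreal_mult[symmetric] powr_add)

lemma epowr_le_iff: "0 < r \<Longrightarrow> epowr x r \<le> y \<longleftrightarrow> x \<le> epowr y (1 / r)"
  using epowr_mono[of r x "epowr y (1/r)"] epowr_mono[of "1/r" "epowr x r" y]
  by (auto simp: epowr_epowr)

lemma epowr_antimono:
  assumes "r \<le> 0" "x \<le> y"
  shows "epowr y r \<le> epowr x r"
proof (cases "r = 0")
  case False
  then have r: "r < 0" using assms by simp
  consider "x = 0" | "y = top" | a b where "x = ennreal a" "0 < a" "y = ennreal b" "a \<le> b"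
    using assms(2) by (cases x; cases y) (auto simp: less_le top_unique)
  then show ?thesis
  proof cases
    case 3
    then show ?thesis using r by (simp add: epowr_ennreal_pos powr_mono2')
  qed (use r in \<open>auto simp: epowr_def\<close>)
qed simp

lemma epowr_sum_le:
  fixes a :: "'e \<Rightarrow> ennreal"
  assumes E: "finite E" and s: "0 < s"
  shows "epowr (\<Sum>e\<in>E. a e) s \<le> ennreal (real (card E) powr s) * (\<Sum>e\<in>E. epowr (a e) s)"
proof (cases "E = {}")
  case False
  have "Max (a ` E) \<in> a ` E" using E False by (intro Max_in) auto
  then obtain e where e: "e \<in> E" "a e = Max (a ` E)" by auto
  have "(\<Sum>e\<in>E. a e) \<le> of_nat (card E) * a e"
    using E e by (intro sum_bounded_above) auto
  then have "epowr (\<Sum>e\<in>E. a e) s \<le> epowr (ennreal (real (card E)) * a e) s"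
    using s by (intro epowr_mono) (auto simp: ennreal_of_nat_eq_real_of_nat)
  also have "\<dots> = ennreal (real (card E) powr s) * epowr (a e) s"
    using s by (simp add: epowr_mult epowr_ennreal)
  also have "\<dots> \<le> ennreal (real (card E) powr s) * (\<Sum>e\<in>E. epowr (a e) s)"
    using E e by (intro mult_left_mono member_le_sum) auto
  finally show ?thesis .
qed (use s in simp)

lemma epowr_measurable [measurable]: "(\<lambda>x. epowr x r) \<in> borel_measurable borel"
  unfolding epowr_def by measurable

text \<open>
  Jensen's inequality for the exponential function.
\<close>

lemma weighted_AM_GM:
  fixes l a :: "'i \<Rightarrow> real"
  assumes "finite I" "I \<noteq> {}" "\<And>i. i \<in> I \<Longrightarrow> 0 < l i" "(\<Sum>i\<in>I. l i) = 1" "\<And>i. i \<in> I \<Longrightarrow> 0 \<le> a i"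
  shows "(\<Prod>i\<in>I. a i powr l i) \<le> (\<Sum>i\<in>I. l i * a i)"
proof (cases "\<exists>i\<in>I. a i = 0")
  case True
  then have "(\<Prod>i\<in>I. a i powr l i) = 0"
    using assms(1) by (intro prod_zero) auto
  also have "\<dots> \<le> (\<Sum>i\<in>I. l i * a i)"
    using assms by (intro sum_nonneg mult_nonneg_nonneg) (auto simp: less_imp_le)
  finally show ?thesis .
next
  case False
  then have pos: "\<And>i. i \<in> I \<Longrightarrow> 0 < a i" using assms(5) by (force simp: less_le)
  have "(\<Prod>i\<in>I. a i powr l i) = exp (\<Sum>i\<in>I. l i *\<^sub>R ln (a i))"
    using assms(1) pos by (auto simp: exp_sum powr_def less_imp_neq[symmetric] intro!: prod.cong)
  also have "\<dots> \<le> (\<Sum>i\<in>I. l i * exp (ln (a i)))"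
    by (rule convex_on_sum[OF assms(1,2) exp_convex]) (use assms in \<open>auto simp: less_imp_le\<close>)
  also have "\<dots> = (\<Sum>i\<in>I. l i * a i)"
    using pos by (intro sum.cong) auto
  finally show ?thesis .
qed

lemma weighted_AM_GM_ennreal:
  fixes l :: "'i \<Rightarrow> real" and a :: "'i \<Rightarrow> ennreal"
  assumes I: "finite I" "I \<noteq> {}" and l: "\<And>i. i \<in> I \<Longrightarrow> 0 < l i" "(\<Sum>i\<in>I. l i) = 1"
  shows "(\<Prod>i\<in>I. epowr (a i) (l i)) \<le> (\<Sum>i\<in>I. ennreal (l i) * a i)"
proof (cases "\<exists>i\<in>I. a i = top")
  case True
  then obtain i where i: "i \<in> I" "a i = top" by auto
  have "(\<Sum>i\<in>I. ennreal (l i) * a i) = top"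
    using i I l(1)[OF i(1)] by (subst ennreal_sum_eq_top) (auto simp: ennreal_mult_top intro!: bexI[of _ i])
  then show ?thesis by simp
next
  case False
  then have a: "a i = ennreal (enn2real (a i))" if "i \<in> I" for i
    using that by (simp add: less_top)
  have "(\<Prod>i\<in>I. epowr (a i) (l i)) = (\<Prod>i\<in>I. ennreal (enn2real (a i) powr l i))"
    by (intro prod.cong refl, subst a) (auto simp: epowr_ennreal l)
  also have "\<dots> = ennreal (\<Prod>i\<in>I. enn2real (a i) powr l i)"
    by (rule prod_ennreal) auto
  also have "\<dots> \<le> ennreal (\<Sum>i\<in>I. l i * enn2real (a i))"
    by (intro ennreal_leI weighted_AM_GM) (use I l in auto)
  also have "\<dots> = (\<Sum>i\<in>I. ennreal (l i * enn2real (a i)))"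
    using l by (intro sum_ennreal[symmetric]) (auto simp: less_imp_le)
  also have "\<dots> = (\<Sum>i\<in>I. ennreal (l i) * a i)"
    using l a by (intro sum.cong refl) (auto simp: ennreal_mult less_imp_le)
  finally show ?thesis .
qed

text \<open>
  Once every function is divided by its integral, the inequality follows by integrating the
  weighted inequality of arithmetic and geometric means. The degenerate integrals fit in because
  \<open>0 * \<infinity> = 0\<close>: if one integral vanishes, the product of the functions vanishes almost everywhere;
  otherwise an infinite integral makes the right-hand side infinite.
\<close>

lemma Holder_nn_integral_prod:
  fixes f :: "'i \<Rightarrow> 'a \<Rightarrow> ennreal"
  assumes I: "finite I" "I \<noteq> {}" and l: "\<And>i. i \<in> I \<Longrightarrow> 0 < l i" "(\<Sum>i\<in>I. l i) = 1"
    and f [measurable]: "\<And>i. i \<in> I \<Longrightarrow> f i \<in> borel_measurable M"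
  shows "(\<integral>\<^sup>+x. (\<Prod>i\<in>I. epowr (f i x) (l i)) \<partial>M) \<le> (\<Prod>i\<in>I. epowr (\<integral>\<^sup>+x. f i x \<partial>M) (l i))"
proof -
  define F where "F i = (\<integral>\<^sup>+x. f i x \<partial>M)" for i
  consider (zero) "\<exists>i\<in>I. F i = 0" | (top) "\<forall>i\<in>I. F i \<noteq> 0" "\<exists>i\<in>I. F i = top"
    | (fin) "\<forall>i\<in>I. F i \<noteq> 0 \<and> F i \<noteq> top" by auto
  then show ?thesis
  proof cases
    case zero
    then obtain i where i: "i \<in> I" "F i = 0" by auto
    have "AE x in M. f i x = 0"
      using i nn_integral_0_iff_AE[OF f[OF i(1)]] by (simp add: F_def)
    then have "AE x in M. (\<Prod>i\<in>I. epowr (f i x) (l i)) = 0"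
      by eventually_elim (use i l I in \<open>auto intro!: prod_zero bexI[of _ i]\<close>)
    then have "(\<integral>\<^sup>+x. (\<Prod>i\<in>I. epowr (f i x) (l i)) \<partial>M) = (\<integral>\<^sup>+x. 0 \<partial>M)"
      by (rule nn_integral_cong_AE)
    then show ?thesis by simp
  next
    case top
    then have "(\<Prod>i\<in>I. epowr (F i) (l i)) = top"
      using I l by (auto simp: ennreal_prod_eq_top epowr_eq_0_iff epowr_eq_top_iff)
    then show ?thesis by (simp add: F_def)
  next
    case fin
    have "(\<integral>\<^sup>+x. (\<Prod>i\<in>I. epowr (f i x) (l i)) \<partial>M) =
      (\<integral>\<^sup>+x. (\<Prod>i\<in>I. epowr (F i) (l i)) * (\<Prod>i\<in>I. epowr (f i x / F i) (l i)) \<partial>M)"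
    proof (intro nn_integral_cong)
      fix x
      have "epowr (F i) (l i) * epowr (f i x / F i) (l i) = epowr (f i x) (l i)" if i: "i \<in> I" for i
      proof -
        have "F i * (f i x / F i) = f i x"
          using fin i by (simp add: ennreal_times_divide mult.commute[of "F i"] ennreal_mult_divide_eq)
        then show ?thesis using l(1)[OF i] by (simp add: epowr_mult[symmetric])
      qed
      then show "(\<Prod>i\<in>I. epowr (f i x) (l i)) =
          (\<Prod>i\<in>I. epowr (F i) (l i)) * (\<Prod>i\<in>I. epowr (f i x / F i) (l i))"
        by (simp add: prod.distrib[symmetric] cong: prod.cong)
    qed
    also have "\<dots> \<le> (\<integral>\<^sup>+x. (\<Prod>i\<in>I. epowr (F i) (l i)) * (\<Sum>i\<in>I. ennreal (l i) * (f i x / F i)) \<partial>M)"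
      by (intro nn_integral_mono mult_left_mono weighted_AM_GM_ennreal I l) auto
    also have "\<dots> = (\<Prod>i\<in>I. epowr (F i) (l i)) * (\<Sum>i\<in>I. ennreal (l i) * (F i / F i))"
      by (simp add: nn_integral_cmult nn_integral_sum nn_integral_divide F_def)
    also have "(\<Sum>i\<in>I. ennreal (l i) * (F i / F i)) = (\<Sum>i\<in>I. ennreal (l i))"
      using fin by (intro sum.cong) (auto simp: less_top)
    also have "\<dots> = ennreal (\<Sum>i\<in>I. l i)"
      using l by (intro sum_ennreal) (auto simp: less_imp_le)
    finally show ?thesis by (simp add: l F_def)
  qed
qed

lemma Holder_nn_integral:
  assumes "0 < s" "s < 1" and [measurable]: "f \<in> borel_measurable M" "g \<in> borel_measurable M"
  shows "(\<integral>\<^sup>+x. epowr (f x) s * epowr (g x) (1 - s) \<partial>M)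
     \<le> epowr (\<integral>\<^sup>+x. f x \<partial>M) s * epowr (\<integral>\<^sup>+x. g x \<partial>M) (1 - s)"
  using Holder_nn_integral_prod[of "UNIV :: bool set" "\<lambda>b. if b then s else 1 - s" "\<lambda>b. if b then f else g" M]
    assms by (simp add: UNIV_bool mult.commute)

section \<open>Minkowski's inequality and sums over product index sets\<close>

text \<open>
  The norm of a sum in \<open>\<ell>\<^bsup>t\<^esup>\<close> is at most the sum of the norms \<open>N x\<close>. The proof applies Hoelder's
  inequality to \<open>f x y = (f x y\<^bsup>t\<^esup> N x\<^bsup>1-t\<^esup>)\<^bsup>1/t\<^esup> N x\<^bsup>1-1/t\<^esup>\<close>. The weights \<open>N x\<close>
  take the place of the norm of the sum in the usual argument, since that norm may be infinite.
\<close>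

lemma Minkowski_count_space:
  fixes f :: "'a \<Rightarrow> 'b \<Rightarrow> ennreal"
  assumes t: "1 < t" and A: "countable A"
  shows "(\<integral>\<^sup>+y. epowr (\<integral>\<^sup>+x. f x y \<partial>count_space A) t \<partial>count_space B)
    \<le> epowr (\<integral>\<^sup>+x. epowr (\<integral>\<^sup>+y. epowr (f x y) t \<partial>count_space B) (1 / t) \<partial>count_space A) t"
proof -
  define N where "N x = epowr (\<integral>\<^sup>+y. epowr (f x y) t \<partial>count_space B) (1 / t)" for x
  define T where "T = (\<integral>\<^sup>+x. N x \<partial>count_space A)"
  show ?thesis
  proof (cases "T = top")
    case True
    then show ?thesis using t by (simp add: T_def N_def)
  next
    case False
    have Nfin: "N x \<noteq> top" if "x \<in> A" for x
    proof -
      have "AE x in count_space A. N x \<noteq> \<infinity>"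
        using False by (intro nn_integral_noteq_infinite) (auto simp: T_def)
      then show ?thesis using that by (simp add: AE_count_space)
    qed
    have f0: "f x y = 0" if "N x = 0" "y \<in> B" for x y
    proof -
      have "(\<integral>\<^sup>+y. epowr (f x y) t \<partial>count_space B) = 0"
        using that t by (simp add: N_def epowr_eq_0_iff)
      then have "AE y in count_space B. epowr (f x y) t = 0"
        by (subst (asm) nn_integral_0_iff_AE) auto
      then show ?thesis using that t by (simp add: AE_count_space epowr_eq_0_iff)
    qed
    \<comment> \<open>for \<open>N x = 0\<close> both sides vanish, since the negative power is then multiplied by \<open>f x y = 0\<close>\<close>
    have split: "f x y = epowr (epowr (f x y) t * epowr (N x) (1 - t)) (1 / t) * epowr (N x) (1 - 1 / t)"
      if "x \<in> A" "y \<in> B" for x y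
    proof (cases "N x = 0")
      case True
      then show ?thesis using f0[OF True that(2)] t by simp
    next
      case False
      moreover have "N x \<noteq> top" using Nfin[OF that(1)] .
      ultimately obtain r where r: "N x = ennreal r" "0 < r"
        by (cases "N x") auto
      have "epowr (N x) ((1 - t) * (1 / t)) * epowr (N x) (1 - 1 / t) = 1"
        using r t by (simp add: epowr_ennreal_pos ennreal_mult[symmetric] powr_add[symmetric] field_simps)
      then show ?thesis
        using t by (simp add: epowr_mult epowr_epowr mult.assoc)
    qed
    have H: "epowr (\<integral>\<^sup>+x. f x y \<partial>count_space A) t
        \<le> (\<integral>\<^sup>+x. epowr (f x y) t * epowr (N x) (1 - t) \<partial>count_space A) * epowr T (t - 1)"
      if y: "y \<in> B" for y
    proof -
      have "(\<integral>\<^sup>+x. f x y \<partial>count_space A) =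
        (\<integral>\<^sup>+x. epowr (epowr (f x y) t * epowr (N x) (1 - t)) (1 / t) * epowr (N x) (1 - 1 / t) \<partial>count_space A)"
        using split y by (intro nn_integral_cong) auto
      also have "\<dots> \<le> epowr (\<integral>\<^sup>+x. epowr (f x y) t * epowr (N x) (1 - t) \<partial>count_space A) (1 / t)
          * epowr T (1 - 1 / t)"
        unfolding T_def using t by (intro Holder_nn_integral) auto
      finally have "epowr (\<integral>\<^sup>+x. f x y \<partial>count_space A) t \<le>
         epowr (epowr (\<integral>\<^sup>+x. epowr (f x y) t * epowr (N x) (1 - t) \<partial>count_space A) (1 / t)
          * epowr T (1 - 1 / t)) t"
        using t by (intro epowr_mono) auto
      also have "(1 - 1 / t) * t = t - 1" using t by (simp add: field_simps)
      then have "epowr (epowr (\<integral>\<^sup>+x. epowr (f x y) t * epowr (N x) (1 - t) \<partial>count_space A) (1 / t)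
          * epowr T (1 - 1 / t)) t =
        (\<integral>\<^sup>+x. epowr (f x y) t * epowr (N x) (1 - t) \<partial>count_space A) * epowr T (t - 1)"
        using t by (simp add: epowr_mult epowr_epowr)
      finally show ?thesis .
    qed
    have "(\<integral>\<^sup>+y. epowr (\<integral>\<^sup>+x. f x y \<partial>count_space A) t \<partial>count_space B)
      \<le> (\<integral>\<^sup>+y. (\<integral>\<^sup>+x. epowr (f x y) t * epowr (N x) (1 - t) \<partial>count_space A) * epowr T (t - 1) \<partial>count_space B)"
      using H by (intro nn_integral_mono) auto
    also have "\<dots> = (\<integral>\<^sup>+y. (\<integral>\<^sup>+x. epowr (f x y) t * epowr (N x) (1 - t) \<partial>count_space A) \<partial>count_space B) * epowr T (t - 1)"
      by (rule nn_integral_multc) auto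
    also have "(\<integral>\<^sup>+y. (\<integral>\<^sup>+x. epowr (f x y) t * epowr (N x) (1 - t) \<partial>count_space A) \<partial>count_space B)
      = (\<integral>\<^sup>+x. (\<integral>\<^sup>+y. epowr (f x y) t * epowr (N x) (1 - t) \<partial>count_space B) \<partial>count_space A)"
      using A by (intro nn_integral_count_space_nn_integral) auto
    also have "\<dots> = (\<integral>\<^sup>+x. epowr (N x) t * epowr (N x) (1 - t) \<partial>count_space A)"
      using t by (simp add: nn_integral_multc N_def epowr_epowr)
    also have "\<dots> \<le> T"
      unfolding T_def
    proof (intro nn_integral_mono)
      fix x assume "x \<in> space (count_space A)"
      then have x: "N x \<noteq> top" using Nfin by simp
      show "epowr (N x) t * epowr (N x) (1 - t) \<le> N x"
      proof (cases "N x = 0")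
        case False
        then obtain r where r: "N x = ennreal r" "0 < r"
          using x by (cases "N x") auto
        then show ?thesis
          by (simp add: epowr_ennreal_pos ennreal_mult[symmetric] powr_add[symmetric])
      qed (use t in simp)
    qed
    also have "T * epowr T (t - 1) = epowr T t"
      using epowr_add[of 1 "t - 1" T] t by simp
    finally show ?thesis by (simp add: T_def N_def mult_right_mono)
  qed
qed

text \<open>
  The coordinates in \<open>S\<close> range over \<open>B\<close>, the others are those of \<open>x\<close>.
\<close>

definition variants :: "'n set \<Rightarrow> 'b set \<Rightarrow> ('n \<Rightarrow> 'b) \<Rightarrow> ('n \<Rightarrow> 'b) set" where
  "variants S B x = {x'. (\<forall>j. j \<notin> S \<longrightarrow> x' j = x j) \<and> (\<forall>j\<in>S. x' j \<in> B)}"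

lemma variants_empty [simp]: "variants {} B x = {x}"
  by (auto simp: variants_def)

lemma nn_integral_variants_insert:
  fixes h :: "('n::finite \<Rightarrow> 'b::countable) \<Rightarrow> ennreal"
  assumes j: "j \<notin> S"
  shows "(\<integral>\<^sup>+x'. h x' \<partial>count_space (variants (insert j S) B x)) =
    (\<integral>\<^sup>+y. \<integral>\<^sup>+x'. h (x'(j := y)) \<partial>count_space (variants S B x) \<partial>count_space B)"
proof -
  have bij: "bij_betw (\<lambda>(y, x'). x'(j := y)) (B \<times> variants S B x) (variants (insert j S) B x)"
    by (rule bij_betw_byWitness[where f' = "\<lambda>x'. (x' j, x'(j := x j))"])
      (use j in \<open>auto simp: variants_def fun_eq_iff split: if_splits\<close>)
  interpret sigma_finite_measure "count_space (variants S B x)"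
    by (rule sigma_finite_measure_count_space_countable) auto
  have "(\<integral>\<^sup>+x'. h x' \<partial>count_space (variants (insert j S) B x))
    = (\<integral>\<^sup>+z. (case z of (y, x') \<Rightarrow> h (x'(j := y))) \<partial>count_space (B \<times> variants S B x))"
    by (subst nn_integral_bij_count_space[OF bij, symmetric]) (auto intro!: nn_integral_cong)
  also have "\<dots> = (\<integral>\<^sup>+z. (case z of (y, x') \<Rightarrow> h (x'(j := y)))
      \<partial>(count_space B \<Otimes>\<^sub>M count_space (variants S B x)))"
    by (subst pair_measure_countable) auto
  also have "\<dots> = (\<integral>\<^sup>+y. \<integral>\<^sup>+x'. h (x'(j := y)) \<partial>count_space (variants S B x) \<partial>count_space B)"
    by (subst nn_integral_fst[symmetric]) (auto simp: pair_measure_countable)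
  finally show ?thesis .
qed

lemma variants_swap:
  fixes h :: "('n::finite \<Rightarrow> 'b::countable) \<Rightarrow> ennreal"
  assumes j: "j \<notin> S"
  shows "(\<integral>\<^sup>+x'. h x' \<partial>count_space (variants S B (x(j := y)))) =
    (\<integral>\<^sup>+x'. h (x'(j := y)) \<partial>count_space (variants S B x))"
proof -
  have bij: "bij_betw (\<lambda>x'. x'(j := y)) (variants S B x) (variants S B (x(j := y)))"
    by (rule bij_betw_byWitness[where f' = "\<lambda>x'. x'(j := x j)"])
      (use j in \<open>auto simp: variants_def fun_eq_iff split: if_splits\<close>)
  show ?thesis
    by (subst nn_integral_bij_count_space[OF bij, symmetric]) auto
qed

text \<open>
  A bound from \<open>\<ell>\<^bsup>1\<^esup>\<close> over \<open>B\<close> to \<open>\<ell>\<^bsup>t\<^esup>\<close> that holds for each coordinate separately holds for all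
  coordinates together. To add one coordinate, the bound for the others is applied first; then
  Minkowski's inequality brings the new coordinate inside, where its own bound applies.
\<close>

lemma tensorized_summation:
  fixes G :: "('n::finite \<Rightarrow> 'b::countable) \<Rightarrow> ennreal"
  assumes t: "1 < t" and C: "0 \<le> C"
    and one: "\<And>x j. (\<integral>\<^sup>+y. epowr (G (x(j := y))) t \<partial>count_space UNIV)
      \<le> ennreal C * epowr (\<integral>\<^sup>+y. G (x(j := y)) \<partial>count_space B) t"
  shows "(\<integral>\<^sup>+x'. epowr (G x') t \<partial>count_space (variants S UNIV x))
    \<le> ennreal (C ^ card S) * epowr (\<integral>\<^sup>+x'. G x' \<partial>count_space (variants S B x)) t"
proof -
  have "finite S" by simp
  then show ?thesis
  proof (induction S arbitrary: x rule: finite_induct)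
    case empty
    show ?case by (simp add: nn_integral_count_space_finite)
  next
    case (insert j S)
    let ?V = "variants S B x"
    have "(\<integral>\<^sup>+x'. epowr (G x') t \<partial>count_space (variants (insert j S) UNIV x))
      = (\<integral>\<^sup>+y. \<integral>\<^sup>+x'. epowr (G x') t \<partial>count_space (variants S UNIV (x(j := y))) \<partial>count_space UNIV)"
      using insert.hyps by (simp add: nn_integral_variants_insert variants_swap)
    also have "\<dots> \<le> (\<integral>\<^sup>+y. ennreal (C ^ card S) *
        epowr (\<integral>\<^sup>+x'. G x' \<partial>count_space (variants S B (x(j := y)))) t \<partial>count_space UNIV)"
      by (intro nn_integral_mono insert.IH)
    also have "\<dots> = ennreal (C ^ card S) *
       (\<integral>\<^sup>+y. epowr (\<integral>\<^sup>+x'. G (x'(j := y)) \<partial>count_space ?V) t \<partial>count_space UNIV)"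
      using insert.hyps by (simp add: nn_integral_cmult variants_swap)
    also have "\<dots> \<le> ennreal (C ^ card S) * epowr (\<integral>\<^sup>+x'. epowr
        (\<integral>\<^sup>+y. epowr (G (x'(j := y))) t \<partial>count_space UNIV) (1 / t) \<partial>count_space ?V) t"
      using t by (intro mult_left_mono Minkowski_count_space) auto
    also have "\<dots> \<le> ennreal (C ^ card S) * epowr (\<integral>\<^sup>+x'. epowr
        (ennreal C * epowr (\<integral>\<^sup>+y. G (x'(j := y)) \<partial>count_space B) t) (1 / t) \<partial>count_space ?V) t"
      using t by (intro mult_left_mono epowr_mono nn_integral_mono one) auto
    also have "\<dots> = ennreal (C ^ card S) * (ennreal C * epowr (\<integral>\<^sup>+x'.
        (\<integral>\<^sup>+y. G (x'(j := y)) \<partial>count_space B) \<partial>count_space ?V) t)"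
      using t by (simp add: epowr_mult epowr_epowr nn_integral_cmult)
    also have "(\<integral>\<^sup>+x'. (\<integral>\<^sup>+y. G (x'(j := y)) \<partial>count_space B) \<partial>count_space ?V)
      = (\<integral>\<^sup>+x'. G x' \<partial>count_space (variants (insert j S) B x))"
      using insert.hyps
      by (subst nn_integral_count_space_nn_integral) (auto simp: nn_integral_variants_insert)
    finally show ?case
      using insert.hyps C by (simp add: ennreal_mult mult.assoc mult.left_commute)
  qed
qed

section \<open>A Bellman function on the dyadic tree\<close>

text \<open>
  Convexity of \<open>x\<^bsup>s\<^esup>\<close> at the combination of \<open>a/\<rho>\<close> and \<open>b/(1 - \<rho>)\<close> with weights \<open>\<rho>\<close> and \<open>1 - \<rho>\<close>. What
  matters is that the coefficient of \<open>a\<^bsup>s\<^esup>\<close> is less than one.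
\<close>

lemma powr_sum_split:
  fixes a b \<rho> s :: real
  assumes "0 \<le> a" "0 \<le> b" "0 < \<rho>" "\<rho> < 1" "1 < s"
  shows "(\<rho> * (a + b)) powr s \<le> \<rho> * a powr s + \<rho> powr s * (1 - \<rho>) powr (1 - s) * b powr s"
proof -
  have \<rho>s: "\<rho> powr s \<le> \<rho>"
    using powr_mono'[of 1 s \<rho>] assms by simp
  have \<rho>1: "1 \<le> (1 - \<rho>) powr (1 - s)"
    using powr_mono'[of "1 - s" 0 "1 - \<rho>"] assms by simp
  consider "a = 0" | "b = 0" | "0 < a" "0 < b" using assms by linarith
  then show ?thesis
  proof cases
    case 1
    have "\<rho> powr s * b powr s * 1 \<le> \<rho> powr s * b powr s * (1 - \<rho>) powr (1 - s)"
      by (intro mult_left_mono \<rho>1) auto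
    then show ?thesis using 1 assms by (simp add: powr_mult mult_ac)
  next
    case 2
    then show ?thesis using \<rho>s assms by (simp add: powr_mult mult_right_mono)
  next
    case 3
    have "(\<rho> *\<^sub>R (a / \<rho>) + (1 - \<rho>) *\<^sub>R (b / (1 - \<rho>))) powr s
      \<le> \<rho> * (a / \<rho>) powr s + (1 - \<rho>) * (b / (1 - \<rho>)) powr s"
      using convex_onD[OF powr_convex[of s], of "1 - \<rho>" "a / \<rho>" "b / (1 - \<rho>)"] 3 assms by simp
    then have *: "(a + b) powr s \<le> \<rho> * (a / \<rho>) powr s + (1 - \<rho>) * (b / (1 - \<rho>)) powr s"
      using assms by simp
    have "(\<rho> * (a + b)) powr s = \<rho> powr s * (a + b) powr s"
      using assms by (simp add: powr_mult)
    also have "\<dots> \<le> \<rho> powr s * (\<rho> * (a / \<rho>) powr s + (1 - \<rho>) * (b / (1 - \<rho>)) powr s)"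
      using * by (intro mult_left_mono) auto
    also have "\<dots> = \<rho> * a powr s + \<rho> powr s * (1 - \<rho>) powr (1 - s) * b powr s"
      using assms by (simp add: powr_divide powr_diff field_simps)
    finally show ?thesis .
  qed
qed

text \<open>
  The power is superadditive, and the gain is controlled by the smaller term, because
  \<open>(a + b)\<^bsup>t-1\<^esup>\<close> is at least \<open>(2b)\<^bsup>t-1\<^esup>\<close>.
\<close>

lemma powr_superadditive_gain:
  fixes a b t :: real
  assumes "0 \<le> b" "b \<le> a" "1 < t"
  shows "a powr t + b powr t + (2 powr (t - 1) - 1) * b powr t \<le> (a + b) powr t"
proof -
  have eq: "x * x powr (t - 1) = x powr t" if "0 \<le> x" for x :: real
    using that by (cases "x = 0") (auto simp: powr_diff)
  have "b * (2 * b) powr (t - 1) = 2 powr (t - 1) * b powr t"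
    using eq[of b] assms by (simp add: powr_mult)
  moreover have "a * a powr (t - 1) + b * (2 * b) powr (t - 1) \<le> a * (a + b) powr (t - 1) + b * (a + b) powr (t - 1)"
    using assms by (intro add_mono mult_left_mono powr_mono2) auto
  ultimately show ?thesis
    using eq[of a] eq[of "a + b"] assms by (simp add: algebra_simps)
qed

text \<open>
  The Bellman function of a node with value \<open>F\<close> and mass \<open>P\<close> is \<open>C P\<^bsup>t\<^esup> - D F\<^bsup>p t\<^esup>\<close>: passing to the
  two children lowers the total by at least \<open>F\<^bsup>p t\<^esup>\<close>. If the mass is concentrated on
  one child, \<open>P\<^bsup>t\<^esup>\<close> gains nothing, but then \<open>F \<le> \<rho> F1\<close> up to a small error and the second term gains. In
  general the error is a power of the smaller mass, which the superadditivity of \<open>P\<^bsup>t\<^esup>\<close> pays for.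
\<close>

lemma bellman_step:
  fixes p t \<rho> :: real
  assumes p: "1 \<le> p" and t: "1 < t" and \<rho>: "0 < \<rho>" "\<rho> < 1"
  obtains C D where "0 \<le> D" "1 + D \<le> C"
    "\<And>F F1 F2 P1 P2. \<lbrakk>0 \<le> F; 0 \<le> F1; 0 \<le> F2; F \<le> \<rho> * (F1 + F2); F1 powr p \<le> P1; F2 powr p \<le> P2\<rbrakk> \<Longrightarrow>
      (1 + D) * F powr (p * t) + C * (P1 powr t + P2 powr t)
        \<le> D * (F1 powr (p * t) + F2 powr (p * t)) + C * (P1 + P2) powr t"
proof -
  define s where "s = p * t"
  have s: "1 < s"
    using p t mult_mono[of 1 p 1 t] less_1_mult[of p t] by (cases "p = 1") (auto simp: s_def)
  define K where "K = \<rho> powr s * (1 - \<rho>) powr (1 - s)"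
  define g where "g = 2 powr (t - 1) - (1 :: real)"
  \<comment> \<open>\<open>D\<close> solves \<open>(1 + D) \<rho> = D\<close>, which absorbs the larger child; \<open>C\<close> is large enough for the smaller one\<close>
  define D where "D = \<rho> / (1 - \<rho>)"
  define C where "C = 1 + D + K / (1 - \<rho>) / g"
  have g: "0 < g" using t by (simp add: g_def)
  have K: "0 \<le> K" by (simp add: K_def)
  have D: "0 \<le> D" using \<rho> by (simp add: D_def)
  have C: "1 + D \<le> C" using g K \<rho> by (simp add: C_def)
  have D\<rho>: "(1 + D) * \<rho> = D" "(1 + D) = 1 / (1 - \<rho>)" using \<rho> by (simp_all add: D_def field_simps)
  have step: "(1 + D) * F powr s + C * (P1 powr t + P2 powr t)
        \<le> D * (F1 powr s + F2 powr s) + C * (P1 + P2) powr t"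
    if "0 \<le> F" "0 \<le> F1" "0 \<le> F2" "F \<le> \<rho> * (F1 + F2)" "F1 powr p \<le> P1" "F2 powr p \<le> P2" "P2 \<le> P1"
    for F F1 F2 P1 P2
  proof -
    have P2: "0 \<le> P2" using that(6) powr_ge_zero[of F2 p] by linarith
    have "F powr s \<le> (\<rho> * (F1 + F2)) powr s"
      using that s by (intro powr_mono2) auto
    also have "\<dots> \<le> \<rho> * F1 powr s + K * F2 powr s"
      unfolding K_def using that s \<rho> by (intro powr_sum_split) auto
    finally have "(1 + D) * F powr s \<le> (1 + D) * (\<rho> * F1 powr s + K * F2 powr s)"
      using D by (intro mult_left_mono) auto
    also have "\<dots> = D * F1 powr s + K / (1 - \<rho>) * F2 powr s"
      using D\<rho> by (simp add: distrib_left mult.assoc[symmetric])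
    also have "F2 powr s = (F2 powr p) powr t" by (simp add: s_def powr_powr)
    also have "K / (1 - \<rho>) * (F2 powr p) powr t \<le> K / (1 - \<rho>) * P2 powr t"
      using that K \<rho> t by (intro mult_left_mono powr_mono2) auto
    also have "K / (1 - \<rho>) * P2 powr t = K / (1 - \<rho>) / g * (g * P2 powr t)"
      using g by simp
    also have "K / (1 - \<rho>) / g * (g * P2 powr t) \<le> C * (g * P2 powr t)"
      using g D by (intro mult_right_mono) (auto simp: C_def)
    also have "\<dots> \<le> C * ((P1 + P2) powr t - P1 powr t - P2 powr t)"
      using powr_superadditive_gain[OF P2 that(7) t] C D by (intro mult_left_mono) (auto simp: g_def)
    finally have "(1 + D) * F powr s \<le> D * F1 powr s + C * ((P1 + P2) powr t - P1 powr t - P2 powr t)"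
      by simp
    moreover have "0 \<le> D * F2 powr s" using D by simp
    ultimately show ?thesis by (simp add: algebra_simps)
  qed
  show ?thesis
  proof (rule that[OF D C], fold s_def)
    fix F F1 F2 P1 P2
    assume *: "0 \<le> F" "0 \<le> F1" "0 \<le> F2" "F \<le> \<rho> * (F1 + F2)" "F1 powr p \<le> P1" "F2 powr p \<le> P2"
    show "(1 + D) * F powr s + C * (P1 powr t + P2 powr t)
        \<le> D * (F1 powr s + F2 powr s) + C * (P1 + P2) powr t"
    proof (cases "P2 \<le> P1")
      case True
      then show ?thesis using * by (intro step) auto
    next
      case False
      then show ?thesis using * step[of F F2 F1 P2 P1] by (simp add: add.commute)
    qed
  qed
qed

text \<open>
  Every dyadic interval of one level is the left or the right half of exactly one interval of the
  next level, so a sum over a level can be computed from the parents.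
\<close>

lemma nn_integral_even_odd:
  fixes h :: "int \<Rightarrow> ennreal"
  shows "(\<integral>\<^sup>+c. h (2 * c) + h (2 * c + 1) \<partial>count_space UNIV) = (\<integral>\<^sup>+c. h c \<partial>count_space UNIV)"
proof -
  have e: "bij_betw (\<lambda>c. 2 * c) UNIV {c :: int. even c}"
    by (rule bij_betw_byWitness[where f' = "\<lambda>c. c div 2"]) auto
  have o: "bij_betw (\<lambda>c. 2 * c + 1) UNIV {c :: int. odd c}"
    by (rule bij_betw_byWitness[where f' = "\<lambda>c. c div 2"]) auto
  have "(\<integral>\<^sup>+c. h (2 * c) + h (2 * c + 1) \<partial>count_space UNIV)
    = (\<integral>\<^sup>+c. h (2 * c) \<partial>count_space UNIV) + (\<integral>\<^sup>+c. h (2 * c + 1) \<partial>count_space UNIV)"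
    by (rule nn_integral_add) auto
  also have "\<dots> = (\<integral>\<^sup>+c. h c \<partial>count_space {c. even c}) + (\<integral>\<^sup>+c. h c \<partial>count_space {c. odd c})"
    by (simp add: nn_integral_bij_count_space[OF e] nn_integral_bij_count_space[OF o])
  also have "\<dots> = (\<integral>\<^sup>+c. h c * indicator {c. even c} c + h c * indicator {c. odd c} c \<partial>count_space UNIV)"
    by (subst nn_integral_add) (auto simp: nn_integral_count_space_indicator)
  also have "\<dots> = (\<integral>\<^sup>+c. h c \<partial>count_space UNIV)"
    by (intro nn_integral_cong) (auto simp: indicator_def)
  finally show ?thesis .
qed

lemma sum_epowr_le_epowr_sum:
  assumes t: "1 < t"
  shows "(\<integral>\<^sup>+c. epowr (a c) t \<partial>count_space A) \<le> epowr (\<integral>\<^sup>+c. a c \<partial>count_space A) t"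
proof -
  define S where "S = (\<integral>\<^sup>+c. a c \<partial>count_space A)"
  have eq: "epowr x t = x * epowr x (t - 1)" for x
    using epowr_add[of 1 "t - 1" x] t by simp
  have "a c \<le> S" if "c \<in> A" for c
    unfolding S_def using that by (rule nn_integral_ge_point)
  then have "(\<integral>\<^sup>+c. epowr (a c) t \<partial>count_space A) \<le> (\<integral>\<^sup>+c. a c * epowr S (t - 1) \<partial>count_space A)"
    using t unfolding eq by (intro nn_integral_mono mult_left_mono epowr_mono) auto
  also have "\<dots> = epowr S t"
    by (simp add: nn_integral_multc eq S_def)
  finally show ?thesis by (simp add: S_def)
qed

text \<open>
  The node \<open>(m, c)\<close> stands for the interval \<open>[c 2\<^bsup>m\<^esup>, (c + 1) 2\<^bsup>m\<^esup>)\<close>, whose halves are \<open>(m - 1, 2 c)\<close> and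
  \<open>(m - 1, 2 c + 1)\<close>; the leaves are the nodes with \<open>m = 0\<close>. The two hypotheses on \<open>F\<close> are a
  contraction by \<open>\<rho>\<close> for sums and subadditivity of \<open>F\<^bsup>p\<^esup>\<close>.
\<close>

definition tree_bound :: "real \<Rightarrow> real \<Rightarrow> real \<Rightarrow> real \<Rightarrow> bool" where
  "tree_bound p t \<rho> C \<longleftrightarrow> 0 \<le> C \<and> (\<forall>F :: nat \<times> int \<Rightarrow> real.
     (\<forall>y. 0 \<le> F y) \<and> (\<forall>m c. F (Suc m, c) \<le> \<rho> * (F (m, 2 * c) + F (m, 2 * c + 1))) \<and>
     (\<forall>m c. F (Suc m, c) powr p \<le> F (m, 2 * c) powr p + F (m, 2 * c + 1) powr p) \<longrightarrow>
     (\<integral>\<^sup>+y. epowr (ennreal (F y powr p)) t \<partial>count_space UNIV)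
       \<le> ennreal C * epowr (\<integral>\<^sup>+y. ennreal (F y powr p) \<partial>count_space ({0} \<times> UNIV)) t)"

text \<open>
  Summation of \<open>bellman_step\<close> over the tree. The mass of a node is the sum of \<open>F\<^bsup>p\<^esup>\<close> over the leaves
  below it, and the total mass of every level is the sum over all leaves.
\<close>

lemma dyadic_tree_summation:
  fixes p t \<rho> :: real
  assumes p: "1 \<le> p" and t: "1 < t" and \<rho>: "0 < \<rho>" "\<rho> < 1"
  shows "\<exists>C. tree_bound p t \<rho> C"
proof -
  obtain C D where D: "0 \<le> D" and C: "1 + D \<le> C"
    and step: "\<And>F F1 F2 P1 P2. \<lbrakk>0 \<le> F; 0 \<le> F1; 0 \<le> F2; F \<le> \<rho> * (F1 + F2); F1 powr p \<le> P1; F2 powr p \<le> P2\<rbrakk> \<Longrightarrow>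
      (1 + D) * F powr (p * t) + C * (P1 powr t + P2 powr t)
        \<le> D * (F1 powr (p * t) + F2 powr (p * t)) + C * (P1 + P2) powr t"
    using bellman_step[OF assms] by metis
  have "tree_bound p t \<rho> C"
    unfolding tree_bound_def
  proof (intro conjI allI impI; (elim conjE)?)
    show "0 \<le> C" using C D by simp
    fix F :: "nat \<times> int \<Rightarrow> real"
    assume "\<forall>y. 0 \<le> F y" "\<forall>m c. F (Suc m, c) \<le> \<rho> * (F (m, 2 * c) + F (m, 2 * c + 1))"
      "\<forall>m c. F (Suc m, c) powr p \<le> F (m, 2 * c) powr p + F (m, 2 * c + 1) powr p"
    then have F0: "\<And>y. 0 \<le> F y" and F\<rho>: "\<And>m c. F (Suc m, c) \<le> \<rho> * (F (m, 2 * c) + F (m, 2 * c + 1))"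
      and Fp: "\<And>m c. F (Suc m, c) powr p \<le> F (m, 2 * c) powr p + F (m, 2 * c + 1) powr p"
      by blast+
    define P where "P = rec_nat (\<lambda>c. F (0, c) powr p) (\<lambda>_ g c. g (2 * c) + g (2 * c + 1))"
    define T where "T = rec_nat (\<lambda>c. F (0, c) powr (p * t))
       (\<lambda>m g c. g (2 * c) + g (2 * c + 1) + F (Suc m, c) powr (p * t))"
    have P: "P 0 c = F (0, c) powr p" "P (Suc m) c = P m (2 * c) + P m (2 * c + 1)" for m c
      by (simp_all add: P_def)
    have T: "T 0 c = F (0, c) powr (p * t)"
      "T (Suc m) c = T m (2 * c) + T m (2 * c + 1) + F (Suc m, c) powr (p * t)" for m c
      by (simp_all add: T_def)
    have FP: "F (m, c) powr p \<le> P m c" for m c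
    proof (induction m arbitrary: c)
      case (Suc m)
      show ?case using Fp[of m c] Suc[of "2 * c"] Suc[of "2 * c + 1"] by (simp add: P)
    qed (simp add: P)
    have P0: "0 \<le> P m c" for m c
      using FP[of m c] powr_ge_zero[of "F (m, c)" p] by linarith
    have T0: "0 \<le> T m c" for m c
      by (induction m arbitrary: c) (auto simp: T)
    have TP: "T m c + D * F (m, c) powr (p * t) \<le> C * P m c powr t" for m c
    proof (induction m arbitrary: c)
      case 0
      have "(1 + D) * F (0, c) powr (p * t) \<le> C * F (0, c) powr (p * t)"
        using C by (intro mult_right_mono) auto
      then show ?case by (simp add: P T powr_powr algebra_simps)
    next
      case (Suc m)
      have "(1 + D) * F (Suc m, c) powr (p * t) + C * (P m (2 * c) powr t + P m (2 * c + 1) powr t)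
        \<le> D * (F (m, 2 * c) powr (p * t) + F (m, 2 * c + 1) powr (p * t)) + C * (P m (2 * c) + P m (2 * c + 1)) powr t"
        by (intro step F0 F\<rho> FP)
      then show ?case
        using Suc[of "2 * c"] Suc[of "2 * c + 1"] by (simp add: P T algebra_simps)
    qed
    define L where "L m = (\<integral>\<^sup>+c. epowr (ennreal (F (m, c) powr p)) t \<partial>count_space UNIV)" for m
    have L: "L m = (\<integral>\<^sup>+c. ennreal (F (m, c) powr (p * t)) \<partial>count_space UNIV)" for m
      using t by (simp add: L_def epowr_ennreal powr_powr)
    have sumT: "(\<integral>\<^sup>+c. ennreal (T m c) \<partial>count_space UNIV) = (\<Sum>j\<le>m. L j)" for m
    proof (induction m)
      case 0
      show ?case by (simp add: T L)
    next
      case (Suc m)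
      have "(\<integral>\<^sup>+c. ennreal (T (Suc m) c) \<partial>count_space UNIV)
        = (\<integral>\<^sup>+c. (ennreal (T m (2 * c)) + ennreal (T m (2 * c + 1))) + ennreal (F (Suc m, c) powr (p * t)) \<partial>count_space UNIV)"
        using T0 by (intro nn_integral_cong) (simp add: T ennreal_plus[symmetric] del: ennreal_plus)
      also have "\<dots> = (\<integral>\<^sup>+c. ennreal (T m (2 * c)) + ennreal (T m (2 * c + 1)) \<partial>count_space UNIV) + L (Suc m)"
        unfolding L by (rule nn_integral_add) auto
      finally show ?case
        using nn_integral_even_odd[of "\<lambda>c. ennreal (T m c)"] Suc by simp
    qed
    have sumP: "(\<integral>\<^sup>+c. ennreal (P m c) \<partial>count_space UNIV) = (\<integral>\<^sup>+c. ennreal (F (0, c) powr p) \<partial>count_space UNIV)" for m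
    proof (induction m)
      case 0
      show ?case by (simp add: P)
    next
      case (Suc m)
      then show ?case
        using P0 nn_integral_even_odd[of "\<lambda>c. ennreal (P m c)"] by (simp add: P)
    qed
    define Q where "Q = (\<integral>\<^sup>+c. ennreal (F (0, c) powr p) \<partial>count_space UNIV)"
    have part: "(\<Sum>j\<le>m. L j) \<le> ennreal C * epowr Q t" for m
    proof -
      have "(\<Sum>j\<le>m. L j) \<le> (\<integral>\<^sup>+c. ennreal (C * P m c powr t) \<partial>count_space UNIV)"
        unfolding sumT[symmetric]
      proof (intro nn_integral_mono ennreal_leI)
        fix c
        have "0 \<le> D * F (m, c) powr (p * t)" using D by simp
        then show "T m c \<le> C * P m c powr t" using TP[of m c] by linarith
      qed
      also have "\<dots> = ennreal C * (\<integral>\<^sup>+c. epowr (ennreal (P m c)) t \<partial>count_space UNIV)"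
        using C D t P0 by (subst nn_integral_cmult[symmetric]) (auto simp: epowr_ennreal ennreal_mult)
      also have "\<dots> \<le> ennreal C * epowr Q t"
        unfolding Q_def sumP[of m, symmetric] by (intro mult_left_mono sum_epowr_le_epowr_sum t) simp
      finally show ?thesis .
    qed
    have "(\<integral>\<^sup>+y. epowr (ennreal (F y powr p)) t \<partial>count_space UNIV) = (\<integral>\<^sup>+m. L m \<partial>count_space UNIV)"
      unfolding L_def by (subst nn_integral_fst_count_space[symmetric]) simp
    also have "\<dots> = (\<Sum>m. L m)" by (rule nn_integral_count_space_nat)
    also have "\<dots> \<le> ennreal C * epowr Q t"
    proof (rule suminf_le_const)
      show "sum L {..<n} \<le> ennreal C * epowr Q t" for n
        using part[of n] sum_mono2[of "{..n}" "{..<n}" L] by force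
    qed simp
    also have "Q = (\<integral>\<^sup>+y. ennreal (F y powr p) \<partial>count_space ({0} \<times> UNIV))"
    proof -
      have "bij_betw (\<lambda>c. (0 :: nat, c)) (UNIV :: int set) ({0} \<times> UNIV)"
        by (auto simp: bij_betw_def inj_on_def)
      from nn_integral_bij_count_space[OF this, of "\<lambda>y. ennreal (F y powr p)"] show ?thesis
        by (simp add: Q_def)
    qed
    finally show "(\<integral>\<^sup>+y. epowr (ennreal (F y powr p)) t \<partial>count_space UNIV)
        \<le> ennreal C * epowr (\<integral>\<^sup>+y. ennreal (F y powr p) \<partial>count_space ({0} \<times> UNIV)) t" .
  qed
  then show ?thesis ..
qed

section \<open>Rectangles and dyadic blocks\<close>

text \<open>
  A set between an open box and its closure differs from them by a null set, which settles
  measurability and volume for every choice of endpoints.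
\<close>

lemma sandwiched_box:
  fixes a b :: "real ^ 'n"
  assumes ab: "\<And>j. a $ j < b $ j" and R: "box a b \<subseteq> R" "R \<subseteq> cbox a b"
  shows "R \<in> lmeasurable" "measure lebesgue R = (\<Prod>j\<in>UNIV. b $ j - a $ j)"
proof -
  have "negligible (R - box a b)"
    by (rule negligible_subset[OF negligible_frontier_interval[of a b]]) (use R in auto)
  then have "box a b \<union> (R - box a b) \<in> lmeasurable"
    by (intro fmeasurable.Un lmeasurable_box negligible_imp_measurable)
  also have "box a b \<union> (R - box a b) = R" using R by auto
  finally show meas: "R \<in> lmeasurable" .
  have ne: "cbox a b \<noteq> {}"
    using ab by (auto simp: interval_ne_empty_cart intro: less_imp_le)
  have c: "measure lebesgue (cbox a b) = (\<Prod>j\<in>UNIV. b $ j - a $ j)"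
    using content_cbox_cart[OF ne] by simp
  have b: "measure lebesgue (box a b) = measure lebesgue (cbox a b)"
    by (simp add: measure_lborel_box_eq measure_lborel_cbox_eq)
  have "measure lebesgue (box a b) \<le> measure lebesgue R"
    using R meas by (intro measure_mono_fmeasurable) auto
  moreover have "measure lebesgue R \<le> measure lebesgue (cbox a b)"
    using R meas by (intro measure_mono_fmeasurable) auto
  ultimately show "measure lebesgue R = (\<Prod>j\<in>UNIV. b $ j - a $ j)"
    using b c by simp
qed

lemma bounded_interval_sandwich:
  fixes I :: "real set"
  assumes "is_interval I" "bounded I" "interior I \<noteq> {}"
  obtains a b where "a < b" "{a<..<b} \<subseteq> I" "I \<subseteq> {a..b}"
proof -
  define a b where "a = Inf I" and "b = Sup I"
  have bdd: "bdd_above I" "bdd_below I" using assms(2) by (auto simp: bounded_imp_bdd_above bounded_imp_bdd_below)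
  obtain x e where xe: "0 < e" "ball x e \<subseteq> I"
    using assms(3) by (auto simp: mem_interior)
  then have mem: "x \<in> I" "x + e / 2 \<in> I"
    by (auto simp: subset_iff dist_real_def)
  then have ne: "I \<noteq> {}" by auto
  have "a \<le> x" "x + e / 2 \<le> b"
    unfolding a_def b_def using mem bdd by (auto intro: cInf_lower cSup_upper)
  then have "a < b" using xe by simp
  moreover have "{a<..<b} \<subseteq> I"
  proof
    fix t assume "t \<in> {a<..<b}"
    then have t: "a < t" "t < b" by auto
    obtain u where u: "u \<in> I" "u < t" using t ne bdd by (auto simp: a_def cInf_less_iff)
    obtain v where v: "v \<in> I" "t < v" using t ne bdd by (auto simp: b_def less_cSup_iff)
    show "t \<in> I" using assms(1) u v unfolding is_interval_1 by (meson less_imp_le)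
  qed
  moreover have "I \<subseteq> {a..b}"
    unfolding a_def b_def using bdd by (auto intro: cInf_lower cSup_upper)
  ultimately show ?thesis by (rule that)
qed

lemma rectangles_sandwich:
  assumes "R \<in> rectangles"
  obtains a b :: "real ^ 'n" where "\<And>j. a $ j < b $ j" "box a b \<subseteq> R" "R \<subseteq> cbox a b"
proof -
  obtain I where I: "\<And>j. is_interval (I j) \<and> bounded (I j) \<and> interior (I j) \<noteq> {}"
    and R: "R = {x. \<forall>j. x $ j \<in> I j}"
    using assms unfolding rectangles_def by blast
  have "\<forall>j. \<exists>a b. a < b \<and> {a<..<b} \<subseteq> I j \<and> I j \<subseteq> {a..b}"
    using I bounded_interval_sandwich by metis
  then obtain a b where ab: "\<And>j. a j < b j" "\<And>j. {a j<..<b j} \<subseteq> I j" "\<And>j. I j \<subseteq> {a j..b j}"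
    by metis
  show ?thesis
  proof (rule that[of "\<chi> j. a j" "\<chi> j. b j"])
    show "box (\<chi> j. a j) (\<chi> j. b j) \<subseteq> R"
      using ab(2) by (force simp: R mem_box_cart)
    show "R \<subseteq> cbox (\<chi> j. a j) (\<chi> j. b j)"
    proof
      fix x assume "x \<in> R"
      then have "x $ j \<in> {a j..b j}" for j using ab(3)[of j] by (auto simp: R)
      then show "x \<in> cbox (\<chi> j. a j) (\<chi> j. b j)" by (simp add: mem_box_cart)
    qed
  qed (use ab in simp)
qed

lemma rectangles_lmeasurable: "R \<in> rectangles \<Longrightarrow> R \<in> lmeasurable"
  by (metis rectangles_sandwich sandwiched_box(1))

lemma rectangles_measure_pos:
  fixes R :: "(real ^ 'n) set"
  assumes "R \<in> rectangles" shows "0 < measure lebesgue R"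
proof -
  obtain a b :: "real ^ 'n" where ab: "\<And>j. a $ j < b $ j" "box a b \<subseteq> R" "R \<subseteq> cbox a b"
    using rectangles_sandwich[OF assms] by metis
  show ?thesis
    unfolding sandwiched_box(2)[OF ab] using ab(1) by (intro prod_pos) simp
qed

text \<open>
  The index gives for each coordinate the level \<open>k\<close> and the position \<open>l\<close> of the side
  \<open>[l 2\<^bsup>k\<^esup>, (l + r) 2\<^bsup>k\<^esup>)\<close>. For \<open>r = 1\<close> these are the dyadic rectangles; for \<open>r = 2\<close> each side consists of two
  adjacent dyadic intervals, and these blocks contain every rectangle with comparable volume.
\<close>

definition dyadic_block :: "real \<Rightarrow> ('n \<Rightarrow> int \<times> int) \<Rightarrow> (real ^ 'n) set" where
  "dyadic_block r x = {v. \<forall>j. v $ j \<in>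
     {of_int (snd (x j)) * 2 powi fst (x j) ..< (of_int (snd (x j)) + r) * 2 powi fst (x j)}}"

lemma dyadic_block_rectangles:
  assumes "0 < r" shows "dyadic_block r x \<in> rectangles"
proof -
  have "of_int (snd (x j)) * 2 powi fst (x j) < (of_int (snd (x j)) + r) * 2 powi fst (x j)" for j
    using assms by (intro mult_strict_right_mono) auto
  then have "is_interval {of_int (snd (x j)) * 2 powi fst (x j) ..< (of_int (snd (x j)) + r) * 2 powi fst (x j)} \<and>
     bounded {of_int (snd (x j)) * 2 powi fst (x j) ..< (of_int (snd (x j)) + r) * 2 powi fst (x j)} \<and>
     interior {of_int (snd (x j)) * 2 powi fst (x j) ..< (of_int (snd (x j)) + r) * 2 powi fst (x j)} \<noteq> {}" for j
    by (auto simp: is_interval_co interior_atLeastLessThan)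
  then show ?thesis
    unfolding rectangles_def dyadic_block_def
    by (intro CollectI exI[of _ "\<lambda>j. {of_int (snd (x j)) * 2 powi fst (x j) ..< (of_int (snd (x j)) + r) * 2 powi fst (x j)}"]) auto
qed

lemma dyadic_rectangles_eq: "dyadic_rectangles = range (dyadic_block 1)"
proof (intro set_eqI iffI)
  fix R :: "(real ^ 'n) set"
  assume "R \<in> dyadic_rectangles"
  then obtain I where I: "\<And>j. I j \<in> dyadic_intervals" and R: "R = {x. \<forall>j. x $ j \<in> I j}"
    by (auto simp: dyadic_rectangles_def)
  have "\<forall>j. \<exists>y :: int \<times> int. I j = {of_int (snd y) * 2 powi fst y ..< (of_int (snd y) + 1) * 2 powi fst y}"
    using I by (fastforce simp: dyadic_intervals_def)
  then obtain x where "\<And>j. I j = {of_int (snd (x j)) * 2 powi fst (x j) ..< (of_int (snd (x j)) + 1) * 2 powi fst (x j)}"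
    by metis
  then have "R = dyadic_block 1 x" by (simp add: R dyadic_block_def)
  then show "R \<in> range (dyadic_block 1)" by simp
next
  fix R :: "(real ^ 'n) set"
  assume "R \<in> range (dyadic_block 1)"
  then obtain x where x: "R = dyadic_block 1 x" by blast
  have "{of_int (snd (x j)) * 2 powi fst (x j) ..< (of_int (snd (x j)) + 1) * 2 powi fst (x j)} \<in> dyadic_intervals" for j
    unfolding dyadic_intervals_def by blast
  then show "R \<in> dyadic_rectangles"
    unfolding dyadic_rectangles_def x dyadic_block_def
    by (intro CollectI exI[of _ "\<lambda>j. {of_int (snd (x j)) * 2 powi fst (x j) ..< (of_int (snd (x j)) + 1) * 2 powi fst (x j)}"]) auto
qed

lemma measure_dyadic_block:
  assumes "0 < r"
  shows "measure lebesgue (dyadic_block r x) = (\<Prod>j\<in>UNIV. r * 2 powi fst (x j))"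
proof -
  let ?a = "\<chi> j. of_int (snd (x j)) * 2 powi fst (x j)"
  let ?b = "\<chi> j. (of_int (snd (x j)) + r) * 2 powi fst (x j)"
  have "measure lebesgue (dyadic_block r x) = (\<Prod>j\<in>UNIV. ?b $ j - ?a $ j)"
  proof (rule sandwiched_box(2))
    show "?a $ j < ?b $ j" for j using assms by simp
  qed (auto simp: dyadic_block_def mem_box_cart less_imp_le)
  then show ?thesis by (simp add: distrib_right)
qed

lemma dyadic_block_lmeasurable: "0 < r \<Longrightarrow> dyadic_block r x \<in> lmeasurable"
  by (rule rectangles_lmeasurable[OF dyadic_block_rectangles])

lemma dyadic_block_sets [measurable]: "0 < r \<Longrightarrow> dyadic_block r x \<in> sets lebesgue"
  using dyadic_block_lmeasurable by blast

lemma measure_dyadic_block_pos: "0 < r \<Longrightarrow> 0 < measure lebesgue (dyadic_block r x)"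
  by (rule rectangles_measure_pos[OF dyadic_block_rectangles])

lemma dyadic_block_halves:
  fixes x :: "'n::finite \<Rightarrow> int \<times> int"
  shows "dyadic_block 1 (x(j := (k + 1, c))) =
     dyadic_block 1 (x(j := (k, 2 * c))) \<union> dyadic_block 1 (x(j := (k, 2 * c + 1)))"
    and "dyadic_block 1 (x(j := (k, 2 * c))) \<inter> dyadic_block 1 (x(j := (k, 2 * c + 1))) = {}"
proof -
  have p: "2 powi (k + 1) = 2 * (2 powi k :: real)" by (simp add: power_int_add)
  define h :: real where "h = 2 powi k"
  have mem: "v \<in> dyadic_block 1 (x(j := (k', c'))) \<longleftrightarrow>
     (\<forall>i. i \<noteq> j \<longrightarrow> v $ i \<in> {of_int (snd (x i)) * 2 powi fst (x i) ..< (of_int (snd (x i)) + 1) * 2 powi fst (x i)})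
     \<and> of_int c' * 2 powi k' \<le> v $ j \<and> v $ j < (of_int c' + 1) * 2 powi k'" for v k' c'
    by (auto simp: dyadic_block_def)
  show "dyadic_block 1 (x(j := (k + 1, c))) =
     dyadic_block 1 (x(j := (k, 2 * c))) \<union> dyadic_block 1 (x(j := (k, 2 * c + 1)))"
    unfolding set_eq_iff Un_iff mem p h_def[symmetric] by (auto simp: algebra_simps)
  show "dyadic_block 1 (x(j := (k, 2 * c))) \<inter> dyadic_block 1 (x(j := (k, 2 * c + 1))) = {}"
    unfolding set_eq_iff Int_iff mem p h_def[symmetric] by (auto simp: algebra_simps)
qed

lemma nn_integral_halves:
  fixes x :: "'n::finite \<Rightarrow> int \<times> int"
  assumes [measurable]: "f \<in> borel_measurable lebesgue"
  shows "(\<integral>\<^sup>+v\<in>dyadic_block 1 (x(j := (k + 1, c))). f v \<partial>lebesgue) =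
    (\<integral>\<^sup>+v\<in>dyadic_block 1 (x(j := (k, 2 * c))). f v \<partial>lebesgue) +
    (\<integral>\<^sup>+v\<in>dyadic_block 1 (x(j := (k, 2 * c + 1))). f v \<partial>lebesgue)"
  unfolding dyadic_block_halves(1)
  by (rule nn_integral_disjoint_pair) (auto simp: dyadic_block_halves(2))

lemma rectangle_subset_block:
  fixes R :: "(real ^ 'n) set"
  assumes "R \<in> rectangles"
  obtains x where "R \<subseteq> dyadic_block 2 x" "measure lebesgue (dyadic_block 2 x) \<le> 4 ^ CARD('n) * measure lebesgue R"
proof -
  obtain a b :: "real ^ 'n" where ab: "\<And>j. a $ j < b $ j" "box a b \<subseteq> R" "R \<subseteq> cbox a b"
    using rectangles_sandwich[OF assms] by metis
  \<comment> \<open>the least power of two that exceeds the side length; two consecutive intervals of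
  this length cover the side\<close>
  define k where "k j = \<lfloor>log 2 (b $ j - a $ j)\<rfloor> + 1" for j
  define l where "l j = \<lfloor>a $ j / 2 powi k j\<rfloor>" for j
  have powi: "2 powi i = 2 powr real_of_int i" for i :: int
    by (rule powr_real_of_int'[symmetric]) auto
  have k: "b $ j - a $ j < 2 powi k j" "2 powi k j \<le> 2 * (b $ j - a $ j)" for j
  proof -
    let ?L = "b $ j - a $ j"
    have L: "0 < ?L" using ab by simp
    have e: "?L = 2 powr (log 2 ?L)" using L by simp
    have "2 powr (log 2 ?L) < 2 powr real_of_int (k j)"
      unfolding k_def by (intro powr_less_mono; simp; linarith)
    then show "?L < 2 powi k j" using e powi by simp
    have "2 powr (real_of_int (k j)) \<le> 2 powr (log 2 ?L + 1)"
      unfolding k_def by (intro powr_mono) auto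
    also have "\<dots> = 2 * ?L" using L by (simp add: powr_add)
    finally show "2 powi k j \<le> 2 * ?L" using powi by simp
  qed
  have l: "of_int (l j) * 2 powi k j \<le> a $ j" "a $ j < (of_int (l j) + 1) * 2 powi k j" for j
  proof -
    have "of_int (l j) \<le> a $ j / 2 powi k j" "a $ j / 2 powi k j < of_int (l j) + 1"
      unfolding l_def by linarith+
    moreover have "(0::real) < 2 powi k j" by simp
    ultimately show "of_int (l j) * 2 powi k j \<le> a $ j" "a $ j < (of_int (l j) + 1) * 2 powi k j"
      by (simp_all only: pos_le_divide_eq pos_divide_less_eq)
  qed
  show ?thesis
  proof (rule that[of "\<lambda>j. (k j, l j)"])
    show "R \<subseteq> dyadic_block 2 (\<lambda>j. (k j, l j))"
    proof
      fix v assume "v \<in> R"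
      then have "a $ j \<le> v $ j \<and> v $ j \<le> b $ j" for j using ab(3) by (auto simp: mem_box_cart)
      then have "of_int (l j) * 2 powi k j \<le> v $ j \<and> v $ j < (of_int (l j) + 2) * 2 powi k j" for j
        using k(1)[of j] l[of j] unfolding distrib_right by (smt (verit, best) mult_2 mult_1)
      then show "v \<in> dyadic_block 2 (\<lambda>j. (k j, l j))" by (simp add: dyadic_block_def)
    qed
    have "(\<Prod>j\<in>UNIV. 2 * 2 powi k j) \<le> (\<Prod>j\<in>UNIV. 4 * (b $ j - a $ j))"
    proof (intro prod_mono conjI)
      show "2 * 2 powi k j \<le> 4 * (b $ j - a $ j)" for j using k(2)[of j] by linarith
    qed simp
    also have "\<dots> = 4 ^ CARD('n) * measure lebesgue R"
      unfolding prod.distrib sandwiched_box(2)[OF ab] by simp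
    finally show "measure lebesgue (dyadic_block 2 (\<lambda>j. (k j, l j))) \<le> 4 ^ CARD('n) * measure lebesgue R"
      by (simp add: measure_dyadic_block)
  qed
qed

text \<open>
  Translation of a block by \<open>e\<close> times its own side lengths.
\<close>

definition shift :: "('n \<Rightarrow> int) \<Rightarrow> ('n \<Rightarrow> int \<times> int) \<Rightarrow> ('n \<Rightarrow> int \<times> int)" where
  "shift e x j = (fst (x j), snd (x j) + e j)"

lemma bij_shift: "bij (shift e)"
  by (rule bij_betw_byWitness[where f' = "shift (\<lambda>j. - e j)"]) (auto simp: shift_def fun_eq_iff)

lemma dyadic_block_two:
  fixes x :: "'n::finite \<Rightarrow> int \<times> int"
  shows "dyadic_block 2 x = (\<Union>e\<in>{e. \<forall>j. e j \<in> {0, 1}}. dyadic_block 1 (shift e x))"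
proof (intro set_eqI iffI)
  fix v assume v: "v \<in> dyadic_block 2 x"
  define e :: "'n \<Rightarrow> int" where "e j = (if v $ j < (of_int (snd (x j)) + 1) * 2 powi fst (x j) then 0 else 1)" for j
  have "v \<in> dyadic_block 1 (shift e x)"
    using v by (auto simp: dyadic_block_def shift_def e_def add.assoc)
  moreover have "\<forall>j. e j \<in> {0, 1}" by (simp add: e_def)
  ultimately show "v \<in> (\<Union>e\<in>{e. \<forall>j. e j \<in> {0, 1}}. dyadic_block 1 (shift e x))" by blast
next
  fix v assume "v \<in> (\<Union>e\<in>{e. \<forall>j. e j \<in> {0, 1}}. dyadic_block 1 (shift e x))"
  then obtain e where e: "\<And>j. e j \<in> {0, 1}" "v \<in> dyadic_block 1 (shift e x)" by blast
  have "of_int (snd (x j)) * 2 powi fst (x j) \<le> v $ j \<and> v $ j < (of_int (snd (x j)) + 2) * 2 powi fst (x j)" for j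
  proof -
    have h: "(0::real) < 2 powi fst (x j)" by simp
    have "(of_int (snd (x j)) + of_int (e j)) * 2 powi fst (x j) \<le> v $ j"
      "v $ j < (of_int (snd (x j)) + of_int (e j) + 1) * 2 powi fst (x j)"
      using e(2) by (auto simp: dyadic_block_def shift_def)
    with h e(1)[of j] show ?thesis by (auto simp: algebra_simps)
  qed
  then show "v \<in> dyadic_block 2 x" by (simp add: dyadic_block_def)
qed

lemma finite_shifts: "finite {e :: 'n::finite \<Rightarrow> int. \<forall>j. e j \<in> {0, 1}}"
  using finite_PiE[of "UNIV :: 'n set" "\<lambda>_. {0, 1 :: int}"] by (simp add: PiE_def Pi_def)

section \<open>The embedding inequality for dyadic rectangles\<close>

text \<open>
  With \<open>u = \<integral>\<^sub>R g\<close> and \<open>w = s(R)\<close> this is \<open>s(R)\<^bsup>-1/p'\<^esup> \<integral>\<^sub>R g\<close>, the quantity whose powers are summed.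
\<close>

definition normalized :: "real \<Rightarrow> ennreal \<Rightarrow> ennreal \<Rightarrow> ennreal" where
  "normalized p u w = u * epowr w (1 / p - 1)"

lemma epowr_cancel:
  assumes "w \<noteq> top"
  shows "epowr w r * epowr w (- r) \<le> 1"
proof -
  consider "w = 0" | a where "w = ennreal a" "0 < a"
    using assms by (cases w) (auto simp: less_le)
  then show ?thesis
  proof cases
    case 1
    then show ?thesis by (auto simp: epowr_def)
  next
    case 2
    then show ?thesis by (simp add: epowr_ennreal_pos ennreal_mult[symmetric] powr_add[symmetric])
  qed
qed

lemma epowr_cancel_eq:
  assumes "w \<noteq> top" "w \<noteq> 0"
  shows "epowr w r * epowr w (- r) = 1"
proof -
  obtain a where "w = ennreal a" "0 < a"
    using assms by (cases w) (auto simp: less_le)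
  then show ?thesis
    by (simp add: epowr_ennreal_pos ennreal_mult[symmetric] powr_add[symmetric])
qed

lemma normalized_powr_le:
  assumes p: "1 < p" and w: "w \<noteq> top" and u: "u \<le> epowr H (1 / p) * epowr w (1 - 1 / p)"
  shows "epowr (normalized p u w) p \<le> H"
proof -
  have "normalized p u w \<le> epowr H (1 / p) * (epowr w (1 - 1 / p) * epowr w (- (1 - 1 / p)))"
    unfolding normalized_def using mult_right_mono[OF u] by (simp add: mult.assoc)
  also have "\<dots> \<le> epowr H (1 / p) * 1"
    by (intro mult_left_mono epowr_cancel w) auto
  finally show ?thesis
    using p by (simp add: epowr_le_iff)
qed

lemma normalized_finite:
  assumes "1 < p" "u \<noteq> top" "w = 0 \<Longrightarrow> u = 0"
  shows "normalized p u w \<noteq> top"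
proof -
  consider "w = 0" | "w = top" | a where "w = ennreal a" "0 < a"
    by (cases w) (auto simp: less_le)
  then show ?thesis
    by cases (use assms in \<open>auto simp: normalized_def epowr_def ennreal_mult_eq_top_iff\<close>)
qed

lemma normalized_inverse:
  assumes "1 < p" "w \<noteq> top" "w = 0 \<Longrightarrow> u = 0"
  shows "normalized p u w * epowr w (1 - 1 / p) = u"
proof (cases "w = 0")
  case True
  then show ?thesis using assms by (simp add: normalized_def)
next
  case False
  then have "epowr w (1 - 1 / p) * epowr w (- (1 - 1 / p)) = 1"
    using assms by (intro epowr_cancel_eq) auto
  then show ?thesis by (simp add: normalized_def mult_ac)
qed

text \<open>
  Hoelder's inequality for two terms: \<open>u1 + u2\<close> is \<open>\<Sum> normalized * w\<^bsup>1-1/p\<^esup>\<close>.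
\<close>

lemma normalized_add_powr_le:
  assumes p: "1 < p" and w: "w1 + w2 \<noteq> top" and u: "w1 = 0 \<Longrightarrow> u1 = 0" "w2 = 0 \<Longrightarrow> u2 = 0"
  shows "epowr (normalized p (u1 + u2) (w1 + w2)) p
    \<le> epowr (normalized p u1 w1) p + epowr (normalized p u2 w2) p"
proof (rule normalized_powr_le[OF p w])
  define f where "f b = (if b then normalized p u1 w1 else normalized p u2 w2)" for b
  define g where "g b = (if b then w1 else w2)" for b
  have "(\<integral>\<^sup>+b. epowr (epowr (f b) p) (1 / p) * epowr (g b) (1 - 1 / p) \<partial>count_space UNIV)
     \<le> epowr (\<integral>\<^sup>+b. epowr (f b) p \<partial>count_space UNIV) (1 / p)
      * epowr (\<integral>\<^sup>+b. g b \<partial>count_space UNIV) (1 - 1 / p)"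
    using p by (intro Holder_nn_integral) auto
  moreover have "normalized p u1 w1 * epowr w1 (1 - 1 / p) = u1"
    "normalized p u2 w2 * epowr w2 (1 - 1 / p) = u2"
    using p w u by (auto intro!: normalized_inverse)
  ultimately show "u1 + u2 \<le> epowr (epowr (normalized p u1 w1) p + epowr (normalized p u2 w2) p) (1 / p)
      * epowr (w1 + w2) (1 - 1 / p)"
    using p by (simp add: nn_integral_count_space_finite UNIV_bool f_def g_def epowr_epowr add.commute)
qed

text \<open>
  This is where reverse doubling produces the contraction factor of the tree bound.
\<close>

lemma normalized_mono_contraction:
  assumes p: "1 < p" and \<gamma>: "0 < \<gamma>" and w: "w \<noteq> top" "w1 \<le> ennreal \<gamma> * w"
  shows "normalized p u w \<le> ennreal (\<gamma> powr (1 - 1 / p)) * normalized p u w1"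
proof -
  have "epowr w (1 / p - 1) \<le> ennreal (\<gamma> powr (1 - 1 / p)) * epowr w1 (1 / p - 1)"
  proof (cases "w1 = 0")
    case True
    then show ?thesis using p \<gamma> by (simp add: epowr_def ennreal_mult_top)
  next
    case False
    then have "w \<noteq> 0" using w(2) by auto
    then obtain a where a: "w = ennreal a" "0 < a" using w(1) by (cases w) (auto simp: less_le)
    have "w1 \<le> ennreal (\<gamma> * a)" using w(2) a \<gamma> by (simp add: ennreal_mult)
    then obtain b where b: "w1 = ennreal b" "0 < b" "b \<le> \<gamma> * a"
      using False a \<gamma> by (cases w1) (auto simp: top_unique less_le)
    have "(\<gamma> * a) powr (1 / p - 1) \<le> b powr (1 / p - 1)"
      using b p by (intro powr_mono2') auto
    then have "\<gamma> powr (1 - 1 / p) * (\<gamma> powr (1 / p - 1) * a powr (1 / p - 1)) \<le> \<gamma> powr (1 - 1 / p) * b powr (1 / p - 1)"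
      using a \<gamma> by (intro mult_left_mono) (auto simp: powr_mult)
    moreover have "\<gamma> powr (1 - 1 / p) * \<gamma> powr (1 / p - 1) = 1"
      using \<gamma> by (simp add: powr_add[symmetric])
    ultimately have "a powr (1 / p - 1) \<le> \<gamma> powr (1 - 1 / p) * b powr (1 / p - 1)"
      by (simp add: mult.assoc[symmetric])
    then show ?thesis
      using a b by (simp add: epowr_ennreal_pos ennreal_mult[symmetric])
  qed
  from mult_left_mono[OF this, of u] show ?thesis
    by (simp add: normalized_def mult_ac)
qed

lemma dyadic_blocks_disjoint_sum:
  fixes B :: "('n::finite \<Rightarrow> int \<times> int) set"
  assumes B: "\<And>x y j. x \<in> B \<Longrightarrow> y \<in> B \<Longrightarrow> fst (x j) = fst (y j)"
    and [measurable]: "h \<in> borel_measurable lebesgue"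
  shows "(\<integral>\<^sup>+x. (\<integral>\<^sup>+v\<in>dyadic_block 1 x. h v \<partial>lebesgue) \<partial>count_space B) \<le> (\<integral>\<^sup>+v. h v \<partial>lebesgue)"
proof -
  have eq: "x = y" if "x \<in> B" "y \<in> B" "v \<in> dyadic_block 1 x" "v \<in> dyadic_block 1 y" for x y v
  proof (rule ext)
    fix j
    define h :: real where "h = 2 powi fst (x j)"
    have h: "0 < h" by (simp add: h_def)
    have k: "fst (y j) = fst (x j)" using B that by metis
    have "of_int (snd (x j)) * h \<le> v $ j" "v $ j < (of_int (snd (x j)) + 1) * h"
      "of_int (snd (y j)) * h \<le> v $ j" "v $ j < (of_int (snd (y j)) + 1) * h"
      using that(3)[unfolded dyadic_block_def, simplified, rule_format, of j]
        that(4)[unfolded dyadic_block_def, simplified, rule_format, of j] by (simp_all add: h_def k)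
    then have "of_int (snd (x j)) * h < (of_int (snd (y j)) + 1) * h" "of_int (snd (y j)) * h < (of_int (snd (x j)) + 1) * h"
      by linarith+
    then have "of_int (snd (x j)) < (of_int (snd (y j)) + 1 :: real)" "of_int (snd (y j)) < (of_int (snd (x j)) + 1 :: real)"
      using h by simp_all
    then have "snd (x j) = snd (y j)" by linarith
    then show "x j = y j" using k by (simp add: prod_eq_iff)
  qed
  have "(\<integral>\<^sup>+x. (\<integral>\<^sup>+v\<in>dyadic_block 1 x. h v \<partial>lebesgue) \<partial>count_space B)
    = (\<integral>\<^sup>+x. emeasure (density lebesgue h) (dyadic_block 1 x) \<partial>count_space B)"
    by (intro nn_integral_cong) (simp add: emeasure_density)
  also have "\<dots> = emeasure (density lebesgue h) (\<Union>x\<in>B. dyadic_block 1 x)"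
    using eq by (intro emeasure_UN_countable[symmetric]) (auto simp: disjoint_family_on_def)
  also have "\<dots> \<le> emeasure (density lebesgue h) UNIV"
    by (intro emeasure_mono) auto
  also have "\<dots> = (\<integral>\<^sup>+v. h v \<partial>lebesgue)"
    by (simp add: emeasure_density)
  finally show ?thesis .
qed

text \<open>
  The values \<open>F(R) = s(R)\<^bsup>-1/p'\<^esup> \<integral>\<^sub>R g\<close> satisfy the hypotheses of the tree bound in each coordinate: the
  contraction comes from reverse doubling and the subadditivity of \<open>F\<^bsup>p\<^esup>\<close> from Hoelder's inequality. Summing
  over all coordinates bounds the sum over the rectangles with levels at least \<open>-N\<close> by a constant times
  the \<open>t\<close>-th power of the sum of \<open>F\<^bsup>p\<^esup>\<close> over the cubes of level \<open>-N\<close>; that sum is at most \<open>\<integral> h\<close>, where \<open>g = h\<^bsup>1/p\<^esup> s\<^bsup>1-1/p\<^esup>\<close>. The constant does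
  not depend on \<open>N\<close>, and \<open>N\<close> tends to infinity. The predicate \<open>good\<close> allows \<open>s\<close> to be infinite on part of the space.
\<close>

lemma dyadic_embedding:
  fixes p t \<gamma> :: real and s g h :: "real ^ 'n \<Rightarrow> ennreal"
  assumes p: "1 < p" and t: "1 < t" and \<gamma>: "0 < \<gamma>"
    and C: "tree_bound p t (\<gamma> powr (1 - 1 / p)) C"
    and [measurable]: "s \<in> borel_measurable lebesgue" "g \<in> borel_measurable lebesgue" "h \<in> borel_measurable lebesgue"
    and good: "\<And>x j k c e. e \<in> {0, 1} \<Longrightarrow> good (x(j := (k, 2 * c + e))) = good (x(j := (k + 1, c)))"
    and sfin: "\<And>x. good x \<Longrightarrow> (\<integral>\<^sup>+v\<in>dyadic_block 1 x. s v \<partial>lebesgue) \<noteq> top"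
    and gfin: "\<And>x. good x \<Longrightarrow> (\<integral>\<^sup>+v\<in>dyadic_block 1 x. g v \<partial>lebesgue) \<noteq> top"
    and gh: "\<And>x. good x \<Longrightarrow> AE v in lebesgue. v \<in> dyadic_block 1 x \<longrightarrow> g v = epowr (h v) (1 / p) * epowr (s v) (1 - 1 / p)"
    and rd: "\<And>x j k c e. e \<in> {0, 1} \<Longrightarrow> good (x(j := (k + 1, c))) \<Longrightarrow>
        (\<integral>\<^sup>+v\<in>dyadic_block 1 (x(j := (k, 2 * c + e))). s v \<partial>lebesgue)
        \<le> ennreal \<gamma> * (\<integral>\<^sup>+v\<in>dyadic_block 1 (x(j := (k + 1, c))). s v \<partial>lebesgue)"
  shows "(\<integral>\<^sup>+x. (if good x then epowr (normalized p (\<integral>\<^sup>+v\<in>dyadic_block 1 x. g v \<partial>lebesgue)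
          (\<integral>\<^sup>+v\<in>dyadic_block 1 x. s v \<partial>lebesgue)) (p * t) else 0) \<partial>count_space UNIV)
      \<le> ennreal (C ^ CARD('n)) * epowr (\<integral>\<^sup>+v. h v \<partial>lebesgue) t"
proof -
  define \<rho> where "\<rho> = \<gamma> powr (1 - 1 / p)"
  have \<rho>: "0 \<le> \<rho>" by (simp add: \<rho>_def)
  have C0: "0 \<le> C" using C by (simp add: tree_bound_def)
  have tree: "(\<integral>\<^sup>+y. epowr (ennreal (F y powr p)) t \<partial>count_space UNIV)
        \<le> ennreal C * epowr (\<integral>\<^sup>+y. ennreal (F y powr p) \<partial>count_space ({0} \<times> UNIV)) t"
    if "\<And>y. 0 \<le> F y" "\<And>m c. F (Suc m, c) \<le> \<rho> * (F (m, 2 * c) + F (m, 2 * c + 1))"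
      "\<And>m c. F (Suc m, c) powr p \<le> F (m, 2 * c) powr p + F (m, 2 * c + 1) powr p"
    for F :: "nat \<times> int \<Rightarrow> real"
    using C that unfolding tree_bound_def \<rho>_def by blast
  define W where "W x = (\<integral>\<^sup>+v\<in>dyadic_block 1 x. s v \<partial>lebesgue)" for x
  define U where "U x = (\<integral>\<^sup>+v\<in>dyadic_block 1 x. g v \<partial>lebesgue)" for x
  define H where "H x = (\<integral>\<^sup>+v\<in>dyadic_block 1 x. h v \<partial>lebesgue)" for x
  define E where "E x = (if good x then normalized p (U x) (W x) else 0)" for x
  define F where "F x = enn2real (E x)" for x
  have UH: "U x \<le> epowr (H x) (1 / p) * epowr (W x) (1 - 1 / p)" if "good x" for x
  proof -
    have "U x = (\<integral>\<^sup>+v. epowr (h v * indicator (dyadic_block 1 x) v) (1 / p) *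
        epowr (s v * indicator (dyadic_block 1 x) v) (1 - 1 / p) \<partial>lebesgue)"
      unfolding U_def using gh[OF that] p
      by (intro nn_integral_cong_AE) (auto elim!: eventually_mono simp: indicator_def)
    also have "\<dots> \<le> epowr (H x) (1 / p) * epowr (W x) (1 - 1 / p)"
      unfolding H_def W_def using p by (intro Holder_nn_integral) auto
    finally show ?thesis .
  qed
  have U0: "U x = 0" if "good x" "W x = 0" for x
    using UH[OF that(1)] that(2) p by simp
  have EF: "E x = ennreal (F x)" for x
    using normalized_finite[OF p gfin[of x], folded U_def, of "W x"] U0[of x]
    by (auto simp: F_def E_def less_top)
  have F0: "0 \<le> F x" for x by (simp add: F_def)
  have Fp: "ennreal (F x powr p) = epowr (E x) p" for x
    using p by (simp add: EF epowr_ennreal F0)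
  have EH: "epowr (E x) p \<le> H x" for x
    using normalized_powr_le[OF p sfin[of x], folded W_def, OF _ UH] p by (auto simp: E_def)
  have UW2: "U (x(j := (k + 1, c))) = U (x(j := (k, 2 * c))) + U (x(j := (k, 2 * c + 1)))"
    "W (x(j := (k + 1, c))) = W (x(j := (k, 2 * c))) + W (x(j := (k, 2 * c + 1)))" for x j k c
    unfolding U_def W_def by (rule nn_integral_halves; simp)+
  have Ep: "epowr (E (x(j := (k + 1, c)))) p
     \<le> epowr (E (x(j := (k, 2 * c)))) p + epowr (E (x(j := (k, 2 * c + 1)))) p" for x j k c
  proof (cases "good (x(j := (k + 1, c)))")
    case True
    then have "good (x(j := (k, 2 * c)))" "good (x(j := (k, 2 * c + 1)))"
      using good[of 0 x j k c] good[of 1 x j k c] by auto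
    then show ?thesis
      using True p sfin[OF True, folded W_def] unfolding E_def UW2
      by (auto intro!: normalized_add_powr_le U0)
  qed (use p in \<open>simp add: E_def\<close>)
  have E\<rho>: "E (x(j := (k + 1, c))) \<le> ennreal \<rho> * (E (x(j := (k, 2 * c))) + E (x(j := (k, 2 * c + 1))))" for x j k c
  proof (cases "good (x(j := (k + 1, c)))")
    case True
    let ?w = "W (x(j := (k + 1, c)))"
    have g: "good (x(j := (k, 2 * c)))" "good (x(j := (k, 2 * c + 1)))"
      using True good[of 0 x j k c] good[of 1 x j k c] by auto
    have "normalized p (U (x(j := (k + 1, c)))) ?w =
       normalized p (U (x(j := (k, 2 * c)))) ?w + normalized p (U (x(j := (k, 2 * c + 1)))) ?w"
      by (simp add: UW2(1) normalized_def distrib_right)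
    also have "\<dots> \<le> ennreal \<rho> * normalized p (U (x(j := (k, 2 * c)))) (W (x(j := (k, 2 * c))))
       + ennreal \<rho> * normalized p (U (x(j := (k, 2 * c + 1)))) (W (x(j := (k, 2 * c + 1))))"
      unfolding \<rho>_def using p \<gamma> sfin[OF True] rd[of 0, OF _ True] rd[of 1, OF _ True]
      by (intro add_mono normalized_mono_contraction) (auto simp: W_def)
    finally show ?thesis
      using True g by (simp add: E_def distrib_left)
  qed (simp add: E_def)
  have bound: "(\<integral>\<^sup>+x. epowr (E x) (p * t) * indicator {x. \<forall>j. 0 \<le> fst (x j) + int N} x \<partial>count_space UNIV)
      \<le> ennreal (C ^ CARD('n)) * epowr (\<integral>\<^sup>+v. h v \<partial>lebesgue) t" for N
  proof -
    \<comment> \<open>levels are counted from \<open>-N\<close>, so that the cubes of level \<open>-N\<close> are the leaves\<close>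
    define emb where "emb x' = (\<lambda>j. (int (fst (x' j)) - int N, snd (x' j)))" for x' :: "'n \<Rightarrow> nat \<times> int"
    have bij: "bij_betw emb UNIV {x. \<forall>j. 0 \<le> fst (x j) + int N}"
      by (rule bij_betw_byWitness[where f' = "\<lambda>x j. (nat (fst (x j) + int N), snd (x j))"])
        (auto simp: emb_def fun_eq_iff prod_eq_iff)
    have emb: "emb (x'(j := (m, c))) = (emb x')(j := (int m - int N, c))" for x' j m c
      by (auto simp: emb_def)
    define G where "G x' = epowr (E (emb x')) p" for x'
    define B where "B = {0 :: nat} \<times> (UNIV :: int set)"
    have one: "(\<integral>\<^sup>+y. epowr (G (x'(j := y))) t \<partial>count_space UNIV)
        \<le> ennreal C * epowr (\<integral>\<^sup>+y. G (x'(j := y)) \<partial>count_space B) t" for x' j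
    proof -
      define f where "f y = F (emb (x'(j := y)))" for y
      have G: "G (x'(j := y)) = ennreal (f y powr p)" for y
        by (simp add: G_def f_def Fp)
      have suc: "int (Suc m) - int N = (int m - int N) + 1" for m by simp
      have "f (Suc m, c) \<le> \<rho> * (f (m, 2 * c) + f (m, 2 * c + 1))" for m c
        using E\<rho>[of "emb x'" j "int m - int N" c] \<rho> F0
        unfolding f_def emb suc
        by (simp add: EF ennreal_plus[symmetric] ennreal_mult[symmetric] del: ennreal_plus)
      moreover have "f (Suc m, c) powr p \<le> f (m, 2 * c) powr p + f (m, 2 * c + 1) powr p" for m c
        using Ep[of "emb x'" j "int m - int N" c]
        unfolding f_def emb suc
        by (simp add: Fp[symmetric] ennreal_plus[symmetric] del: ennreal_plus)
      ultimately show ?thesis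
        unfolding G B_def by (intro tree) (auto simp: f_def F0)
    qed
    have "(\<integral>\<^sup>+x. epowr (E x) (p * t) * indicator {x. \<forall>j. 0 \<le> fst (x j) + int N} x \<partial>count_space UNIV)
      = (\<integral>\<^sup>+x. epowr (E x) (p * t) \<partial>count_space {x. \<forall>j. 0 \<le> fst (x j) + int N})"
      by (simp add: nn_integral_count_space_indicator)
    also have "\<dots> = (\<integral>\<^sup>+x'. epowr (G x') t \<partial>count_space UNIV)"
      by (subst nn_integral_bij_count_space[OF bij, symmetric]) (simp add: G_def epowr_epowr)
    also have "\<dots> \<le> ennreal (C ^ CARD('n)) * epowr (\<integral>\<^sup>+x'. G x' \<partial>count_space (variants UNIV B (\<lambda>_. (0, 0)))) t"
      using tensorized_summation[where S = UNIV and x = "\<lambda>_. (0, 0)", OF t C0 one] by (simp add: variants_def)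
    also have "\<dots> \<le> ennreal (C ^ CARD('n)) * epowr (\<integral>\<^sup>+v. h v \<partial>lebesgue) t"
    proof (intro mult_left_mono epowr_mono)
      let ?V = "variants UNIV B (\<lambda>_::'n. (0, 0))"
      have inj: "inj_on emb ?V"
        using bij by (meson bij_betw_def inj_on_subset subset_UNIV)
      have "(\<integral>\<^sup>+x'. G x' \<partial>count_space ?V) \<le> (\<integral>\<^sup>+x'. H (emb x') \<partial>count_space ?V)"
        unfolding G_def by (intro nn_integral_mono EH)
      also have "\<dots> = (\<integral>\<^sup>+x. H x \<partial>count_space (emb ` ?V))"
        by (rule nn_integral_bij_count_space) (use inj in \<open>simp add: bij_betw_def\<close>)
      also have "\<dots> \<le> (\<integral>\<^sup>+v. h v \<partial>lebesgue)"
        unfolding H_def by (rule dyadic_blocks_disjoint_sum) (auto simp: variants_def B_def emb_def mem_Times_iff)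
      finally show "(\<integral>\<^sup>+x'. G x' \<partial>count_space ?V) \<le> (\<integral>\<^sup>+v. h v \<partial>lebesgue)" .
    qed (use t in auto)
    finally show ?thesis .
  qed
  define f where "f N x = epowr (E x) (p * t) * indicator {x. \<forall>j. 0 \<le> fst (x j) + int N} x" for N :: nat and x
  have "epowr (E x) (p * t) \<le> (SUP N. f N x)" for x
  proof -
    define N where "N = (\<Sum>i\<in>UNIV. nat (- fst (x i)))"
    have "0 \<le> fst (x j) + int N" for j
    proof -
      have "nat (- fst (x j)) \<le> N"
        unfolding N_def by (rule member_le_sum) auto
      then show ?thesis by linarith
    qed
    then have "f N x = epowr (E x) (p * t)"
      by (simp add: f_def)
    then show ?thesis by (metis SUP_upper UNIV_I)
  qed
  then have "(\<integral>\<^sup>+x. epowr (E x) (p * t) \<partial>count_space UNIV) \<le> (\<integral>\<^sup>+x. (SUP N. f N x) \<partial>count_space UNIV)"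
    by (intro nn_integral_mono)
  also have "\<dots> = (SUP N. \<integral>\<^sup>+x. f N x \<partial>count_space UNIV)"
  proof (rule nn_integral_monotone_convergence_SUP)
    show "incseq f"
    proof (intro monoI le_funI)
      fix m n :: nat and x :: "'n \<Rightarrow> int \<times> int" assume mn: "m \<le> n"
      have "\<forall>j. 0 \<le> fst (x j) + int n" if "\<forall>j. 0 \<le> fst (x j) + int m"
      proof
        fix j show "0 \<le> fst (x j) + int n" using spec[OF that, of j] mn by linarith
      qed
      then show "f m x \<le> f n x" by (auto simp: f_def indicator_def)
    qed
  qed simp
  also have "\<dots> \<le> ennreal (C ^ CARD('n)) * epowr (\<integral>\<^sup>+v. h v \<partial>lebesgue) t"
    unfolding f_def by (intro SUP_least bound)
  also have "(\<lambda>x. epowr (E x) (p * t)) = (\<lambda>x. if good x then epowr (normalized p (U x) (W x)) (p * t) else 0)"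
    using p t by (auto simp: E_def)
  finally show ?thesis
    unfolding U_def W_def .
qed

section \<open>Locally integrable functions\<close>

text \<open>
  The function is the pointwise limit of its restrictions to growing balls.
\<close>

lemma locally_integrable_measurable:
  fixes f :: "real ^ 'n \<Rightarrow> real"
  assumes "locally_integrable f"
  shows "f \<in> borel_measurable lebesgue"
proof (rule borel_measurable_LIMSEQ_real)
  fix N :: nat
  have "f absolutely_integrable_on cball 0 (real N)"
    using assms by (simp add: locally_integrable_def)
  then have "(\<lambda>x. indicator (cball 0 (real N)) x *\<^sub>R f x) \<in> borel_measurable lebesgue"
    by (auto simp: set_integrable_def)
  then show "(\<lambda>x. indicator (cball 0 (real N)) x * f x) \<in> borel_measurable lebesgue" by simp
next
  fix x :: "real ^ 'n"
  obtain N :: nat where N: "norm x \<le> real N" using real_arch_simple by blast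
  have "eventually (\<lambda>n. indicator (cball 0 (real n)) x * f x = f x) sequentially"
    using eventually_ge_at_top[of N] by eventually_elim (use N in \<open>auto simp: indicator_def\<close>)
  then show "(\<lambda>n. indicator (cball 0 (real n)) x * f x) \<longlonglongrightarrow> f x"
    by (rule tendsto_eventually)
qed

lemma locally_integrable_finite:
  fixes f :: "real ^ 'n \<Rightarrow> real"
  assumes f: "locally_integrable f" and R: "R \<in> rectangles"
  shows "(\<integral>\<^sup>+v\<in>R. ennreal \<bar>f v\<bar> \<partial>lebesgue) \<noteq> top"
proof -
  obtain a b :: "real ^ 'n" where "R \<subseteq> cbox a b"
    using rectangles_sandwich[OF R] by metis
  then have "(\<integral>\<^sup>+v\<in>R. ennreal \<bar>f v\<bar> \<partial>lebesgue) \<le> (\<integral>\<^sup>+v. ennreal (norm (indicator (cbox a b) v *\<^sub>R f v)) \<partial>lebesgue)"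
    by (intro nn_integral_mono) (auto simp: indicator_def)
  also have "\<dots> < top"
    using f by (auto simp: locally_integrable_def set_integrable_def integrable_iff_bounded)
  finally show ?thesis by simp
qed

section \<open>The weight condition and reverse doubling\<close>

locale fractional_weights =
  fixes \<alpha> P q :: real
    and p :: "'m::finite \<Rightarrow> real"
    and \<omega> :: "'m \<Rightarrow> real ^ 'n \<Rightarrow> real"
  assumes p_gt_1: "\<And>i. 1 < p i"
    and P_eq: "1 / P = (\<Sum>i\<in>UNIV. 1 / p i)"
    and P_less_q: "P < q"
    and q_eq: "1 / q = 1 / P - \<alpha> / real CARD('n)"
    and weight: "\<And>i. weight (\<omega> i)"
begin

text \<open>
  The product of the \<open>m\<close> normalizing factors in the maximal function is \<open>|R|\<^bsup>-\<kappa>\<^esup>\<close>.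
\<close>

definition \<kappa> :: real where
  "\<kappa> = real CARD('m) - \<alpha> / real CARD('n)"

text \<open>
  The functions \<open>dual i\<close> and \<open>target\<close> are the \<open>\<sigma>\<^sub>i\<close> and \<open>V\<close> of the introduction.
\<close>

definition dual :: "'m \<Rightarrow> real ^ 'n \<Rightarrow> ennreal" where
  "dual i v = epowr (ennreal (\<omega> i v)) (- conj_exp (p i))"

definition target :: "real ^ 'n \<Rightarrow> ennreal" where
  "target v = epowr (ennreal (weight_prod \<omega> v)) q"

definition dual_mass :: "'m \<Rightarrow> (real ^ 'n) set \<Rightarrow> ennreal" where
  "dual_mass i R = (\<integral>\<^sup>+v\<in>R. dual i v \<partial>lebesgue)"

definition target_mass :: "(real ^ 'n) set \<Rightarrow> ennreal" where
  "target_mass R = (\<integral>\<^sup>+v\<in>R. target v \<partial>lebesgue)"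

text \<open>
  The weight condition for the single set \<open>R\<close>, with the averages replaced by integrals.
\<close>

definition weight_bound :: "real \<Rightarrow> (real ^ 'n) set \<Rightarrow> bool" where
  "weight_bound K R \<longleftrightarrow> epowr (target_mass R) (1 / q) * (\<Prod>i\<in>UNIV. epowr (dual_mass i R) (1 - 1 / p i))
     \<le> ennreal K * ennreal (measure lebesgue R powr \<kappa>)"

lemma P_pos: "0 < P"
proof -
  have "0 < (\<Sum>i\<in>UNIV. 1 / p i)"
    using p_gt_1 by (intro sum_pos) (auto intro: less_trans[OF zero_less_one])
  then show ?thesis by (simp add: P_eq[symmetric])
qed

lemma q_pos: "0 < q"
  using P_pos P_less_q by simp

lemma exponent_ratio: "1 < q / P"
  using P_pos P_less_q by simp

lemma dual_exponent: "1 / conj_exp (p i) = 1 - 1 / p i" "conj_exp (p i) * (1 - 1 / p i) = 1"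
  "0 < conj_exp (p i)" "0 < 1 - 1 / p i"
  using p_gt_1[of i] by (auto simp: conj_exp_def field_simps)

lemma p_pos: "0 < p i"
  using p_gt_1[of i] by simp

lemma \<kappa>_eq: "\<kappa> = 1 / q + (\<Sum>i\<in>UNIV. 1 - 1 / p i)"
  by (simp add: \<kappa>_def q_eq P_eq sum_subtractf)

lemma \<kappa>_pos: "0 < \<kappa>"
  unfolding \<kappa>_eq using q_pos dual_exponent(4) by (intro add_pos_nonneg sum_nonneg) (auto intro: less_imp_le)

lemma \<omega>_nonneg: "0 \<le> \<omega> i v"
  using weight by (simp add: weight_def)

lemma \<omega>_measurable [measurable]: "\<omega> i \<in> borel_measurable lebesgue"
  using weight by (simp add: weight_def)

lemma dual_measurable [measurable]: "dual i \<in> borel_measurable lebesgue"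
  unfolding dual_def[abs_def] by measurable

lemma target_measurable [measurable]: "target \<in> borel_measurable lebesgue"
  unfolding target_def[abs_def] weight_prod_def[abs_def] by measurable

lemma dual_pos: "dual i v \<noteq> 0"
  using dual_exponent(3)[of i] by (auto simp: dual_def epowr_def ennreal_eq_0_iff)

lemma dual_mass_pos:
  assumes "R \<in> lmeasurable" "0 < measure lebesgue R"
  shows "dual_mass i R \<noteq> 0"
proof
  assume "dual_mass i R = 0"
  then have "AE v in lebesgue. dual i v * indicator R v = 0"
    using assms(1) unfolding dual_mass_def by (subst (asm) nn_integral_0_iff_AE) (auto simp: fmeasurableD)
  then have "AE v in lebesgue. v \<notin> R"
    by eventually_elim (auto simp: dual_pos indicator_def split: if_splits)
  then have "emeasure lebesgue R = 0"
    using assms(1) by (subst (asm) AE_iff_measurable[of R]) (auto simp: fmeasurableD)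
  then show False using assms(2) by (simp add: measure_def)
qed

lemma mass_mono:
  "E \<subseteq> R \<Longrightarrow> dual_mass i E \<le> dual_mass i R" "E \<subseteq> R \<Longrightarrow> target_mass E \<le> target_mass R"
  unfolding dual_mass_def target_mass_def
  by (auto intro!: nn_integral_mono mult_left_mono simp: indicator_def)

text \<open>
  The other factors on the left of the weight condition do not vanish, so an infinite one would make
  the whole product infinite.
\<close>

lemma dual_mass_finite:
  assumes K: "weight_bound K R" and R: "R \<in> lmeasurable" "0 < measure lebesgue R" and good: "target_mass R \<noteq> 0"
  shows "dual_mass i R \<noteq> top"
proof
  assume "dual_mass i R = top"
  then have "(\<Prod>i\<in>UNIV. epowr (dual_mass i R) (1 - 1 / p i)) = top"
    using dual_exponent(4) dual_mass_pos[OF R]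
    by (auto simp: ennreal_prod_eq_top epowr_eq_0_iff epowr_eq_top_iff intro!: exI[of _ i])
  then have "epowr (target_mass R) (1 / q) * (\<Prod>i\<in>UNIV. epowr (dual_mass i R) (1 - 1 / p i)) = top"
    using good q_pos by (simp add: ennreal_mult_top epowr_eq_0_iff)
  with K show False
    by (simp add: weight_bound_def top_unique ennreal_mult_eq_top_iff)
qed

lemma weights_pos_AE:
  assumes K: "weight_bound K R" and R: "R \<in> lmeasurable" "0 < measure lebesgue R" and good: "target_mass R \<noteq> 0"
  shows "AE v in lebesgue. v \<in> R \<longrightarrow> (\<forall>i. 0 < \<omega> i v)"
proof -
  have "AE v in lebesgue. v \<in> R \<longrightarrow> 0 < \<omega> i v" for i
  proof -
    have "AE v in lebesgue. dual i v * indicator R v \<noteq> \<infinity>"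
      using dual_mass_finite[OF assms, of i] R(1)
      by (intro nn_integral_noteq_infinite) (auto simp: dual_mass_def fmeasurableD)
    then show ?thesis
    proof eventually_elim
      case (elim v)
      then show ?case
        using \<omega>_nonneg[of i v] dual_exponent(3)[of i] by (auto simp: dual_def epowr_def less_le)
    qed
  qed
  then have "AE v in lebesgue. \<forall>i\<in>UNIV. v \<in> R \<longrightarrow> 0 < \<omega> i v"
    by (subst AE_finite_all) auto
  then show ?thesis by eventually_elim auto
qed

text \<open>
  Finiteness of the dual masses forces all weights, and with them \<open>V\<close>, to be positive almost
  everywhere on \<open>R\<close>.
\<close>

lemma target_mass_pos_subset:
  assumes "weight_bound K R" "R \<in> lmeasurable" "0 < measure lebesgue R" "target_mass R \<noteq> 0"
    and E: "E \<in> lmeasurable" "0 < measure lebesgue E" "E \<subseteq> R"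
  shows "target_mass E \<noteq> 0"
proof
  assume "target_mass E = 0"
  then have "AE v in lebesgue. target v * indicator E v = 0"
    using E(1) unfolding target_mass_def by (subst (asm) nn_integral_0_iff_AE) (auto simp: fmeasurableD)
  then have "AE v in lebesgue. v \<notin> E"
    using weights_pos_AE[OF assms(1-4)]
  proof eventually_elim
    case (elim v)
    show ?case
    proof
      assume v: "v \<in> E"
      then have "\<forall>i. 0 < \<omega> i v" using elim(2) E(3) by auto
      then have "0 < weight_prod \<omega> v" by (simp add: weight_prod_def prod_pos)
      then show False using elim(1) v q_pos by (simp add: target_def epowr_ennreal_pos)
    qed
  qed
  then have "emeasure lebesgue E = 0"
    using E(1) by (subst (asm) AE_iff_measurable[of E]) (auto simp: fmeasurableD)
  then show False using E(2) by (simp add: measure_def)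
qed

text \<open>
  The reverse of the weight condition, for sets on which the weights are positive: \<open>1 = V\<^bsup>1/(q\<kappa>)\<^esup> \<Prod>\<^sub>i \<sigma>\<^sub>i\<^bsup>1/(p\<^sub>i'\<kappa>)\<^esup>\<close> pointwise, and
  the exponents add up to one by the definition of \<open>\<kappa>\<close>.
\<close>

lemma measure_le_masses:
  assumes E: "E \<in> lmeasurable" and pos: "AE v in lebesgue. v \<in> E \<longrightarrow> (\<forall>i. 0 < \<omega> i v)"
  shows "ennreal (measure lebesgue E powr \<kappa>)
     \<le> epowr (target_mass E) (1 / q) * (\<Prod>i\<in>UNIV. epowr (dual_mass i E) (1 - 1 / p i))"
proof -
  \<comment> \<open>\<open>None\<close> indexes \<open>V\<close> and \<open>Some i\<close> indexes \<open>\<sigma>\<^sub>i\<close>\<close>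
  define l where "l o' = (case o' of None \<Rightarrow> 1 / q / \<kappa> | Some i \<Rightarrow> (1 - 1 / p i) / \<kappa>)" for o'
  define f where "f o' v = (case o' of None \<Rightarrow> target v | Some i \<Rightarrow> dual i v) * indicator E v" for o' v
  have [measurable]: "E \<in> sets lebesgue" using E by blast
  have f_meas: "f o' \<in> borel_measurable lebesgue" for o'
    by (cases o') (simp_all add: f_def[abs_def])
  have UNIV_split: "(UNIV :: 'm option set) = insert None (Some ` UNIV)"
    by (simp add: UNIV_option_conv)
  have prod_split: "(\<Prod>o'\<in>UNIV. F o') = F None * (\<Prod>i\<in>UNIV. F (Some i))" for F :: "'m option \<Rightarrow> ennreal"
    unfolding UNIV_split by (subst prod.insert) (auto simp: prod.reindex)
  have sum_split: "(\<Sum>o'\<in>UNIV. F o') = F None + (\<Sum>i\<in>UNIV. F (Some i))" for F :: "'m option \<Rightarrow> real"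
    unfolding UNIV_split by (subst sum.insert) (auto simp: sum.reindex)
  have l_pos: "0 < l o'" for o'
    using q_pos \<kappa>_pos dual_exponent(4) by (auto simp: l_def split: option.splits)
  have l_sum: "(\<Sum>o'\<in>UNIV. l o') = 1"
  proof -
    have "(\<Sum>o'\<in>UNIV. l o') = (1 / q + (\<Sum>i\<in>UNIV. 1 - 1 / p i)) / \<kappa>"
      by (simp only: sum_split l_def option.case sum_divide_distrib add_divide_distrib)
    then show ?thesis using \<kappa>_pos \<kappa>_eq by simp
  qed
  have "emeasure lebesgue E = (\<integral>\<^sup>+v. indicator E v \<partial>lebesgue)" by simp
  also have "\<dots> = (\<integral>\<^sup>+v. (\<Prod>o'\<in>UNIV. epowr (f o' v) (l o')) \<partial>lebesgue)"
  proof (rule nn_integral_cong_AE)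
    show "AE v in lebesgue. indicator E v = (\<Prod>o'\<in>UNIV. epowr (f o' v) (l o'))"
      using pos
    proof eventually_elim
      case (elim v)
      show ?case
      proof (cases "v \<in> E")
        case True
        then have w: "0 < \<omega> i v" for i using elim by auto
        have W: "0 < weight_prod \<omega> v" using w by (simp add: weight_prod_def prod_pos)
        have "epowr (f None v) (l None) = ennreal (weight_prod \<omega> v powr (1 / \<kappa>))"
          using True W q_pos by (simp add: f_def l_def target_def epowr_epowr epowr_ennreal_pos powr_powr)
        moreover have "epowr (f (Some i) v) (l (Some i)) = ennreal (\<omega> i v powr (- 1 / \<kappa>))" for i
          using True w[of i] dual_exponent(2)[of i]
          by (simp add: f_def l_def dual_def epowr_epowr epowr_ennreal_pos powr_powr)
        moreover have "weight_prod \<omega> v powr (1 / \<kappa>) * (\<Prod>i\<in>UNIV. \<omega> i v powr (- 1 / \<kappa>)) = 1"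
        proof -
          have "(\<Prod>i\<in>UNIV. \<omega> i v powr (- 1 / \<kappa>)) = weight_prod \<omega> v powr (- 1 / \<kappa>)"
            using \<omega>_nonneg by (simp add: weight_prod_def prod_powr_distrib)
          then show ?thesis using W by (simp add: powr_add[symmetric])
        qed
        ultimately show ?thesis
          using True by (simp add: prod_split prod_ennreal ennreal_mult[symmetric] prod_nonneg)
      next
        case False
        then show ?thesis using l_pos by (simp add: f_def prod_split)
      qed
    qed
  qed
  also have "\<dots> \<le> (\<Prod>o'\<in>UNIV. epowr (\<integral>\<^sup>+v. f o' v \<partial>lebesgue) (l o'))"
    using l_pos l_sum f_meas by (intro Holder_nn_integral_prod) auto
  finally have "epowr (emeasure lebesgue E) \<kappa> \<le> epowr (\<Prod>o'\<in>UNIV. epowr (\<integral>\<^sup>+v. f o' v \<partial>lebesgue) (l o')) \<kappa>"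
    using \<kappa>_pos by (intro epowr_mono) auto
  also have "\<dots> = epowr (target_mass E) (1 / q) * (\<Prod>i\<in>UNIV. epowr (dual_mass i E) (1 - 1 / p i))"
    using \<kappa>_pos by (simp add: prod_split epowr_mult epowr_prod epowr_epowr l_def f_def target_mass_def dual_mass_def)
  also have "epowr (emeasure lebesgue E) \<kappa> = ennreal (measure lebesgue E powr \<kappa>)"
    using \<kappa>_pos E by (simp add: emeasure_eq_measure2 epowr_ennreal)
  finally show ?thesis .
qed

text \<open>
  Compare the lower bound \<open>measure_le_masses\<close> for \<open>E\<close> with the weight condition for \<open>R\<close>, after
  enlarging \<open>E\<close> to \<open>R\<close> in all factors but the one of \<open>\<sigma>\<^sub>i\<close>.
\<close>

lemma dual_mass_doubling:
  assumes K: "weight_bound K R" and R: "R \<in> lmeasurable" "0 < measure lebesgue R" and good: "target_mass R \<noteq> 0"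
    and E: "E \<in> lmeasurable" "E \<subseteq> R" "measure lebesgue R = 2 * measure lebesgue E" and K1: "1 \<le> K"
  shows "dual_mass i R \<le> ennreal ((K * 2 powr \<kappa>) powr conj_exp (p i)) * dual_mass i E"
proof -
  let ?e = "\<lambda>l. 1 - 1 / p l"
  have pos: "AE v in lebesgue. v \<in> E \<longrightarrow> (\<forall>i. 0 < \<omega> i v)"
    using weights_pos_AE[OF K R good] by eventually_elim (use E in auto)
  have E0: "0 < measure lebesgue E" using R(2) E(3) by simp
  define m where "m = ennreal (measure lebesgue E powr \<kappa>)"
  have m: "m \<noteq> 0" "m \<noteq> top" using E0 by (simp_all add: m_def)
  have "m * epowr (dual_mass i R) (?e i) \<le> epowr (target_mass E) (1 / q) * (\<Prod>l\<in>UNIV. epowr (dual_mass l E) (?e l))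
      * epowr (dual_mass i R) (?e i)"
    unfolding m_def by (intro mult_right_mono measure_le_masses E pos) simp
  also have "\<dots> = epowr (target_mass E) (1 / q) * epowr (dual_mass i E) (?e i)
      * (\<Prod>l\<in>UNIV - {i}. epowr (dual_mass l E) (?e l)) * epowr (dual_mass i R) (?e i)"
    by (subst prod.remove[of UNIV i]) (auto simp: mult_ac)
  also have "\<dots> \<le> epowr (target_mass R) (1 / q) * epowr (dual_mass i E) (?e i)
      * (\<Prod>l\<in>UNIV - {i}. epowr (dual_mass l R) (?e l)) * epowr (dual_mass i R) (?e i)"
    using E q_pos dual_exponent(4)
    by (intro mult_mono prod_mono_ennreal epowr_mono mass_mono) (auto intro: less_imp_le)
  also have "\<dots> = (epowr (target_mass R) (1 / q) * (\<Prod>l\<in>UNIV. epowr (dual_mass l R) (?e l))) * epowr (dual_mass i E) (?e i)"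
    using prod.remove[of UNIV i "\<lambda>l. epowr (dual_mass l R) (?e l)"] by (simp add: mult_ac)
  also have "\<dots> \<le> (ennreal K * ennreal (measure lebesgue R powr \<kappa>)) * epowr (dual_mass i E) (?e i)"
    using K unfolding weight_bound_def by (rule mult_right_mono) simp
  also have "\<dots> = m * (ennreal (K * 2 powr \<kappa>) * epowr (dual_mass i E) (?e i))"
    using K1 by (simp add: m_def E(3) powr_mult ennreal_mult mult_ac)
  finally have "epowr (dual_mass i R) (?e i) \<le> ennreal (K * 2 powr \<kappa>) * epowr (dual_mass i E) (?e i)"
    using m by (simp add: ennreal_mult_le_mult_iff)
  then have "epowr (epowr (dual_mass i R) (?e i)) (conj_exp (p i))
     \<le> epowr (ennreal (K * 2 powr \<kappa>) * epowr (dual_mass i E) (?e i)) (conj_exp (p i))"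
    using dual_exponent(3)[of i] by (intro epowr_mono) auto
  then show ?thesis
    using dual_exponent[of i] K1 by (simp add: epowr_mult epowr_epowr epowr_ennreal mult.commute)
qed

lemma doubling_constant_gt_1:
  assumes "1 \<le> K"
  shows "1 < (K * 2 powr \<kappa>) powr conj_exp (p i)"
proof -
  have "1 < 2 powr \<kappa>" using \<kappa>_pos by simp
  then have "1 < K * 2 powr \<kappa>" using assms by (smt (verit) mult_le_cancel_right1)
  then show ?thesis using dual_exponent(3)[of i] by simp
qed

text \<open>
  Reverse doubling: as one half carries a fixed proportion of \<open>\<sigma>\<^sub>i(R)\<close>, the other half carries
  at most the rest.
\<close>

lemma dual_mass_sibling:
  assumes K: "weight_bound K R" and R: "R \<in> lmeasurable" "0 < measure lebesgue R" and good: "target_mass R \<noteq> 0"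
    and E: "E \<in> lmeasurable" "measure lebesgue R = 2 * measure lebesgue E" and K1: "1 \<le> K"
    and split: "E \<subseteq> R" "dual_mass i R = dual_mass i E + dual_mass i E'"
  shows "dual_mass i E' \<le> ennreal (1 - 1 / (K * 2 powr \<kappa>) powr conj_exp (p i)) * dual_mass i R"
proof -
  define M where "M = (K * 2 powr \<kappa>) powr conj_exp (p i)"
  have M: "1 \<le> M" using doubling_constant_gt_1[OF K1] by (simp add: M_def less_imp_le)
  have "dual_mass i R \<noteq> top" using dual_mass_finite[OF K R good] .
  then obtain a b where ab: "dual_mass i E = ennreal a" "0 \<le> a" "dual_mass i E' = ennreal b" "0 \<le> b"
    unfolding split(2) by (cases "dual_mass i E"; cases "dual_mass i E'") auto
  have "ennreal (a + b) \<le> ennreal (M * a)"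
    using dual_mass_doubling[OF K R good E(1) split(1) E(2) K1, of i] ab M
    unfolding split(2) M_def[symmetric] by (simp add: ennreal_mult)
  then have "a + b \<le> M * a" using ab M by (subst (asm) ennreal_le_iff) auto
  then have "b \<le> (1 - 1 / M) * (a + b)" using M by (simp add: field_simps)
  then have "ennreal b \<le> ennreal ((1 - 1 / M) * (a + b))" by (rule ennreal_leI)
  also have "\<dots> = ennreal (1 - 1 / M) * dual_mass i R"
    using ab M unfolding split(2) by (subst ennreal_mult) (auto simp: field_simps)
  finally show ?thesis using ab by (simp add: M_def)
qed

section \<open>Sufficiency of the weight condition\<close>

definition weighted_power :: "'m \<Rightarrow> (real ^ 'n \<Rightarrow> real) \<Rightarrow> ennreal" where
  "weighted_power i f = (\<integral>\<^sup>+v. epowr (ennreal \<bar>f v\<bar>) (p i) * epowr (ennreal (\<omega> i v)) (p i) \<partial>lebesgue)"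

definition norm_coeff :: "'m \<Rightarrow> (real ^ 'n \<Rightarrow> real) \<Rightarrow> (real ^ 'n) set \<Rightarrow> ennreal" where
  "norm_coeff i f R = normalized (p i) (\<integral>\<^sup>+v\<in>R. ennreal \<bar>f v\<bar> \<partial>lebesgue) (dual_mass i R)"

text \<open>
  The embedding for \<open>s = \<sigma>\<^sub>i\<close>, \<open>g = |f|\<close> and \<open>h = |f|\<^bsup>p\<^esup> \<omega>\<^sub>i\<^bsup>p\<^esup>\<close>, over the rectangles with \<open>V(R) \<noteq> 0\<close>.
\<close>

lemma dyadic_embedding_dual:
  assumes K: "\<And>x. weight_bound K (dyadic_block 1 x)" and K1: "1 \<le> K"
  shows "\<exists>C\<ge>0. \<forall>f. locally_integrable f \<longrightarrow>
     (\<integral>\<^sup>+x. (if target_mass (dyadic_block 1 x) \<noteq> 0 then epowr (norm_coeff i f (dyadic_block 1 x)) (p i * (q / P)) else 0) \<partial>count_space UNIV)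
      \<le> ennreal C * epowr (weighted_power i f) (q / P)"
proof -
  define M where "M = (K * 2 powr \<kappa>) powr conj_exp (p i)"
  have M: "1 < M" using doubling_constant_gt_1[OF K1] by (simp add: M_def)
  define \<gamma> where "\<gamma> = 1 - 1 / M"
  have \<gamma>: "0 < \<gamma>" "\<gamma> < 1" using M by (auto simp: \<gamma>_def field_simps)
  let ?good = "\<lambda>x. target_mass (dyadic_block 1 x) \<noteq> 0"
  note B = dyadic_block_lmeasurable[OF zero_less_one] measure_dyadic_block_pos[OF zero_less_one]
  have half: "measure lebesgue (dyadic_block 1 (x(j := (k + 1, c)))) = 2 * measure lebesgue (dyadic_block 1 (x(j := (k, c'))))"
    for x :: "'n \<Rightarrow> int \<times> int" and j k c c'
  proof -
    have "(2::real) powi (k + 1) = 2 * 2 powi k" by (simp add: power_int_add)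
    moreover have "(\<Prod>j'\<in>UNIV - {j}. 2 powi fst ((x(j := (k + 1, c))) j')) = (\<Prod>j'\<in>UNIV - {j}. (2::real) powi fst ((x(j := (k, c'))) j'))"
      by (intro prod.cong) auto
    ultimately show ?thesis
      by (simp add: measure_dyadic_block prod.remove[of UNIV j])
  qed
  have \<rho>: "0 < \<gamma> powr (1 - 1 / p i)" "\<gamma> powr (1 - 1 / p i) < 1"
    using \<gamma> dual_exponent(4)[of i] powr_less_mono2[of "1 - 1 / p i" \<gamma> 1] by auto
  obtain C where C: "tree_bound (p i) (q / P) (\<gamma> powr (1 - 1 / p i)) C"
    using dyadic_tree_summation[OF less_imp_le[OF p_gt_1[of i]] exponent_ratio \<rho>] by blast
  show ?thesis
  proof (intro exI[of _ "C ^ CARD('n)"] conjI allI impI)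
    show "0 \<le> C ^ CARD('n)" using C by (simp add: tree_bound_def)
    fix f :: "real ^ 'n \<Rightarrow> real"
    assume f: "locally_integrable f"
    note [measurable] = locally_integrable_measurable[OF f]
    show "(\<integral>\<^sup>+x. (if ?good x then epowr (norm_coeff i f (dyadic_block 1 x)) (p i * (q / P)) else 0) \<partial>count_space UNIV)
      \<le> ennreal (C ^ CARD('n)) * epowr (weighted_power i f) (q / P)"
      unfolding norm_coeff_def dual_mass_def weighted_power_def
    proof (rule dyadic_embedding[OF p_gt_1 exponent_ratio \<gamma>(1) C])
      fix x :: "'n \<Rightarrow> int \<times> int" and j k c and e :: int assume e: "e \<in> {0, 1}"
      let ?R = "dyadic_block 1 (x(j := (k + 1, c)))"
      let ?E = "dyadic_block 1 (x(j := (k, 2 * c + e)))" and ?E' = "dyadic_block 1 (x(j := (k, 2 * c + (1 - e))))"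
      have sub: "?E \<subseteq> ?R" "?E' \<subseteq> ?R" unfolding dyadic_block_halves(1) using e by auto
      show "?good (x(j := (k, 2 * c + e))) = ?good (x(j := (k + 1, c)))"
        using target_mass_pos_subset[OF K B _ B sub(1)] mass_mono(2)[OF sub(1)] by auto
      assume g: "?good (x(j := (k + 1, c)))"
      have "dual_mass i ?R = dual_mass i ?E' + dual_mass i ?E"
        using e nn_integral_halves[of "dual i" x j k c] unfolding dual_mass_def by (auto simp: add.commute)
      from dual_mass_sibling[OF K B g B(1) half K1 sub(2) this]
      show "(\<integral>\<^sup>+v\<in>?E. dual i v \<partial>lebesgue) \<le> ennreal \<gamma> * (\<integral>\<^sup>+v\<in>?R. dual i v \<partial>lebesgue)"
        by (simp add: \<gamma>_def M_def dual_mass_def)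
    next
      fix x assume g: "?good x"
      show "(\<integral>\<^sup>+v\<in>dyadic_block 1 x. dual i v \<partial>lebesgue) \<noteq> top"
        using dual_mass_finite[OF K B g] by (simp add: dual_mass_def)
      show "(\<integral>\<^sup>+v\<in>dyadic_block 1 x. ennreal \<bar>f v\<bar> \<partial>lebesgue) \<noteq> top"
        by (rule locally_integrable_finite[OF f dyadic_block_rectangles]) simp
      show "AE v in lebesgue. v \<in> dyadic_block 1 x \<longrightarrow> ennreal \<bar>f v\<bar> =
         epowr (epowr (ennreal \<bar>f v\<bar>) (p i) * epowr (ennreal (\<omega> i v)) (p i)) (1 / p i) * epowr (dual i v) (1 - 1 / p i)"
        using weights_pos_AE[OF K B g]
      proof eventually_elim
        case (elim v)
        show ?case
        proof
          assume "v \<in> dyadic_block 1 x"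
          then have w: "0 < \<omega> i v" using elim by blast
          have "epowr (ennreal (\<omega> i v)) 1 * epowr (ennreal (\<omega> i v)) (- 1) = 1"
            using w by (intro epowr_cancel_eq) auto
          then have "ennreal (\<omega> i v) * epowr (dual i v) (1 - 1 / p i) = 1"
            using dual_exponent(2)[of i] by (simp add: dual_def epowr_epowr)
          then show "ennreal \<bar>f v\<bar> =
            epowr (epowr (ennreal \<bar>f v\<bar>) (p i) * epowr (ennreal (\<omega> i v)) (p i)) (1 / p i) * epowr (dual i v) (1 - 1 / p i)"
            using p_gt_1[of i] by (simp add: epowr_mult epowr_epowr mult.assoc)
        qed
      qed
    qed measurable
  qed
qed

text \<open>
  The integral of \<open>|f|\<close> is the only quantity that has to be split: \<open>\<sigma>\<^sub>i\<close> enters with a negative power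
  and is monotone.
\<close>

lemma norm_coeff_double_block:
  assumes f: "locally_integrable f"
  shows "norm_coeff i f (dyadic_block 2 x) \<le> (\<Sum>e\<in>{e. \<forall>j. e j \<in> {0, 1}}. norm_coeff i f (dyadic_block 1 (shift e x)))"
proof -
  let ?E = "{e :: 'n \<Rightarrow> int. \<forall>j. e j \<in> {0, 1}}"
  let ?B = "\<lambda>e. dyadic_block 1 (shift e x) :: (real ^ 'n) set"
  note [measurable] = locally_integrable_measurable[OF f]
  have sub: "?B e \<subseteq> dyadic_block 2 x" if "e \<in> ?E" for e
    unfolding dyadic_block_two using that by blast
  have "(\<integral>\<^sup>+v\<in>dyadic_block 2 x. ennreal \<bar>f v\<bar> \<partial>lebesgue) \<le> (\<integral>\<^sup>+v. (\<Sum>e\<in>?E. ennreal \<bar>f v\<bar> * indicator (?B e) v) \<partial>lebesgue)"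
  proof (intro nn_integral_mono)
    fix v :: "real ^ 'n"
    show "ennreal \<bar>f v\<bar> * indicator (dyadic_block 2 x) v \<le> (\<Sum>e\<in>?E. ennreal \<bar>f v\<bar> * indicator (?B e) v)"
    proof (cases "v \<in> dyadic_block 2 x")
      case True
      then obtain e where e: "e \<in> ?E" "v \<in> ?B e" unfolding dyadic_block_two by blast
      have "ennreal \<bar>f v\<bar> * indicator (?B e) v \<le> (\<Sum>e\<in>?E. ennreal \<bar>f v\<bar> * indicator (?B e) v)"
        using e finite_shifts by (intro member_le_sum) auto
      then show ?thesis using e True by simp
    qed simp
  qed
  also have "\<dots> = (\<Sum>e\<in>?E. \<integral>\<^sup>+v\<in>?B e. ennreal \<bar>f v\<bar> \<partial>lebesgue)"
    by (rule nn_integral_sum) simp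
  finally have "norm_coeff i f (dyadic_block 2 x) \<le> (\<Sum>e\<in>?E. \<integral>\<^sup>+v\<in>?B e. ennreal \<bar>f v\<bar> \<partial>lebesgue) * epowr (dual_mass i (dyadic_block 2 x)) (1 / p i - 1)"
    unfolding norm_coeff_def normalized_def by (rule mult_right_mono) simp
  also have "\<dots> = (\<Sum>e\<in>?E. (\<integral>\<^sup>+v\<in>?B e. ennreal \<bar>f v\<bar> \<partial>lebesgue) * epowr (dual_mass i (dyadic_block 2 x)) (1 / p i - 1))"
    by (rule sum_distrib_right)
  also have "\<dots> \<le> (\<Sum>e\<in>?E. norm_coeff i f (?B e))"
    unfolding norm_coeff_def normalized_def using dual_exponent(4)[of i] sub
    by (intro sum_mono mult_left_mono epowr_antimono mass_mono) auto
  finally show ?thesis .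
qed

text \<open>
  Each dyadic rectangle occurs in at most \<open>2\<^bsup>n\<^esup>\<close> of the sums in \<open>norm_coeff_double_block\<close>.
\<close>

lemma double_embedding_dual:
  assumes K: "\<And>x. weight_bound K (dyadic_block 1 x)" and K1: "1 \<le> K" and K2: "\<And>x. weight_bound K (dyadic_block 2 x)"
  shows "\<exists>C\<ge>0. \<forall>f. locally_integrable f \<longrightarrow>
     (\<integral>\<^sup>+x. (if target_mass (dyadic_block 2 x) \<noteq> 0 then epowr (norm_coeff i f (dyadic_block 2 x)) (p i * (q / P)) else 0) \<partial>count_space UNIV)
      \<le> ennreal C * epowr (weighted_power i f) (q / P)"
proof -
  obtain C where C: "0 \<le> C" and emb: "\<And>f. locally_integrable f \<Longrightarrow>
     (\<integral>\<^sup>+x. (if target_mass (dyadic_block 1 x) \<noteq> 0 then epowr (norm_coeff i f (dyadic_block 1 x)) (p i * (q / P)) else 0) \<partial>count_space UNIV)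
      \<le> ennreal C * epowr (weighted_power i f) (q / P)"
    using dyadic_embedding_dual[OF K K1, of i] by blast
  let ?E = "{e :: 'n \<Rightarrow> int. \<forall>j. e j \<in> {0, 1}}"
  let ?N = "real (card ?E)"
  define s where "s = p i * (q / P)"
  have s: "0 < s" using p_pos[of i] P_pos q_pos by (simp add: s_def)
  show ?thesis
  proof (intro exI[of _ "?N powr s * (?N * C)"] conjI allI impI)
    show "0 \<le> ?N powr s * (?N * C)" using C by simp
    fix f :: "real ^ 'n \<Rightarrow> real"
    assume f: "locally_integrable f"
    define g where "g x = (if target_mass (dyadic_block 1 x) \<noteq> 0 then epowr (norm_coeff i f (dyadic_block 1 x)) s else 0)" for x
    have point: "(if target_mass (dyadic_block 2 x) \<noteq> 0 then epowr (norm_coeff i f (dyadic_block 2 x)) s else 0)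
       \<le> ennreal (?N powr s) * (\<Sum>e\<in>?E. g (shift e x))" for x
    proof (cases "target_mass (dyadic_block 2 x) = 0")
      case False
      have good: "target_mass (dyadic_block 1 (shift e x)) \<noteq> 0" if "e \<in> ?E" for e
      proof (rule target_mass_pos_subset[OF K2 _ _ False])
        show "dyadic_block 1 (shift e x) \<subseteq> dyadic_block 2 x"
          unfolding dyadic_block_two using that by blast
      qed (auto intro: dyadic_block_lmeasurable measure_dyadic_block_pos)
      have "epowr (norm_coeff i f (dyadic_block 2 x)) s \<le> epowr (\<Sum>e\<in>?E. norm_coeff i f (dyadic_block 1 (shift e x))) s"
        using s by (intro epowr_mono norm_coeff_double_block f) auto
      also have "\<dots> \<le> ennreal (?N powr s) * (\<Sum>e\<in>?E. epowr (norm_coeff i f (dyadic_block 1 (shift e x))) s)"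
        by (rule epowr_sum_le[OF finite_shifts s])
      also have "(\<Sum>e\<in>?E. epowr (norm_coeff i f (dyadic_block 1 (shift e x))) s) = (\<Sum>e\<in>?E. g (shift e x))"
        using good by (intro sum.cong) (auto simp: g_def)
      finally show ?thesis using False by simp
    qed simp
    have "(\<integral>\<^sup>+x. (if target_mass (dyadic_block 2 x) \<noteq> 0 then epowr (norm_coeff i f (dyadic_block 2 x)) s else 0) \<partial>count_space UNIV)
      \<le> (\<integral>\<^sup>+x. ennreal (?N powr s) * (\<Sum>e\<in>?E. g (shift e x)) \<partial>count_space UNIV)"
      by (intro nn_integral_mono point)
    also have "\<dots> = ennreal (?N powr s) * (\<Sum>e\<in>?E. \<integral>\<^sup>+x. g (shift e x) \<partial>count_space UNIV)"
      by (simp add: nn_integral_cmult nn_integral_sum)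
    also have "\<dots> = ennreal (?N powr s) * (of_nat (card ?E) * (\<integral>\<^sup>+x. g x \<partial>count_space UNIV))"
      by (simp add: nn_integral_bij_count_space[OF bij_shift])
    also have "\<dots> \<le> ennreal (?N powr s) * (of_nat (card ?E) * (ennreal C * epowr (weighted_power i f) (q / P)))"
      using emb[OF f] unfolding g_def s_def by (intro mult_left_mono) auto
    also have "\<dots> = ennreal (?N powr s * (?N * C)) * epowr (weighted_power i f) (q / P)"
      using C by (simp add: ennreal_mult ennreal_of_nat_eq_real_of_nat mult.assoc)
    finally show "(\<integral>\<^sup>+x. (if target_mass (dyadic_block 2 x) \<noteq> 0 then epowr (norm_coeff i f (dyadic_block 2 x)) (p i * (q / P)) else 0) \<partial>count_space UNIV)
      \<le> ennreal (?N powr s * (?N * C)) * epowr (weighted_power i f) (q / P)"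
      unfolding s_def .
  qed
qed

lemma fractional_product:
  assumes "0 < \<mu>"
  shows "(\<Prod>i\<in>(UNIV :: 'm set). u i / ennreal (\<mu> powr (1 - \<alpha> / (real CARD('m) * real CARD('n)))))
    = (\<Prod>i\<in>UNIV. u i) * ennreal (\<mu> powr (- \<kappa>))"
proof -
  define e where "e = 1 - \<alpha> / (real CARD('m) * real CARD('n))"
  have "u i / ennreal (\<mu> powr e) = u i * ennreal (\<mu> powr (- e))" for i
    using assms by (simp add: divide_ennreal_def inverse_ennreal powr_minus)
  then have "(\<Prod>i\<in>(UNIV :: 'm set). u i / ennreal (\<mu> powr e)) = (\<Prod>i\<in>UNIV. u i) * ennreal (\<mu> powr (- e)) ^ CARD('m)"
    by (simp add: prod.distrib)
  also have "ennreal (\<mu> powr (- e)) ^ CARD('m) = ennreal (\<mu> powr (- e * real CARD('m)))"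
    using assms by (simp add: ennreal_power powr_realpow[symmetric] powr_powr)
  also have "- e * real CARD('m) = - \<kappa>"
    by (simp add: e_def \<kappa>_def field_simps)
  finally show ?thesis by (simp add: e_def)
qed

lemma average_product:
  assumes R: "R \<in> lmeasurable" "0 < measure lebesgue R"
  shows "epowr (average R target) (1 / q) * (\<Prod>i\<in>UNIV. epowr (average R (dual i)) (1 / conj_exp (p i)))
    = (epowr (target_mass R) (1 / q) * (\<Prod>i\<in>UNIV. epowr (dual_mass i R) (1 - 1 / p i)))
      * ennreal (measure lebesgue R powr (- \<kappa>))"
proof -
  define \<mu> where "\<mu> = measure lebesgue R"
  have \<mu>: "0 < \<mu>" "emeasure lebesgue R = ennreal \<mu>"
    using R by (simp_all add: \<mu>_def emeasure_eq_measure2)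
  have avg: "epowr (A / ennreal \<mu>) r = epowr A r * ennreal (\<mu> powr (- r))" if "0 < r" for A r
    using that \<mu>(1) by (simp add: divide_ennreal_def inverse_ennreal epowr_mult epowr_ennreal powr_minus powr_divide inverse_eq_divide)
  have "(\<Prod>i\<in>UNIV. ennreal (\<mu> powr (- (1 - 1 / p i)))) = ennreal (\<mu> powr (\<Sum>i\<in>UNIV. - (1 - 1 / p i)))"
    using \<mu>(1) by (simp add: prod_ennreal powr_sum)
  moreover have "- (1 / q) + (\<Sum>i\<in>UNIV. - (1 - 1 / p i)) = - \<kappa>"
    unfolding \<kappa>_eq sum_negf by simp
  ultimately have "ennreal (\<mu> powr (- (1 / q))) * (\<Prod>i\<in>UNIV. ennreal (\<mu> powr (- (1 - 1 / p i)))) = ennreal (\<mu> powr (- \<kappa>))"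
    by (simp only: ennreal_mult[symmetric] powr_ge_zero powr_add[symmetric])
  moreover have "epowr (average R target) (1 / q) * (\<Prod>i\<in>UNIV. epowr (average R (dual i)) (1 / conj_exp (p i)))
    = epowr (target_mass R) (1 / q) * (\<Prod>i\<in>UNIV. epowr (dual_mass i R) (1 - 1 / p i))
      * (ennreal (\<mu> powr (- (1 / q))) * (\<Prod>i\<in>UNIV. ennreal (\<mu> powr (- (1 - 1 / p i)))))"
    unfolding average_def \<mu>(2) dual_exponent(1) target_mass_def[symmetric] dual_mass_def[symmetric]
    using q_pos dual_exponent(4) by (simp only: avg zero_less_divide_1_iff prod.distrib mult_ac)
  ultimately show ?thesis by (simp add: \<mu>_def)
qed

lemma weight_bound_iff:
  assumes R: "R \<in> lmeasurable" "0 < measure lebesgue R"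
  shows "weight_bound K R \<longleftrightarrow>
    epowr (average R target) (1 / q) * (\<Prod>i\<in>UNIV. epowr (average R (dual i)) (1 / conj_exp (p i))) \<le> ennreal K"
proof -
  define \<mu> where "\<mu> = measure lebesgue R"
  define X where "X = epowr (target_mass R) (1 / q) * (\<Prod>i\<in>UNIV. epowr (dual_mass i R) (1 - 1 / p i))"
  have one: "ennreal (\<mu> powr \<kappa>) * ennreal (\<mu> powr (- \<kappa>)) = 1"
    using R by (simp add: \<mu>_def ennreal_mult[symmetric] powr_add[symmetric])
  have "X \<le> ennreal K * ennreal (\<mu> powr \<kappa>) \<longleftrightarrow> X * ennreal (\<mu> powr (- \<kappa>)) \<le> ennreal K"
  proof
    assume "X \<le> ennreal K * ennreal (\<mu> powr \<kappa>)"
    from mult_right_mono[OF this, of "ennreal (\<mu> powr (- \<kappa>))"] show "X * ennreal (\<mu> powr (- \<kappa>)) \<le> ennreal K"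
      by (simp add: mult.assoc one)
  next
    assume "X * ennreal (\<mu> powr (- \<kappa>)) \<le> ennreal K"
    from mult_right_mono[OF this, of "ennreal (\<mu> powr \<kappa>)"] show "X \<le> ennreal K * ennreal (\<mu> powr \<kappa>)"
      using one by (simp add: mult.assoc mult.commute[of "ennreal (\<mu> powr (- \<kappa>))"])
  qed
  then show ?thesis
    by (simp add: weight_bound_def average_product[OF R] X_def \<mu>_def)
qed

lemma A_class_iff:
  assumes \<B>: "\<B> \<subseteq> rectangles"
  shows "\<omega> \<in> A_class \<B> p q \<longleftrightarrow> (\<exists>K\<ge>1. \<forall>R\<in>\<B>. weight_bound K R)"
proof -
  define T where "T R = epowr (average R target) (1 / q) * (\<Prod>i\<in>UNIV. epowr (average R (dual i)) (1 / conj_exp (p i)))" for R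
  have A: "\<omega> \<in> A_class \<B> p q \<longleftrightarrow> (SUP R\<in>\<B>. T R) < top"
    using weight by (simp add: A_class_def T_def target_def[abs_def] dual_def[abs_def])
  have wb: "weight_bound K R \<longleftrightarrow> T R \<le> ennreal K" if "R \<in> \<B>" for R K
    unfolding T_def using that \<B> by (intro weight_bound_iff rectangles_lmeasurable rectangles_measure_pos) auto
  show ?thesis
    unfolding A
  proof
    assume fin: "(SUP R\<in>\<B>. T R) < top"
    then obtain k where k: "(SUP R\<in>\<B>. T R) = ennreal k" "0 \<le> k" by (cases "SUP R\<in>\<B>. T R") auto
    have "weight_bound (max 1 k) R" if "R \<in> \<B>" for R
    proof -
      have "T R \<le> ennreal k" unfolding k(1)[symmetric] using that by (rule SUP_upper)
      also have "\<dots> \<le> ennreal (max 1 k)" by (rule ennreal_leI) simp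
      finally show ?thesis using wb[OF that] by simp
    qed
    then show "\<exists>K\<ge>1. \<forall>R\<in>\<B>. weight_bound K R" by (intro exI[of _ "max 1 k"]) auto
  next
    assume "\<exists>K\<ge>1. \<forall>R\<in>\<B>. weight_bound K R"
    then obtain K where K: "\<And>R. R \<in> \<B> \<Longrightarrow> weight_bound K R" by blast
    have "(SUP R\<in>\<B>. T R) \<le> ennreal K" using K wb by (intro SUP_least) auto
    then show "(SUP R\<in>\<B>. T R) < top" by (rule le_less_trans) simp
  qed
qed

lemma Lnorm_eq: "Lnorm (p i) (\<lambda>x. epowr (ennreal (\<omega> i x)) (p i)) (\<lambda>x. ennreal \<bar>f x\<bar>) = epowr (weighted_power i f) (1 / p i)"
  by (simp add: Lnorm_def weighted_power_def)

text \<open>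
  The argument common to both families of rectangles. The blocks form a countable family that covers
  \<open>\<B>\<close> efficiently, so the \<open>q\<close>-th power of the supremum is at most a constant times the sum over
  the blocks. After integration the weight condition turns each summand into a product of the \<open>norm_coeff\<close>,
  and Hoelder's inequality for sums separates the functions \<open>f\<^sub>i\<close>.
\<close>

lemma strong_bound_from_blocks:
  assumes \<B>: "\<B> \<subseteq> rectangles" and r: "0 < r" and c: "0 < c"
    and cover: "\<And>R. R \<in> \<B> \<Longrightarrow> \<exists>y. R \<subseteq> dyadic_block r y \<and> measure lebesgue (dyadic_block r y) \<le> c * measure lebesgue R"
    and K: "\<And>y. weight_bound K (dyadic_block r y)" "0 \<le> K"
    and emb: "\<And>i. \<exists>C\<ge>0. \<forall>f. locally_integrable f \<longrightarrow>
     (\<integral>\<^sup>+x. (if target_mass (dyadic_block r x) \<noteq> 0 then epowr (norm_coeff i f (dyadic_block r x)) (p i * (q / P)) else 0) \<partial>count_space UNIV)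
      \<le> ennreal C * epowr (weighted_power i f) (q / P)"
  shows "strong_type_bound \<B> \<alpha> p q \<omega>"
proof -
  have "\<exists>C. \<forall>i. 0 \<le> C i \<and> (\<forall>f. locally_integrable f \<longrightarrow>
     (\<integral>\<^sup>+x. (if target_mass (dyadic_block r x) \<noteq> 0 then epowr (norm_coeff i f (dyadic_block r x)) (p i * (q / P)) else 0) \<partial>count_space UNIV)
      \<le> ennreal (C i) * epowr (weighted_power i f) (q / P))"
    by (rule choice, rule allI, rule emb)
  then obtain C where C: "\<And>i. 0 \<le> C i" and emb: "\<And>i f. locally_integrable f \<Longrightarrow>
     (\<integral>\<^sup>+x. (if target_mass (dyadic_block r x) \<noteq> 0 then epowr (norm_coeff i f (dyadic_block r x)) (p i * (q / P)) else 0) \<partial>count_space UNIV)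
      \<le> ennreal (C i) * epowr (weighted_power i f) (q / P)"
    by blast
  note [measurable] = dyadic_block_sets[OF r]
  let ?B = "dyadic_block r :: ('n \<Rightarrow> int \<times> int) \<Rightarrow> _"
  define C' where "C' = c powr \<kappa> * K * (\<Prod>i\<in>UNIV. C i powr (P / p i / q))"
  show ?thesis
    unfolding strong_type_bound_def
  proof (intro exI[of _ C'] allI impI)
    fix f :: "'m \<Rightarrow> real ^ 'n \<Rightarrow> real"
    assume f: "\<forall>i. locally_integrable (f i)"
    define u where "u i R = (\<integral>\<^sup>+y\<in>R. ennreal \<bar>f i y\<bar> \<partial>lebesgue)" for i R
    define a where "a y = (\<Prod>i\<in>UNIV. u i (?B y)) * ennreal (measure lebesgue (?B y) powr (- \<kappa>))" for y
    define S where "S x = (\<integral>\<^sup>+y. epowr (a y) q * indicator (?B y) x \<partial>count_space UNIV)" for x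
    have maximal: "epowr (frac_maximal \<B> \<alpha> f x) q \<le> ennreal (c powr (\<kappa> * q)) * S x" for x
    proof -
      have "(\<Prod>i\<in>UNIV. u i R / ennreal (measure lebesgue R powr (1 - \<alpha> / (real CARD('m) * real CARD('n)))))
         \<le> epowr (ennreal (c powr (\<kappa> * q)) * S x) (1 / q)" if R: "R \<in> \<B>" "x \<in> R" for R
      proof -
        obtain y where y: "R \<subseteq> ?B y" "measure lebesgue (?B y) \<le> c * measure lebesgue R"
          using cover[OF R(1)] by blast
        have \<mu>: "0 < measure lebesgue R" "0 < measure lebesgue (?B y)"
          using R(1) \<B> r by (auto intro: rectangles_measure_pos measure_dyadic_block_pos)
        have "measure lebesgue R powr (- \<kappa>) \<le> (measure lebesgue (?B y) / c) powr (- \<kappa>)"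
          using \<mu> y(2) c \<kappa>_pos by (intro powr_mono2') (auto simp: field_simps)
        also have "\<dots> = c powr \<kappa> * measure lebesgue (?B y) powr (- \<kappa>)"
          using \<mu> c by (simp add: powr_divide powr_minus field_simps)
        finally have pw: "measure lebesgue R powr (- \<kappa>) \<le> c powr \<kappa> * measure lebesgue (?B y) powr (- \<kappa>)" .
        have "(\<Prod>i\<in>UNIV. u i R) \<le> (\<Prod>i\<in>UNIV. u i (?B y))"
          using y(1) unfolding u_def
          by (intro prod_mono_ennreal nn_integral_mono mult_left_mono) (auto simp: indicator_def)
        then have "(\<Prod>i\<in>UNIV. u i R) * ennreal (measure lebesgue R powr (- \<kappa>))
          \<le> (\<Prod>i\<in>UNIV. u i (?B y)) * ennreal (c powr \<kappa> * measure lebesgue (?B y) powr (- \<kappa>))"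
          using pw by (intro mult_mono ennreal_leI) auto
        also have "\<dots> = ennreal (c powr \<kappa>) * a y"
          by (simp add: a_def ennreal_mult mult_ac)
        finally have le: "(\<Prod>i\<in>UNIV. u i R) * ennreal (measure lebesgue R powr (- \<kappa>)) \<le> ennreal (c powr \<kappa>) * a y" .
        have "epowr (a y) q \<le> S x"
          using nn_integral_ge_point[of y UNIV "\<lambda>y. epowr (a y) q * indicator (?B y) x"] R(2) y(1)
          by (auto simp: S_def indicator_def split: if_splits)
        then have "epowr (ennreal (c powr \<kappa>) * a y) q \<le> ennreal (c powr (\<kappa> * q)) * S x"
          using q_pos by (simp add: epowr_mult epowr_ennreal powr_powr mult_left_mono)
        then have "ennreal (c powr \<kappa>) * a y \<le> epowr (ennreal (c powr (\<kappa> * q)) * S x) (1 / q)"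
          using q_pos by (simp add: epowr_le_iff)
        then show ?thesis
          unfolding fractional_product[OF \<mu>(1)] using le by simp
      qed
      then have "frac_maximal \<B> \<alpha> f x \<le> epowr (ennreal (c powr (\<kappa> * q)) * S x) (1 / q)"
        unfolding frac_maximal_def u_def by (intro SUP_least) auto
      then show ?thesis using q_pos by (simp add: epowr_le_iff)
    qed
    define g where "g i y = (if target_mass (?B y) \<noteq> 0 then epowr (norm_coeff i (f i) (?B y)) (p i * (q / P)) else 0)" for i y
    have term_bound: "epowr (a y) q * target_mass (?B y) \<le> ennreal (K powr q) * (\<Prod>i\<in>UNIV. epowr (g i y) (P / p i))" for y
    proof (cases "target_mass (?B y) = 0")
      case False
      note B = dyadic_block_lmeasurable[OF r, of y] measure_dyadic_block_pos[OF r, of y]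
      define \<mu> where "\<mu> = measure lebesgue (?B y)"
      have u: "u i (?B y) = norm_coeff i (f i) (?B y) * epowr (dual_mass i (?B y)) (1 - 1 / p i)" for i
        using normalized_inverse[OF p_gt_1[of i] dual_mass_finite[OF K(1) B False, of i], of "u i (?B y)"] dual_mass_pos[OF B, of i]
        by (simp add: norm_coeff_def u_def)
      have "a y * epowr (target_mass (?B y)) (1 / q) = (\<Prod>i\<in>UNIV. norm_coeff i (f i) (?B y)) * ennreal (\<mu> powr (- \<kappa>))
         * (epowr (target_mass (?B y)) (1 / q) * (\<Prod>i\<in>UNIV. epowr (dual_mass i (?B y)) (1 - 1 / p i)))"
        by (simp add: a_def u prod.distrib \<mu>_def mult_ac)
      also have "\<dots> \<le> (\<Prod>i\<in>UNIV. norm_coeff i (f i) (?B y)) * ennreal (\<mu> powr (- \<kappa>)) * (ennreal K * ennreal (\<mu> powr \<kappa>))"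
        using K(1)[of y] unfolding weight_bound_def \<mu>_def by (rule mult_left_mono) simp
      also have "\<dots> = ennreal K * (\<Prod>i\<in>UNIV. norm_coeff i (f i) (?B y)) * (ennreal (\<mu> powr (- \<kappa>)) * ennreal (\<mu> powr \<kappa>))"
        by (simp add: mult_ac)
      also have "ennreal (\<mu> powr (- \<kappa>)) * ennreal (\<mu> powr \<kappa>) = 1"
        using B by (simp add: \<mu>_def ennreal_mult[symmetric] powr_add[symmetric])
      finally have "epowr (a y * epowr (target_mass (?B y)) (1 / q)) q \<le> epowr (ennreal K * (\<Prod>i\<in>UNIV. norm_coeff i (f i) (?B y))) q"
        using q_pos by (intro epowr_mono) auto
      moreover have "epowr (g i y) (P / p i) = epowr (norm_coeff i (f i) (?B y)) q" for i
        using False P_pos p_pos[of i] by (simp add: g_def epowr_epowr)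
      ultimately show ?thesis
        using q_pos K(2) by (simp add: epowr_mult epowr_epowr epowr_prod epowr_ennreal)
    qed simp
    have lambda: "(\<Sum>i\<in>UNIV. P / p i) = 1"
    proof -
      have "(\<Sum>i\<in>UNIV. P / p i) = P * (\<Sum>i\<in>UNIV. 1 / p i)" by (simp add: sum_distrib_left)
      then show ?thesis using P_pos by (simp add: P_eq[symmetric])
    qed
    have "(\<integral>\<^sup>+x. epowr (frac_maximal \<B> \<alpha> f x) q * target x \<partial>lebesgue)
      \<le> (\<integral>\<^sup>+x. ennreal (c powr (\<kappa> * q)) * (S x * target x) \<partial>lebesgue)"
      using maximal by (intro nn_integral_mono) (simp add: mult.assoc[symmetric] mult_right_mono)
    also have "\<dots> = (\<integral>\<^sup>+x. (\<integral>\<^sup>+y. ennreal (c powr (\<kappa> * q)) * (epowr (a y) q * (target x * indicator (?B y) x)) \<partial>count_space UNIV) \<partial>lebesgue)"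
    proof (intro nn_integral_cong)
      fix x
      have "S x * target x = (\<integral>\<^sup>+y. epowr (a y) q * indicator (?B y) x * target x \<partial>count_space UNIV)"
        unfolding S_def by (rule nn_integral_multc[symmetric]) simp
      also have "\<dots> = (\<integral>\<^sup>+y. epowr (a y) q * (target x * indicator (?B y) x) \<partial>count_space UNIV)"
        by (simp only: mult_ac)
      finally show "ennreal (c powr (\<kappa> * q)) * (S x * target x) =
         (\<integral>\<^sup>+y. ennreal (c powr (\<kappa> * q)) * (epowr (a y) q * (target x * indicator (?B y) x)) \<partial>count_space UNIV)"
        by (subst nn_integral_cmult) simp_all
    qed
    also have "\<dots> = (\<integral>\<^sup>+y. (\<integral>\<^sup>+x. ennreal (c powr (\<kappa> * q)) * (epowr (a y) q * (target x * indicator (?B y) x)) \<partial>lebesgue) \<partial>count_space UNIV)"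
      by (rule nn_integral_count_space_nn_integral) simp_all
    also have "\<dots> = (\<integral>\<^sup>+y. ennreal (c powr (\<kappa> * q)) * (epowr (a y) q * target_mass (?B y)) \<partial>count_space UNIV)"
      by (simp add: nn_integral_cmult target_mass_def)
    also have "\<dots> = ennreal (c powr (\<kappa> * q)) * (\<integral>\<^sup>+y. epowr (a y) q * target_mass (?B y) \<partial>count_space UNIV)"
      by (rule nn_integral_cmult) simp
    also have "(\<integral>\<^sup>+y. epowr (a y) q * target_mass (?B y) \<partial>count_space UNIV) \<le> (\<integral>\<^sup>+y. ennreal (K powr q) * (\<Prod>i\<in>UNIV. epowr (g i y) (P / p i)) \<partial>count_space UNIV)"
      by (intro nn_integral_mono term_bound)
    also have "\<dots> = ennreal (K powr q) * (\<integral>\<^sup>+y. (\<Prod>i\<in>UNIV. epowr (g i y) (P / p i)) \<partial>count_space UNIV)"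
      by (rule nn_integral_cmult) simp
    also have "\<dots> \<le> ennreal (K powr q) * (\<Prod>i\<in>UNIV. epowr (\<integral>\<^sup>+y. g i y \<partial>count_space UNIV) (P / p i))"
      using P_pos p_pos lambda by (intro mult_left_mono Holder_nn_integral_prod) auto
    also have "\<dots> \<le> ennreal (K powr q) * (\<Prod>i\<in>UNIV. epowr (ennreal (C i) * epowr (weighted_power i (f i)) (q / P)) (P / p i))"
    proof (intro mult_left_mono prod_mono_ennreal epowr_mono)
      show "(\<integral>\<^sup>+y. g i y \<partial>count_space UNIV) \<le> ennreal (C i) * epowr (weighted_power i (f i)) (q / P)" for i
        unfolding g_def using f by (intro emb) simp
      show "0 \<le> P / p i" for i using P_pos p_pos[of i] by simp
    qed auto
    finally have "(\<integral>\<^sup>+x. epowr (frac_maximal \<B> \<alpha> f x) q * target x \<partial>lebesgue)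
      \<le> ennreal (c powr (\<kappa> * q)) * (ennreal (K powr q) * (\<Prod>i\<in>UNIV. epowr (ennreal (C i) * epowr (weighted_power i (f i)) (q / P)) (P / p i)))"
      by (simp add: mult_left_mono)
    then have "Lnorm q target (frac_maximal \<B> \<alpha> f)
      \<le> epowr (ennreal (c powr (\<kappa> * q)) * (ennreal (K powr q) * (\<Prod>i\<in>UNIV. epowr (ennreal (C i) * epowr (weighted_power i (f i)) (q / P)) (P / p i)))) (1 / q)"
      unfolding Lnorm_def using q_pos by (intro epowr_mono) auto
    also have "\<dots> = ennreal (c powr \<kappa>) * (ennreal K * (\<Prod>i\<in>UNIV. ennreal (C i powr (P / p i / q)) * epowr (weighted_power i (f i)) (1 / p i)))"
    proof -
      have "epowr (epowr (ennreal (C i) * epowr (weighted_power i (f i)) (q / P)) (P / p i)) (1 / q)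
         = ennreal (C i powr (P / p i / q)) * epowr (weighted_power i (f i)) (1 / p i)" for i
        using P_pos p_pos[of i] q_pos C[of i] by (simp add: epowr_mult epowr_epowr epowr_ennreal powr_powr)
      then show ?thesis
        using q_pos c K(2) by (simp add: epowr_mult epowr_prod epowr_ennreal powr_powr)
    qed
    also have "\<dots> = ennreal C' * (\<Prod>i\<in>UNIV. epowr (weighted_power i (f i)) (1 / p i))"
      using K(2) by (simp add: C'_def prod.distrib prod_ennreal ennreal_mult prod_nonneg mult.assoc)
    finally show "Lnorm q (\<lambda>x. epowr (ennreal (weight_prod \<omega> x)) q) (frac_maximal \<B> \<alpha> f)
      \<le> ennreal C' * (\<Prod>i\<in>UNIV. Lnorm (p i) (\<lambda>x. epowr (ennreal (\<omega> i x)) (p i)) (\<lambda>x. ennreal \<bar>f i x\<bar>))"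
      by (simp add: Lnorm_eq target_def[abs_def])
  qed
qed

lemma A_dyadic_imp_strong:
  assumes "\<omega> \<in> A_class dyadic_rectangles p q"
  shows "strong_type_bound dyadic_rectangles \<alpha> p q \<omega>"
proof -
  have sub: "dyadic_rectangles \<subseteq> (rectangles :: (real ^ 'n) set set)"
    by (auto simp: dyadic_rectangles_eq dyadic_block_rectangles)
  obtain K where K: "1 \<le> K" "\<And>x. weight_bound K (dyadic_block 1 x)"
    using assms A_class_iff[OF sub] by (auto simp: dyadic_rectangles_eq)
  show ?thesis
  proof (rule strong_bound_from_blocks[OF sub, of 1 1 K])
    show "\<exists>y. R \<subseteq> dyadic_block 1 y \<and> measure lebesgue (dyadic_block 1 y) \<le> 1 * measure lebesgue R"
      if "R \<in> dyadic_rectangles" for R :: "(real ^ 'n) set"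
      using that by (auto simp: dyadic_rectangles_eq)
    show "weight_bound K (dyadic_block 1 y)" for y by (rule K)
  qed (use K(1) in \<open>simp_all add: dyadic_embedding_dual[OF K(2,1)]\<close>)
qed

lemma A_rectangles_imp_strong:
  assumes "\<omega> \<in> A_class rectangles p q"
  shows "strong_type_bound rectangles \<alpha> p q \<omega>"
proof -
  obtain K where K: "1 \<le> K" "\<And>R. R \<in> rectangles \<Longrightarrow> weight_bound K R"
    using assms A_class_iff[OF order_refl] by blast
  have K12: "weight_bound K (dyadic_block 1 x)" "weight_bound K (dyadic_block 2 x)" for x
    by (simp_all add: K(2) dyadic_block_rectangles)
  show ?thesis
  proof (rule strong_bound_from_blocks[of _ 2 "4 ^ CARD('n)" K])
    show "\<exists>y. R \<subseteq> dyadic_block 2 y \<and> measure lebesgue (dyadic_block 2 y) \<le> 4 ^ CARD('n) * measure lebesgue R"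
      if "R \<in> rectangles" for R :: "(real ^ 'n) set"
      by (rule rectangle_subset_block[OF that]) blast
    show "weight_bound K (dyadic_block 2 y)" for y by (rule K12)
  qed (use K(1) in \<open>simp_all add: double_embedding_dual[OF K12(1) K(1) K12(2)]\<close>)
qed

end

section \<open>Necessity of the weight condition\<close>

text \<open>
  Only this half of homogeneity is available for functions that may fail to be measurable, such as
  the indicators of the superlevel sets in Chebyshev's inequality.
\<close>

lemma nn_integral_cmult_le:
  fixes h :: "'a \<Rightarrow> ennreal"
  assumes "c < top"
  shows "c * (\<integral>\<^sup>+x. h x \<partial>M) \<le> (\<integral>\<^sup>+x. c * h x \<partial>M)"
proof -
  have "c * integral\<^sup>S M g \<le> (\<integral>\<^sup>+x. c * h x \<partial>M)" if "simple_function M g" "g \<le> h" for g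
  proof -
    have "c * integral\<^sup>S M g = (\<integral>\<^sup>Sx. c * g x \<partial>M)"
      using that(1) by (rule simple_integral_mult[symmetric])
    also have "\<dots> = (\<integral>\<^sup>+x. c * g x \<partial>M)"
      using that(1) by (intro nn_integral_eq_simple_integral[symmetric]) auto
    also have "\<dots> \<le> (\<integral>\<^sup>+x. c * h x \<partial>M)"
      using that(2) by (intro nn_integral_mono mult_left_mono) (auto simp: le_fun_def)
    finally show ?thesis .
  qed
  then show ?thesis
    unfolding nn_integral_def[of M h] by (auto simp: SUP_mult_left_ennreal intro!: SUP_least)
qed

text \<open>
  Chebyshev's inequality.
\<close>

lemma weak_Lnorm_le_Lnorm:
  assumes q: "0 < q"
  shows "weak_Lnorm q \<mu> g \<le> Lnorm q \<mu> g"
  unfolding weak_Lnorm_def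
proof (rule SUP_least)
  fix t :: real assume "t \<in> {0<..}"
  then have t: "0 < t" by simp
  let ?I = "\<integral>\<^sup>+x\<in>{x. g x > ennreal t}. \<mu> x \<partial>lebesgue"
  have "epowr (ennreal t) q * ?I \<le> (\<integral>\<^sup>+x. epowr (ennreal t) q * (\<mu> x * indicator {x. g x > ennreal t} x) \<partial>lebesgue)"
    using q t by (intro nn_integral_cmult_le) (simp add: epowr_ennreal)
  also have "\<dots> \<le> (\<integral>\<^sup>+x. epowr (g x) q * \<mu> x \<partial>lebesgue)"
  proof (intro nn_integral_mono)
    fix x
    show "epowr (ennreal t) q * (\<mu> x * indicator {x. g x > ennreal t} x) \<le> epowr (g x) q * \<mu> x"
      using q by (cases "g x > ennreal t") (simp_all add: mult_right_mono epowr_mono less_imp_le)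
  qed
  finally have "epowr (epowr (ennreal t) q * ?I) (1 / q) \<le> Lnorm q \<mu> g"
    unfolding Lnorm_def using q by (intro epowr_mono) auto
  then show "ennreal t * epowr ?I (1 / q) \<le> Lnorm q \<mu> g"
    using q by (simp add: epowr_mult epowr_epowr)
qed

lemma strong_type_imp_weak_type:
  "0 < q \<Longrightarrow> strong_type_bound \<B> \<alpha> p q \<omega> \<Longrightarrow> weak_type_bound \<B> \<alpha> p q \<omega>"
  unfolding strong_type_bound_def weak_type_bound_def
  by (meson weak_Lnorm_le_Lnorm order_trans)

lemma SUP_mult_incseq:
  fixes x y :: "nat \<Rightarrow> ennreal"
  assumes "incseq x" "incseq y"
  shows "(SUP N. x N) * (SUP N. y N) = (SUP N. x N * y N)"
proof (rule antisym)
  show "(SUP N. x N) * (SUP N. y N) \<le> (SUP N. x N * y N)"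
    unfolding SUP_mult_right_ennreal SUP_mult_left_ennreal
  proof (intro SUP_least)
    fix N M
    have "x N * y M \<le> x (max N M) * y (max N M)"
      using assms by (intro mult_mono) (auto simp: incseq_def)
    also have "\<dots> \<le> (SUP N. x N * y N)" by (rule SUP_upper) simp
    finally show "x N * y M \<le> (SUP N. x N * y N)" .
  qed
  show "(SUP N. x N * y N) \<le> (SUP N. x N) * (SUP N. y N)"
    by (intro SUP_least mult_mono SUP_upper) auto
qed

lemma SUP_prod_incseq:
  fixes x :: "'i \<Rightarrow> nat \<Rightarrow> ennreal"
  assumes "finite I" "\<And>i. i \<in> I \<Longrightarrow> incseq (x i)"
  shows "(\<Prod>i\<in>I. SUP N. x i N) = (SUP N. \<Prod>i\<in>I. x i N)"
  using assms
proof (induction I rule: finite_induct)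
  case (insert i I)
  have "incseq (\<lambda>N. \<Prod>i\<in>I. x i N)"
    using insert.prems by (auto simp: incseq_def intro!: prod_mono_ennreal)
  then show ?case
    using insert by (simp add: SUP_mult_incseq)
qed simp

lemma epowr_SUP_le:
  assumes "0 < r"
  shows "epowr (SUP i\<in>I. f i) r \<le> (SUP i\<in>I. epowr (f i) r)"
proof -
  have "f i \<le> epowr (SUP i\<in>I. epowr (f i) r) (1 / r)" if "i \<in> I" for i
    using that assms by (subst epowr_le_iff[symmetric]) (auto intro: SUP_upper)
  then have "(SUP i\<in>I. f i) \<le> epowr (SUP i\<in>I. epowr (f i) r) (1 / r)"
    by (rule SUP_least)
  then show ?thesis using assms by (simp add: epowr_le_iff)
qed

context fractional_weights
begin

text \<open>
  A bounded approximation of \<open>\<sigma>\<^sub>i\<close> from below; bounding \<open>\<omega>\<^sub>i\<close> away from zero covers the points with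
  \<open>\<omega>\<^sub>i = 0\<close>, where \<open>\<sigma>\<^sub>i = \<infinity>\<close>.
\<close>

definition truncated_dual :: "nat \<Rightarrow> 'm \<Rightarrow> real ^ 'n \<Rightarrow> real" where
  "truncated_dual N i v = max (\<omega> i v) (1 / real (Suc N)) powr (- conj_exp (p i))"

lemma truncated_dual_measurable [measurable]: "truncated_dual N i \<in> borel_measurable lebesgue"
  unfolding truncated_dual_def[abs_def] by measurable

lemma truncated_dual_pos: "0 < truncated_dual N i v"
proof -
  have "0 < max (\<omega> i v) (1 / real (Suc N))" by (simp add: less_max_iff_disj)
  then show ?thesis unfolding truncated_dual_def powr_gt_zero by linarith
qed

lemma truncated_dual_le: "truncated_dual N i v \<le> (1 / real (Suc N)) powr (- conj_exp (p i))"
  unfolding truncated_dual_def using dual_exponent(3)[of i] by (intro powr_mono2') auto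

lemma truncated_dual_mono: "N \<le> M \<Longrightarrow> truncated_dual N i v \<le> truncated_dual M i v"
  unfolding truncated_dual_def using dual_exponent(3)[of i]
  by (intro powr_mono2' max.mono) (auto simp: less_max_iff_disj frac_le)

lemma SUP_truncated_dual: "(SUP N. ennreal (truncated_dual N i v)) = dual i v"
proof (cases "\<omega> i v = 0")
  case True
  have "(SUP N. ennreal (truncated_dual N i v)) = top"
  proof (rule ennreal_SUP_eq_top)
    fix n :: nat
    obtain N :: nat where N: "real n powr (1 / conj_exp (p i)) \<le> real N"
      using real_arch_simple by blast
    have "real n \<le> real (Suc N) powr conj_exp (p i)"
    proof -
      have "real n = (real n powr (1 / conj_exp (p i))) powr conj_exp (p i)"
        using dual_exponent(3)[of i] by (simp add: powr_powr)
      also have "\<dots> \<le> real (Suc N) powr conj_exp (p i)"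
        using dual_exponent(3)[of i] N by (intro powr_mono2) auto
      finally show ?thesis .
    qed
    also have "\<dots> = truncated_dual N i v"
      by (simp add: truncated_dual_def True powr_minus powr_divide)
    finally show "\<exists>N\<in>UNIV. of_nat n \<le> ennreal (truncated_dual N i v)"
      by (intro bexI[of _ N]) (auto simp: ennreal_of_nat_eq_real_of_nat intro: ennreal_leI)
  qed
  then show ?thesis
    using True dual_exponent(3)[of i] by (simp add: dual_def epowr_def)
next
  case False
  then have w: "0 < \<omega> i v" using \<omega>_nonneg[of i v] by simp
  have d: "dual i v = ennreal (\<omega> i v powr (- conj_exp (p i)))"
    using w by (simp add: dual_def epowr_ennreal_pos)
  obtain N where N: "1 / real (Suc N) < \<omega> i v"
    using reals_Archimedean[OF w] by (auto simp: inverse_eq_divide)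
  show ?thesis
  proof (rule antisym)
    show "(SUP N. ennreal (truncated_dual N i v)) \<le> dual i v"
      unfolding d truncated_dual_def using w dual_exponent(3)[of i]
      by (intro SUP_least ennreal_leI powr_mono2') auto
    have "dual i v = ennreal (truncated_dual N i v)"
      using N by (simp add: d truncated_dual_def max_def)
    then show "dual i v \<le> (SUP N. ennreal (truncated_dual N i v))"
      by (metis SUP_upper UNIV_I)
  qed
qed

text \<open>
  For \<open>\<sigma>\<^sub>i\<close> itself this is the equality \<open>\<sigma>\<^sub>i\<^bsup>p\<^sub>i\<^esup> \<omega>\<^sub>i\<^bsup>p\<^sub>i\<^esup> = \<sigma>\<^sub>i\<close>, which follows from \<open>p\<^sub>i p\<^sub>i' - p\<^sub>i = p\<^sub>i'\<close>.
\<close>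

lemma truncated_dual_test:
  "truncated_dual N i v powr p i * \<omega> i v powr p i \<le> truncated_dual N i v"
proof -
  define t where "t = max (\<omega> i v) (1 / real (Suc N))"
  have t: "0 < t" "\<omega> i v \<le> t" by (auto simp: t_def less_max_iff_disj)
  have e: "- conj_exp (p i) * p i + p i = - conj_exp (p i)"
    using p_gt_1[of i] by (simp add: conj_exp_def field_simps)
  have "truncated_dual N i v powr p i * \<omega> i v powr p i \<le> truncated_dual N i v powr p i * t powr p i"
    using t \<omega>_nonneg p_pos[of i] by (intro mult_left_mono powr_mono2) auto
  also have "\<dots> = t powr (- conj_exp (p i) * p i + p i)"
    by (simp only: truncated_dual_def t_def[symmetric] powr_powr powr_add)
  finally show ?thesis unfolding e by (simp only: truncated_dual_def t_def[symmetric])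
qed

text \<open>
  The weak type inequality at the truncated dual weights on \<open>R\<close>. As the truncations have finite and
  positive integrals, their powers can be cancelled; the bound does not depend on the truncation.
\<close>

lemma truncated_weight_bound:
  assumes R: "R \<in> \<B>" "R \<in> rectangles"
    and C: "\<And>f. (\<And>i. locally_integrable (f i)) \<Longrightarrow>
        weak_Lnorm q target (frac_maximal \<B> \<alpha> f) \<le> ennreal C * (\<Prod>i\<in>UNIV. epowr (weighted_power i (f i)) (1 / p i))"
  shows "epowr (target_mass R) (1 / q) * (\<Prod>i\<in>UNIV. epowr (\<integral>\<^sup>+v\<in>R. ennreal (truncated_dual N i v) \<partial>lebesgue) (1 - 1 / p i))
     \<le> ennreal (2 * max 0 C) * ennreal (measure lebesgue R powr \<kappa>)"
proof -
  have RL: "R \<in> lmeasurable" and \<mu>: "0 < measure lebesgue R"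
    using R(2) by (auto intro: rectangles_lmeasurable rectangles_measure_pos)
  have [measurable]: "R \<in> sets lebesgue" using RL by blast
  define \<mu> where "\<mu> = measure lebesgue R"
  note \<mu> = \<mu>[folded \<mu>_def]
  define f where "f i v = indicator R v * truncated_dual N i v" for i v
  define D where "D i = (\<integral>\<^sup>+v\<in>R. ennreal (truncated_dual N i v) \<partial>lebesgue)" for i
  have loc: "locally_integrable (f i)" for i
  proof -
    have fin: "emeasure lebesgue R < \<infinity>"
      using fmeasurableD2[OF RL] unfolding infinity_ennreal_def by (rule top.not_eq_extremum[THEN iffD1])
    have "integrable lebesgue (f i)"
    proof (rule Bochner_Integration.integrable_bound)
      show "integrable lebesgue (\<lambda>v. (1 / real (Suc N)) powr (- conj_exp (p i)) * indicator R v)"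
        by (intro integrable_mult_right integrable_real_indicator fin) measurable
      show "AE v in lebesgue. norm (f i v) \<le> norm ((1 / real (Suc N)) powr (- conj_exp (p i)) * indicator R v)"
        using truncated_dual_le[of N i] truncated_dual_pos[of N i]
        by (intro AE_I2) (auto simp: f_def indicator_def abs_of_pos)
    qed (simp add: f_def[abs_def])
    then show ?thesis
      unfolding locally_integrable_def set_integrable_def
      using integrable_mult_indicator[OF fmeasurableD[OF lmeasurable_compact]] by blast
  qed
  have uf: "(\<integral>\<^sup>+v\<in>R. ennreal \<bar>f i v\<bar> \<partial>lebesgue) = D i" for i
    unfolding D_def using truncated_dual_pos[of N i]
    by (intro nn_integral_cong) (auto simp: f_def indicator_def abs_of_pos)
  have Dtop: "D i \<noteq> top" for i
    using locally_integrable_finite[OF loc R(2), of i] by (simp add: uf)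
  have D0: "D i \<noteq> 0" for i
  proof
    assume "D i = 0"
    then have "AE v in lebesgue. ennreal (truncated_dual N i v) * indicator R v = 0"
      unfolding D_def by (subst (asm) nn_integral_0_iff_AE) auto
    then have "AE v in lebesgue. v \<notin> R"
    proof eventually_elim
      case (elim v)
      then show ?case
        using truncated_dual_pos[of N i v] by (auto simp: ennreal_eq_0_iff not_le)
    qed
    then have "emeasure lebesgue R = 0"
      by (subst (asm) AE_iff_measurable[of R]) auto
    then show False using \<mu> by (simp add: \<mu>_def measure_def)
  qed
  have norm: "weighted_power i (f i) \<le> D i" for i
    unfolding weighted_power_def D_def
  proof (intro nn_integral_mono)
    fix v
    show "epowr (ennreal \<bar>f i v\<bar>) (p i) * epowr (ennreal (\<omega> i v)) (p i) \<le> ennreal (truncated_dual N i v) * indicator R v"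
      using truncated_dual_test[of N i v] truncated_dual_pos[of N i v] \<omega>_nonneg[of i v] p_pos[of i]
      by (cases "v \<in> R") (simp_all add: f_def epowr_ennreal ennreal_mult[symmetric] ennreal_leI abs_of_pos)
  qed
  define V where "V = epowr (target_mass R) (1 / q)"
  define X where "X = (\<Prod>i\<in>UNIV. D i) * ennreal (\<mu> powr (- \<kappa>))"
  have "X \<noteq> 0" "X \<noteq> top"
    using D0 Dtop \<mu> by (auto simp: X_def ennreal_mult_eq_top_iff ennreal_prod_eq_top)
  then obtain l where l: "X = ennreal l" "0 < l" by (cases X) (auto simp: less_le)
  \<comment> \<open>superlevel sets are defined by a strict inequality, so the level is taken below the lower bound \<open>l\<close>\<close>
  have maximal: "ennreal (l / 2) < frac_maximal \<B> \<alpha> f v" if "v \<in> R" for v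
  proof -
    have "ennreal (l / 2) < X" using l by (simp add: ennreal_lessI)
    also have "X = (\<Prod>i\<in>UNIV. (\<integral>\<^sup>+y\<in>R. ennreal \<bar>f i y\<bar> \<partial>lebesgue) /
       ennreal (measure lebesgue R powr (1 - \<alpha> / (real CARD('m) * real CARD('n)))))"
      by (simp only: X_def uf \<mu>_def[symmetric] fractional_product[OF \<mu>])
    also have "\<dots> \<le> frac_maximal \<B> \<alpha> f v"
      unfolding frac_maximal_def using that R(1) by (intro SUP_upper) auto
    finally show ?thesis .
  qed
  have "ennreal (l / 2) * V \<le> ennreal (l / 2) *
        epowr (\<integral>\<^sup>+x\<in>{x. frac_maximal \<B> \<alpha> f x > ennreal (l / 2)}. target x \<partial>lebesgue) (1 / q)"
    unfolding V_def target_mass_def using q_pos maximal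
    by (intro mult_left_mono epowr_mono nn_integral_mono) (auto simp: indicator_def)
  also have "\<dots> \<le> weak_Lnorm q target (frac_maximal \<B> \<alpha> f)"
    unfolding weak_Lnorm_def using l by (intro SUP_upper) auto
  also have "\<dots> \<le> ennreal C * (\<Prod>i\<in>UNIV. epowr (weighted_power i (f i)) (1 / p i))"
    by (rule C) (rule loc)
  also have "\<dots> \<le> ennreal (max 0 C) * (\<Prod>i\<in>UNIV. epowr (D i) (1 / p i))"
    using p_pos norm by (intro mult_mono ennreal_leI prod_mono_ennreal epowr_mono) (auto intro: less_imp_le)
  finally have "2 * (ennreal (l / 2) * V) \<le> 2 * (ennreal (max 0 C) * (\<Prod>i\<in>UNIV. epowr (D i) (1 / p i)))"
    by (rule mult_left_mono) simp
  moreover have "2 * ennreal (l / 2) = X"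
    using l ennreal_mult[of 2 "l / 2"] by simp
  moreover have "2 * ennreal (max 0 C) = ennreal (2 * max 0 C)"
    by (simp add: ennreal_mult)
  ultimately have XV: "X * V \<le> ennreal (2 * max 0 C) * (\<Prod>i\<in>UNIV. epowr (D i) (1 / p i))"
    by (simp add: mult.assoc[symmetric])
  define W where "W = (\<Prod>i\<in>UNIV. epowr (D i) (- (1 / p i)))"
  have W1: "(\<Prod>i\<in>UNIV. epowr (D i) (1 / p i)) * W = 1"
    unfolding W_def prod.distrib[symmetric] by (simp only: epowr_cancel_eq[OF Dtop D0] prod.neutral_const)
  have W2: "(\<Prod>i\<in>UNIV. D i) * W = (\<Prod>i\<in>UNIV. epowr (D i) (1 - 1 / p i))"
    unfolding W_def prod.distrib[symmetric]
  proof (intro prod.cong refl)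
    fix i
    obtain d where "D i = ennreal d" "0 < d"
      using D0[of i] Dtop[of i] by (cases "D i") (auto simp: less_le)
    then show "D i * epowr (D i) (- (1 / p i)) = epowr (D i) (1 - 1 / p i)"
      using powr_add[of d 1 "- (1 / p i)"] by (simp add: epowr_ennreal_pos ennreal_mult[symmetric])
  qed
  have one: "ennreal (\<mu> powr (- \<kappa>)) * ennreal (\<mu> powr \<kappa>) = 1"
    using \<mu> by (simp add: ennreal_mult[symmetric] powr_add[symmetric])
  have "V * (\<Prod>i\<in>UNIV. epowr (D i) (1 - 1 / p i)) = X * V * (W * ennreal (\<mu> powr \<kappa>))"
  proof -
    have "X * V * (W * ennreal (\<mu> powr \<kappa>)) = V * ((\<Prod>i\<in>UNIV. D i) * W) * (ennreal (\<mu> powr (- \<kappa>)) * ennreal (\<mu> powr \<kappa>))"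
      by (simp only: X_def mult_ac)
    then show ?thesis by (simp only: W2 one mult_1_right)
  qed
  also have "\<dots> \<le> ennreal (2 * max 0 C) * (\<Prod>i\<in>UNIV. epowr (D i) (1 / p i)) * (W * ennreal (\<mu> powr \<kappa>))"
    by (rule mult_right_mono[OF XV]) simp
  also have "\<dots> = ennreal (2 * max 0 C) * ((\<Prod>i\<in>UNIV. epowr (D i) (1 / p i)) * W) * ennreal (\<mu> powr \<kappa>)"
    by (simp only: mult_ac)
  also have "\<dots> = ennreal (2 * max 0 C) * ennreal (\<mu> powr \<kappa>)"
    by (simp only: W1 mult_1_right)
  finally show ?thesis by (simp only: V_def D_def \<mu>_def)
qed

text \<open>
  Monotone convergence removes the truncation.
\<close>

lemma weak_type_imp_A_class:
  assumes \<B>: "\<B> \<subseteq> rectangles" and weak: "weak_type_bound \<B> \<alpha> p q \<omega>"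
  shows "\<omega> \<in> A_class \<B> p q"
proof -
  obtain C where C: "\<And>f. (\<And>i. locally_integrable (f i)) \<Longrightarrow>
        weak_Lnorm q target (frac_maximal \<B> \<alpha> f) \<le> ennreal C * (\<Prod>i\<in>UNIV. epowr (weighted_power i (f i)) (1 / p i))"
    using weak unfolding weak_type_bound_def Lnorm_eq target_def[abs_def, symmetric] by blast
  define K where "K = max 1 (2 * max 0 C)"
  have "weight_bound K R" if R: "R \<in> \<B>" for R
  proof -
    have RR: "R \<in> rectangles" using R \<B> by blast
    have [measurable]: "R \<in> sets lebesgue" using rectangles_lmeasurable[OF RR] by blast
    define D where "D i N = (\<integral>\<^sup>+v\<in>R. ennreal (truncated_dual N i v) \<partial>lebesgue)" for i N
    have inc: "incseq (D i)" for i
      unfolding D_def incseq_def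
      by (auto intro!: nn_integral_mono mult_right_mono ennreal_leI truncated_dual_mono)
    have "dual_mass i R = (\<integral>\<^sup>+v. (SUP N. ennreal (truncated_dual N i v) * indicator R v) \<partial>lebesgue)" for i
      unfolding dual_mass_def SUP_truncated_dual[symmetric] by (simp only: SUP_mult_right_ennreal)
    also have "\<dots> i = (SUP N. D i N)" for i
      unfolding D_def
      by (rule nn_integral_monotone_convergence_SUP)
        (auto simp: incseq_def le_fun_def intro!: mult_right_mono ennreal_leI truncated_dual_mono)
    finally have SUP: "dual_mass i R = (SUP N. D i N)" for i .
    have "(\<Prod>i\<in>UNIV. epowr (dual_mass i R) (1 - 1 / p i)) \<le> (\<Prod>i\<in>UNIV. SUP N. epowr (D i N) (1 - 1 / p i))"
      unfolding SUP using dual_exponent(4) by (intro prod_mono_ennreal epowr_SUP_le)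
    also have "\<dots> = (SUP N. \<Prod>i\<in>UNIV. epowr (D i N) (1 - 1 / p i))"
    proof (rule SUP_prod_incseq)
      show "incseq (\<lambda>N. epowr (D i N) (1 - 1 / p i))" for i
        using inc[of i] less_imp_le[OF dual_exponent(4)[of i]] unfolding incseq_def by (blast intro: epowr_mono)
    qed simp
    finally have "epowr (target_mass R) (1 / q) * (\<Prod>i\<in>UNIV. epowr (dual_mass i R) (1 - 1 / p i))
       \<le> (SUP N. epowr (target_mass R) (1 / q) * (\<Prod>i\<in>UNIV. epowr (D i N) (1 - 1 / p i)))"
      unfolding SUP_mult_left_ennreal[symmetric] by (rule mult_left_mono) simp
    also have "\<dots> \<le> ennreal (2 * max 0 C) * ennreal (measure lebesgue R powr \<kappa>)"
      unfolding D_def by (intro SUP_least truncated_weight_bound[OF R RR] C)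
    also have "\<dots> \<le> ennreal K * ennreal (measure lebesgue R powr \<kappa>)"
      unfolding K_def by (intro mult_right_mono ennreal_leI) auto
    finally show ?thesis by (simp add: weight_bound_def)
  qed
  then show ?thesis
    using A_class_iff[OF \<B>] by (auto simp: K_def intro!: exI[of _ K])
qed

end

section \<open>The characterization\<close>

theorem theorem2p2:
  fixes \<alpha> P q :: real
    and p :: "'m::finite \<Rightarrow> real"
    and \<omega> :: "'m \<Rightarrow> real ^ 'n \<Rightarrow> real"
  assumes "0 < \<alpha>" and "\<alpha> < real CARD('m) * real CARD('n)"
    and "\<And>i. 1 < p i"
    and "1 / P = (\<Sum>i\<in>UNIV. 1 / p i)"
    and "P < q"
    and "1 / q = 1 / P - \<alpha> / real CARD('n)"
    and "\<And>i. weight (\<omega> i)"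
  shows "(\<omega> \<in> A_class rectangles p q \<longleftrightarrow> weak_type_bound rectangles \<alpha> p q \<omega>) \<and>
         (\<omega> \<in> A_class rectangles p q \<longleftrightarrow> strong_type_bound rectangles \<alpha> p q \<omega>) \<and>
         (\<omega> \<in> A_class dyadic_rectangles p q \<longleftrightarrow> weak_type_bound dyadic_rectangles \<alpha> p q \<omega>) \<and>
         (\<omega> \<in> A_class dyadic_rectangles p q \<longleftrightarrow> strong_type_bound dyadic_rectangles \<alpha> p q \<omega>)"
proof -
  interpret fractional_weights \<alpha> P q p \<omega>
    by unfold_locales (fact assms)+
  have dyadic: "dyadic_rectangles \<subseteq> (rectangles :: (real ^ 'n) set set)"
    by (auto simp: dyadic_rectangles_eq dyadic_block_rectangles)
  show ?thesis
    using strong_type_imp_weak_type[OF q_pos] weak_type_imp_A_class[OF order_refl] weak_type_imp_A_class[OF dyadic]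
      A_rectangles_imp_strong A_dyadic_imp_strong by blast
qed

end
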